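(* Let $\mathcal{G}$ be any fixed finite group with $|\mathcal{G}|\geq 2$ and let $c>0$ be any constant. For any $k\leq n/2$, there is a deterministic polynomial-time algorithm which, given as input a generating set of a subgroup $\mathcal{H}$ of $\mathcal{G}^n$ with $\delta(\mathcal{H})\leq k$ and a number $r\leq\frac{cn\log k}{k}$, outputs $x\in\mathcal{G}^n$ with $x\notin B(\mathcal{H},r)$. In the paper's terminology: the Remote Point Problem over $\mathcal{G}$ has a polynomial time $(k,\frac{cn\log k}{k})$-algorithm for any $k\leq n/2$.
   Context: For $x,y\in\mathcal{G}^n$, $\Delta(x,y)=|\{i: x_i\neq y_i\}|$ and $\Delta(x,S)=\min_{y\in S}\Delta(x,y)$. $wt(x)$ is the number of coordinates $i$ with $x_i\neq 1$; $B(r)=\{x\in\mathcal{G}^n: wt(x)\leq r\}$ and $B(S,r)=\{sx: s\in S, x\in B(r)\}$, so $x\in B(S,r)$ iff $\Delta(x,S)\leq r$. For a subgroup $\mathcal{H}\leq\mathcal{G}^n$, $\delta(\mathcal{H})=\log_{|\mathcal{G}|}|\mathcal{H}|$. The Remote Point Problem over $\mathcal{G}$: given a subgroup $\mathcal{H}$ of $\mathcal{G}^n$ by generators and $r\in\mathbb{N}$, output $x\in\mathcal{G}^n$ with $x\notin B(\mathcal{H},r)$. A $(k(n),r(n))$-algorithm solves it on all inputs with $\delta(\mathcal{H})\leq k(n)$ and $r\leq r(n)$.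
   Formalization: As stated the claim fails for small k (c=4, k=2, r=n gives B(H,r)=G^n); the formal version requires a correct output only if some x outside B(H,r) exists, and proves that such x always exists once k exceeds a constant depending only on G and c. *)

theory Defs
  imports Complex_Main
    "HOL-Algebra.Coset" "HOL-Algebra.Generated_Groups" "HOL-Algebra.Product_Groups"
    "HOL-Computational_Algebra.Polynomial"
begin

section \<open>The Hamming geometry of a power of a group\<close>

abbreviation power_group :: "('a, 'm) monoid_scheme \<Rightarrow> nat \<Rightarrow> (nat \<Rightarrow> 'a) monoid" where
  "power_group G n \<equiv> product_group {..<n} (\<lambda>_. G)"

definition wt :: "('a, 'm) monoid_scheme \<Rightarrow> nat \<Rightarrow> (nat \<Rightarrow> 'a) \<Rightarrow> nat" where
  "wt G n x = card {i \<in> {..<n}. x i \<noteq> \<one>\<^bsub>G\<^esub>}"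

definition weight_ball :: "('a, 'm) monoid_scheme \<Rightarrow> nat \<Rightarrow> nat \<Rightarrow> (nat \<Rightarrow> 'a) set" where
  "weight_ball G n r = {x \<in> carrier (power_group G n). wt G n x \<le> r}"

definition ball_around ::
  "('a, 'm) monoid_scheme \<Rightarrow> nat \<Rightarrow> (nat \<Rightarrow> 'a) set \<Rightarrow> nat \<Rightarrow> (nat \<Rightarrow> 'a) set" where
  "ball_around G n S r = S <#>\<^bsub>power_group G n\<^esub> weight_ball G n r"

definition delta :: "('a, 'm) monoid_scheme \<Rightarrow> (nat \<Rightarrow> 'a) set \<Rightarrow> real" where
  "delta G H = log (real (card (carrier G))) (real (card H))"


section \<open>Deterministic polynomial time\<close>

text \<open>
  The machine model is the WHILE language of N. D. Jones (Computability and Complexity from a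
  Programming Perspective, MIT Press 1997), whose only data are binary trees with one kind of
  leaf. The cost of an expression or command is the number of operations performed. There is no
  unit-cost arithmetic, and no equality test except for being a leaf. Since a run of \<open>t\<close> steps
  allocates at most \<open>t\<close> new tree nodes (trees are shared, never copied), this model and
  the Turing machine simulate each other with polynomial overhead.
\<close>

datatype tree = Leaf | Node tree tree

text \<open>Selecting a component of a leaf yields a leaf, so that every expression has a value.\<close>

primrec left_of :: "tree \<Rightarrow> tree" where
  "left_of Leaf = Leaf"
| "left_of (Node l r) = l"

primrec right_of :: "tree \<Rightarrow> tree" where
  "right_of Leaf = Leaf"
| "right_of (Node l r) = r"

datatype expr = Var nat | LeafE | NodeE expr expr | LeftE expr | RightE expr

datatype com =
    Assign nat expr
  | Seq com com
  | If expr com com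
  | While expr com

type_synonym store = "nat \<Rightarrow> tree"

primrec eval_expr :: "expr \<Rightarrow> store \<Rightarrow> tree" where
  "eval_expr (Var v) s = s v"
| "eval_expr LeafE s = Leaf"
| "eval_expr (NodeE a b) s = Node (eval_expr a s) (eval_expr b s)"
| "eval_expr (LeftE a) s = left_of (eval_expr a s)"
| "eval_expr (RightE a) s = right_of (eval_expr a s)"

primrec expr_cost :: "expr \<Rightarrow> nat" where
  "expr_cost (Var v) = 1"
| "expr_cost LeafE = 1"
| "expr_cost (NodeE a b) = 1 + expr_cost a + expr_cost b"
| "expr_cost (LeftE a) = 1 + expr_cost a"
| "expr_cost (RightE a) = 1 + expr_cost a"

text \<open>\<open>runs c s t s'\<close>: started in store \<open>s\<close>, the command \<open>c\<close> halts after exactly \<open>t\<close> steps in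
  store \<open>s'\<close>. A leaf plays the role of false.\<close>

inductive runs :: "com \<Rightarrow> store \<Rightarrow> nat \<Rightarrow> store \<Rightarrow> bool" where
  Assign: "runs (Assign v a) s (1 + expr_cost a) (s(v := eval_expr a s))"
| Seq: "runs c1 s t1 s' \<Longrightarrow> runs c2 s' t2 s'' \<Longrightarrow> runs (Seq c1 c2) s (1 + t1 + t2) s''"
| IfTrue: "eval_expr a s \<noteq> Leaf \<Longrightarrow> runs c1 s t s' \<Longrightarrow>
    runs (If a c1 c2) s (1 + expr_cost a + t) s'"
| IfFalse: "eval_expr a s = Leaf \<Longrightarrow> runs c2 s t s' \<Longrightarrow>
    runs (If a c1 c2) s (1 + expr_cost a + t) s'"
| WhileFalse: "eval_expr a s = Leaf \<Longrightarrow> runs (While a c) s (1 + expr_cost a) s"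
| WhileTrue: "eval_expr a s \<noteq> Leaf \<Longrightarrow> runs c s t1 s' \<Longrightarrow> runs (While a c) s' t2 s'' \<Longrightarrow>
    runs (While a c) s (1 + expr_cost a + t1 + t2) s''"

inductive_cases runs_AssignE: "runs (Assign v a) s t s'"
inductive_cases runs_SeqE: "runs (Seq v a) s t s'"
inductive_cases runs_IfE: "runs (If a v b) s t s'"
inductive_cases runs_WhileE: "runs (While v a) s t s'"

lemma runs_deterministic: "runs c s t s' \<Longrightarrow> runs c s u s'' \<Longrightarrow> t = u \<and> s' = s''"
proof (induction arbitrary: u s'' rule: runs.induct)
  case (Assign v a s)
  from Assign.prems show ?case by (elim runs_AssignE) simp
next
  case (Seq c1 s t1 s' c2 t2 s3)
  from Seq.prems show ?case by (elim runs_SeqE) (auto dest!: Seq.IH)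
next
  case (IfTrue a s c1 t s' c2)
  from IfTrue.prems show ?case by (elim runs_IfE) (use IfTrue.hyps in \<open>auto dest!: IfTrue.IH\<close>)
next
  case (IfFalse a s c1 t s' c2)
  from IfFalse.prems show ?case by (elim runs_IfE) (use IfFalse.hyps in \<open>auto dest!: IfFalse.IH\<close>)
next
  case (WhileFalse a s c)
  from WhileFalse.prems show ?case by (rule runs_WhileE) (use WhileFalse.hyps in simp_all)
next
  case (WhileTrue a s c t1 s' t2 s3)
  from WhileTrue.prems show ?case by (rule runs_WhileE) (use WhileTrue.hyps in \<open>auto dest!: WhileTrue.IH\<close>)
qed

text \<open>Input and output are held in variable 0; all other variables are initially empty.\<close>

definition computes_in :: "com \<Rightarrow> tree \<Rightarrow> nat \<Rightarrow> tree \<Rightarrow> bool" where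
  "computes_in P input t output \<longleftrightarrow>
     (\<exists>s'. runs P ((\<lambda>_. Leaf)(0 := input)) t s' \<and> s' 0 = output)"


section \<open>Encoding of instances\<close>

fun enc_list :: "tree list \<Rightarrow> tree" where
  "enc_list [] = Leaf"
| "enc_list (t # ts) = Node t (enc_list ts)"

definition enc_unary :: "nat \<Rightarrow> tree" where
  "enc_unary n = enc_list (replicate n Leaf)"

text \<open>Binary digits, least significant first; the digit 1 is \<open>Node Leaf Leaf\<close>, 0 is \<open>Leaf\<close>.\<close>

fun enc_binary :: "nat \<Rightarrow> tree" where
  "enc_binary n = (if n = 0 then Leaf
     else Node (if odd n then Node Leaf Leaf else Leaf) (enc_binary (n div 2)))"

declare enc_binary.simps [simp del]

text \<open>In the following, \<open>e\<close> assigns to every element of the (fixed, finite) group \<open>G\<close> its code.\<close>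

definition enc_vec :: "('a \<Rightarrow> tree) \<Rightarrow> nat \<Rightarrow> (nat \<Rightarrow> 'a) \<Rightarrow> tree" where
  "enc_vec e n x = enc_list (map (\<lambda>i. e (x i)) [0..<n])"

text \<open>The dimension \<open>n\<close> is written in unary, because the output has length \<open>n\<close> and the list of
  generators may be empty; the radius is written in binary.\<close>

definition enc_instance :: "('a \<Rightarrow> tree) \<Rightarrow> nat \<Rightarrow> (nat \<Rightarrow> 'a) list \<Rightarrow> nat \<Rightarrow> tree" where
  "enc_instance e n gens r =
     Node (enc_unary n) (Node (enc_list (map (enc_vec e n) gens)) (enc_binary r))"


section \<open>Algorithms for the Remote Point Problem\<close>

text \<open>
  \<open>P\<close> is a polynomial-time \<open>(k(n), \<rho>(n))\<close>-algorithm. It runs in polynomial time on every instance;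
  on every instance within the bounds it has to output a point outside the ball. As usual for a
  search problem, nothing is required of the output if there is no such point, i.e. if the ball
  is all of \<open>G\<^sup>n\<close>.
\<close>

definition rpp_algorithm ::
  "('a, 'm) monoid_scheme \<Rightarrow> ('a \<Rightarrow> tree) \<Rightarrow> (nat \<Rightarrow> real) \<Rightarrow> (nat \<Rightarrow> real) \<Rightarrow> com \<Rightarrow> bool" where
  "rpp_algorithm G e k \<rho> P \<longleftrightarrow>
     (\<exists>p :: nat poly. \<forall>n gens r. set gens \<subseteq> carrier (power_group G n) \<longrightarrow>
       (\<exists>t output.
          computes_in P (enc_instance e n gens r) t output \<and>
          t \<le> poly p (size (enc_instance e n gens r)) \<and>
          (let H = generate (power_group G n) (set gens) in
             delta G H \<le> k n \<and> real r \<le> \<rho> n \<and>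
             (\<exists>x \<in> carrier (power_group G n). x \<notin> ball_around G n H r) \<longrightarrow>
             (\<exists>x \<in> carrier (power_group G n). output = enc_vec e n x \<and> x \<notin> ball_around G n H r))))"

end

theory Submission
  imports Defs
begin

text \<open>
  The algorithm ignores the radius and the bound \<open>k\<close>, and outputs a point that is remote enough for
  every admissible choice of them. From the generators it computes a strong generating set \<open>R\<close> of
  \<open>H\<close>, by sifting; up to constant factors its length is \<open>\<delta>(H)\<close>.

  If \<open>R\<close> is long, the coordinates are cut into blocks of length \<open>b = min n (2 \<cdot> |R|)\<close>, which are
  treated separately. In a block, let \<open>m = O(log b)\<close>. An error set of size \<open>m / 8\<close> meets few of the
  residue classes modulo \<open>m\<close>, so it suffices that for every union \<open>T\<close> of residue classes that covers
  most of the block the restriction of the output to \<open>T\<close> is not in the restriction of \<open>H\<close>. There are only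
  \<open>2\<^sup>m\<close>, i.e. polynomially many, such \<open>T\<close>. The output is chosen greedily, coordinate by coordinate:
  where the next coordinate of \<open>H\<close> restricted to \<open>T\<close> is confined to a coset of a proper subgroup of
  \<open>G\<close>, at most half of the choices keep \<open>T\<close> alive, and the survivors are duplicated. With the choice
  that minimizes the number of copies this number never increases, whereas a \<open>T\<close> that is never escaped
  ends with more than \<open>2\<^sup>m\<close> copies.

  If \<open>R\<close> is short, \<open>H\<close> has boundedly many elements, and a farthest point is found exactly by dynamic
  programming over the vectors of distances to the elements of \<open>H\<close>. This case cannot be avoided,
  because \<open>c\<close> is arbitrary and \<open>k\<close> may be bounded.
\<close>

section \<open>Polynomial-time functions on encoded data\<close>

text \<open>Neither \<open>k\<close> nor a real logarithm is available to the machine, yet a block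
  needs length at least \<open>2 * \<delta>\<close>. The length of a strong generating set is the
  substitute: with \<open>q = |G|\<close> it lies between \<open>\<delta>\<close> and
  \<open>q^2 * \<delta>\<close>. Since \<open>log x / x\<close> decreases for
  \<open>x \<ge> 3\<close>, a distance guaranteed in terms of \<open>\<delta>\<close> suffices for
  every \<open>k \<ge> \<delta>\<close>. The lost factor \<open>q^2\<close>, like the arbitrary
  constant \<open>c\<close>, is absorbed by the number \<open>m\<close> of residue classes, that is,
  by the degree of the polynomial bounding \<open>2 ^ m\<close>. The escape argument is a count. The
  restriction of \<open>H\<close> to \<open>T\<close> has at most \<open>q ^ \<delta>\<close>
  elements, and every coordinate that is free, given the earlier ones, contributes a factor
  \<open>q\<close>. Hence all but \<open>\<delta>\<close> coordinates in \<open>T\<close> are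
  confined, and a \<open>T\<close> that is never escaped ends with at least
  \<open>2 ^ (|T| - \<delta>)\<close> copies, too many if \<open>|T| > \<delta> + m\<close>. The
  minimizing choice is the method of conditional expectations, with copies in place of numerical
  weights. \<open>k \<le> n / 2\<close> ensures that a block of length \<open>2 * \<delta>\<close>
  fits. Once \<open>k\<close> exceeds a constant, the same construction proves that remote points
  exist.\<close>

class encodable =
  fixes encode :: "'a \<Rightarrow> tree"

instantiation tree :: encodable begin
definition encode_tree :: "tree \<Rightarrow> tree" where [simp]: "encode_tree t = t"
instance ..
end

instantiation bool :: encodable begin
definition encode_bool :: "bool \<Rightarrow> tree" where "encode_bool b = (if b then Node Leaf Leaf else Leaf)"
instance ..
end

text \<open>Unary coding makes every value polynomial in the size of its code, so that a
  \<open>nat\<close> may serve as a loop count. The binary radius of an instance is carried as a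
  plain \<open>tree\<close>.\<close>

instantiation nat :: encodable begin
definition encode_nat :: "nat \<Rightarrow> tree" where "encode_nat n = enc_unary n"
instance ..
end

instantiation prod :: (encodable, encodable) encodable begin
definition encode_prod :: "'a \<times> 'b \<Rightarrow> tree" where "encode_prod p = Node (encode (fst p)) (encode (snd p))"
instance ..
end

instantiation list :: (encodable) encodable begin
definition encode_list :: "'a list \<Rightarrow> tree" where "encode_list xs = enc_list (map encode xs)"
instance ..
end

lemma encode_Pair [simp]: "encode (a, b) = Node (encode a) (encode b)"
  by (simp add: encode_prod_def)

lemma encode_Nil [simp]: "encode [] = Leaf"
  and encode_Cons [simp]: "encode (x # xs) = Node (encode x) (encode xs)"
  by (simp_all add: encode_list_def)

lemma encode_0 [simp]: "encode (0 :: nat) = Leaf"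
  and encode_Suc [simp]: "encode (Suc n) = Node Leaf (encode n)"
  by (simp_all add: encode_nat_def enc_unary_def)

lemma encode_True [simp]: "encode True = Node Leaf Leaf"
  and encode_False [simp]: "encode False = Leaf"
  by (simp_all add: encode_bool_def)

lemma size_encode_nat [simp]: "size (encode (n :: nat)) = n"
  by (induction n) auto

lemma size_encode_list: "size (encode xs) = (\<Sum>x\<leftarrow>xs. size (encode x) + 1)"
  by (induction xs) auto

lemma length_le_size_encode: "length xs \<le> size (encode xs)"
  by (induction xs) auto

lemma size_encode_member: "x \<in> set xs \<Longrightarrow> size (encode x) < size (encode xs)"
  by (induction xs) auto

lemma size_encode_list_le:
  assumes "\<And>x. x \<in> set xs \<Longrightarrow> size (encode x) \<le> B" "length xs \<le> N"
  shows "size (encode xs) \<le> N * (B + 1)"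
proof -
  have "size (encode xs) \<le> length xs * (B + 1)"
    using assms(1) by (induction xs) force+
  also have "\<dots> \<le> N * (B + 1)" using assms(2) by (rule mult_le_mono1)
  finally show ?thesis .
qed

text \<open>Natural coefficients make every polynomial monotone, so a bound may be evaluated at an
  overestimate of the size.\<close>

lemma poly_nat_mono: "a \<le> b \<Longrightarrow> poly (p :: nat poly) a \<le> poly p b"
  by (induction p) (auto intro!: add_mono mult_mono)

section \<open>Polynomial bounds in the size of the encoded argument\<close>

definition pbd :: "('a::encodable \<Rightarrow> nat) \<Rightarrow> bool" where
  "pbd f \<longleftrightarrow> (\<exists>p :: nat poly. \<forall>x. f x \<le> poly p (size (encode x)))"

lemma pbd_mono: "pbd g \<Longrightarrow> (\<And>x. f x \<le> g x) \<Longrightarrow> pbd f"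
  unfolding pbd_def by (meson le_trans)

named_theorems pbd_intros

lemma pbd_const [pbd_intros]: "pbd (\<lambda>_. c)"
  unfolding pbd_def by (rule exI[of _ "[:c:]"]) simp

lemma pbd_size [pbd_intros]: "pbd (\<lambda>x. size (encode x))"
  unfolding pbd_def by (rule exI[of _ "[:0, 1:]"]) simp

lemma pbd_add [pbd_intros]: "pbd f \<Longrightarrow> pbd g \<Longrightarrow> pbd (\<lambda>x. f x + g x)"
  unfolding pbd_def
proof (elim exE)
  fix p q :: "nat poly"
  assume "\<forall>x. f x \<le> poly p (size (encode x))" "\<forall>x. g x \<le> poly q (size (encode x))"
  then show "\<exists>p. \<forall>x. f x + g x \<le> poly p (size (encode x))"
    by (intro exI[of _ "p + q"]) (simp add: add_mono)
qed

lemma pbd_mult [pbd_intros]: "pbd f \<Longrightarrow> pbd g \<Longrightarrow> pbd (\<lambda>x. f x * g x)"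
  unfolding pbd_def
proof (elim exE)
  fix p q :: "nat poly"
  assume "\<forall>x. f x \<le> poly p (size (encode x))" "\<forall>x. g x \<le> poly q (size (encode x))"
  then show "\<exists>p. \<forall>x. f x * g x \<le> poly p (size (encode x))"
    by (intro exI[of _ "p * q"]) (simp add: mult_le_mono)
qed

lemma pbd_poly [pbd_intros]:
  assumes "pbd f" shows "pbd (\<lambda>x. poly (p :: nat poly) (f x))"
proof -
  from assms obtain q :: "nat poly" where q: "\<And>x. f x \<le> poly q (size (encode x))"
    unfolding pbd_def by blast
  have "poly p (f x) \<le> poly (pcompose p q) (size (encode x))" for x
    using poly_nat_mono[OF q] by (simp add: poly_pcompose)
  then show ?thesis unfolding pbd_def by blast
qed

lemma pbd_power [pbd_intros]: "pbd f \<Longrightarrow> pbd (\<lambda>x. f x ^ k)"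
  by (induction k) (auto intro!: pbd_intros)

section \<open>Programs on a stack of variables, and subroutine calls\<close>

definition stack :: "tree list \<Rightarrow> store" where
  "stack xs = (\<lambda>v. if v < length xs then xs ! v else Leaf)"

lemma stack_update: "v < length xs \<Longrightarrow> (stack xs)(v := t) = stack (xs[v := t])"
  by (auto simp: stack_def fun_eq_iff)

lemma stack_push: "v = length xs \<Longrightarrow> (stack xs)(v := t) = stack (xs @ [t])"
  by (auto simp: stack_def fun_eq_iff nth_append)

text \<open>An empty variable and an absent one give the same store; hence assigning
  \<open>LeafE\<close> to the last variable frees it.\<close>

lemma stack_pop: "stack (xs @ [Leaf]) = stack xs"
  by (auto simp: stack_def fun_eq_iff nth_append less_Suc_eq)

lemma stack_nth [simp]: "v < length xs \<Longrightarrow> stack xs v = xs ! v"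
  by (simp add: stack_def)

lemma stack_singleton: "stack [t] = (\<lambda>_. Leaf)(0 := t)"
  by (auto simp: stack_def fun_eq_iff)

primrec shift_expr :: "nat \<Rightarrow> expr \<Rightarrow> expr" where
  "shift_expr d (Var v) = Var (v + d)"
| "shift_expr d LeafE = LeafE"
| "shift_expr d (NodeE a b) = NodeE (shift_expr d a) (shift_expr d b)"
| "shift_expr d (LeftE a) = LeftE (shift_expr d a)"
| "shift_expr d (RightE a) = RightE (shift_expr d a)"

primrec shift_com :: "nat \<Rightarrow> com \<Rightarrow> com" where
  "shift_com d (Assign v a) = Assign (v + d) (shift_expr d a)"
| "shift_com d (Seq c1 c2) = Seq (shift_com d c1) (shift_com d c2)"
| "shift_com d (If a c1 c2) = If (shift_expr d a) (shift_com d c1) (shift_com d c2)"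
| "shift_com d (While a c) = While (shift_expr d a) (shift_com d c)"

lemma eval_shift_expr [simp]: "eval_expr (shift_expr d a) S = eval_expr a (\<lambda>v. S (v + d))"
  by (induction a) auto

lemma expr_cost_shift [simp]: "expr_cost (shift_expr d a) = expr_cost a"
  by (induction a) auto

text \<open>Renaming all variables upward by \<open>d\<close> turns a program into a subroutine that
  cannot touch the first \<open>d\<close> variables of its caller.\<close>

lemma runs_shift:
  "runs c s t s' \<Longrightarrow> s = (\<lambda>v. S (v + d)) \<Longrightarrow>
    \<exists>S'. runs (shift_com d c) S t S' \<and> s' = (\<lambda>v. S' (v + d)) \<and> (\<forall>v<d. S' v = S v)"
proof (induction arbitrary: S rule: runs.induct)
  case (Assign v a s)
  have "runs (shift_com d (Assign v a)) S (1 + expr_cost a) (S(v + d := eval_expr a s))"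
    using runs.Assign[of "v + d" "shift_expr d a" S] Assign by simp
  moreover have "s(v := eval_expr a s) = (\<lambda>w. (S(v + d := eval_expr a s)) (w + d))"
    by (subst (1) Assign) (simp add: fun_eq_iff)
  ultimately show ?case by (intro exI conjI) auto
next
  case (Seq c1 s t1 s' c2 t2 s'')
  from Seq.IH(1)[OF Seq.prems] obtain S1 where
    S1: "runs (shift_com d c1) S t1 S1" "s' = (\<lambda>v. S1 (v + d))" "\<forall>v<d. S1 v = S v" by blast
  from Seq.IH(2)[OF S1(2)] obtain S2 where
    S2: "runs (shift_com d c2) S1 t2 S2" "s'' = (\<lambda>v. S2 (v + d))" "\<forall>v<d. S2 v = S1 v" by blast
  have "runs (shift_com d (Seq c1 c2)) S (1 + t1 + t2) S2"
    using runs.Seq[OF S1(1) S2(1)] by simp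
  then show ?case using S1(3) S2(2,3) by (intro exI[of _ S2] conjI) simp_all
next
  case (IfTrue a s c1 t s' c2)
  from IfTrue.IH[OF IfTrue.prems] obtain S1 where
    S1: "runs (shift_com d c1) S t S1" "s' = (\<lambda>v. S1 (v + d))" "\<forall>v<d. S1 v = S v" by blast
  have "eval_expr (shift_expr d a) S \<noteq> Leaf"
    using IfTrue.hyps IfTrue.prems by simp
  from runs.IfTrue[OF this S1(1), of "shift_com d c2"]
  have "runs (shift_com d (If a c1 c2)) S (1 + expr_cost a + t) S1" by simp
  with S1(2,3) show ?case by blast
next
  case (IfFalse a s c2 t s' c1)
  from IfFalse.IH[OF IfFalse.prems] obtain S1 where
    S1: "runs (shift_com d c2) S t S1" "s' = (\<lambda>v. S1 (v + d))" "\<forall>v<d. S1 v = S v" by blast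
  have "eval_expr (shift_expr d a) S = Leaf"
    using IfFalse.hyps IfFalse.prems by simp
  from runs.IfFalse[OF this S1(1), of "shift_com d c1"]
  have "runs (shift_com d (If a c1 c2)) S (1 + expr_cost a + t) S1" by simp
  with S1(2,3) show ?case by blast
next
  case (WhileFalse a s c)
  have "eval_expr (shift_expr d a) S = Leaf"
    using WhileFalse.hyps WhileFalse.prems by simp
  from runs.WhileFalse[OF this, of "shift_com d c"]
  have "runs (shift_com d (While a c)) S (1 + expr_cost a) S" by simp
  with WhileFalse.prems show ?case by blast
next
  case (WhileTrue a s c t1 s' t2 s'')
  from WhileTrue.IH(1)[OF WhileTrue.prems] obtain S1 where
    S1: "runs (shift_com d c) S t1 S1" "s' = (\<lambda>v. S1 (v + d))" "\<forall>v<d. S1 v = S v" by blast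
  from WhileTrue.IH(2)[OF S1(2)] obtain S2 where
    S2: "runs (shift_com d (While a c)) S1 t2 S2" "s'' = (\<lambda>v. S2 (v + d))" "\<forall>v<d. S2 v = S1 v"
    by blast
  have "eval_expr (shift_expr d a) S \<noteq> Leaf"
    using WhileTrue.hyps WhileTrue.prems by simp
  from runs.WhileTrue[OF this S1(1)] S2(1)
  have "runs (shift_com d (While a c)) S (1 + expr_cost a + t1 + t2) S2" by simp
  then show ?case using S1(3) S2(2,3) by (intro exI[of _ S2] conjI) simp_all
qed

definition runs_le :: "com \<Rightarrow> tree list \<Rightarrow> nat \<Rightarrow> tree list \<Rightarrow> bool" where
  "runs_le c xs b ys \<longleftrightarrow> (\<exists>t\<le>b. runs c (stack xs) t (stack ys))"

lemma runs_le_shift: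
  assumes "runs_le c [x] b [y]" "d = length xs"
  shows "runs_le (shift_com d c) (xs @ [x]) b (xs @ [y])"
proof -
  from assms(1) obtain t where t: "t \<le> b" "runs c (stack [x]) t (stack [y])"
    unfolding runs_le_def by blast
  have "stack [x] = (\<lambda>v. stack (xs @ [x]) (v + d))"
    using assms(2) by (auto simp: stack_def fun_eq_iff nth_append)
  from runs_shift[OF t(2) this] obtain S' where
    S': "runs (shift_com d c) (stack (xs @ [x])) t S'" "stack [y] = (\<lambda>v. S' (v + d))"
      "\<forall>v<d. S' v = stack (xs @ [x]) v" by blast
  have "S' v = stack (xs @ [y]) v" for v
  proof (cases "v < d")
    case True
    then show ?thesis using S'(3) assms(2) by (auto simp: stack_def nth_append)
  next
    case False
    then have "S' v = stack [y] (v - d)" using fun_cong[OF S'(2), of "v - d"] by simp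
    then show ?thesis using False assms(2) by (auto simp: stack_def nth_append)
  qed
  then have "S' = stack (xs @ [y])" by blast
  with S'(1) t(1) show ?thesis unfolding runs_le_def by blast
qed

lemma runs_le_Assign:
  "(stack xs)(v := eval_expr a (stack xs)) = stack ys \<Longrightarrow> 1 + expr_cost a \<le> b \<Longrightarrow>
    runs_le (Assign v a) xs b ys"
  unfolding runs_le_def by (metis runs.Assign)

lemma runs_le_Seq:
  "runs_le c1 xs b1 ys \<Longrightarrow> runs_le c2 ys b2 zs \<Longrightarrow> 1 + b1 + b2 \<le> b \<Longrightarrow> runs_le (Seq c1 c2) xs b zs"
  unfolding runs_le_def by (meson add_le_mono le_refl le_trans runs.Seq)

lemma runs_le_IfTrue:
  "eval_expr a (stack xs) \<noteq> Leaf \<Longrightarrow> runs_le c1 xs b1 ys \<Longrightarrow> 1 + expr_cost a + b1 \<le> b \<Longrightarrow>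
    runs_le (If a c1 c2) xs b ys"
  unfolding runs_le_def by (meson add_le_mono le_refl le_trans runs.IfTrue)

lemma runs_le_IfFalse:
  "eval_expr a (stack xs) = Leaf \<Longrightarrow> runs_le c2 xs b2 ys \<Longrightarrow> 1 + expr_cost a + b2 \<le> b \<Longrightarrow>
    runs_le (If a c1 c2) xs b ys"
  unfolding runs_le_def by (meson add_le_mono le_refl le_trans runs.IfFalse)

lemma runs_le_WhileFalse:
  "eval_expr a (stack xs) = Leaf \<Longrightarrow> 1 + expr_cost a \<le> b \<Longrightarrow> runs_le (While a c) xs b xs"
  unfolding runs_le_def by (metis runs.WhileFalse)

lemma runs_le_WhileTrue:
  "eval_expr a (stack xs) \<noteq> Leaf \<Longrightarrow> runs_le c xs b1 ys \<Longrightarrow> runs_le (While a c) ys b2 zs \<Longrightarrow>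
    1 + expr_cost a + b1 + b2 \<le> b \<Longrightarrow> runs_le (While a c) xs b zs"
  unfolding runs_le_def by (meson add_le_mono le_refl le_trans runs.WhileTrue)

text \<open>A run of \<open>t\<close> steps can build a tree whose size is exponential in \<open>t\<close>, by sharing subtrees.
  For closure under composition the size of the output therefore has to be bounded as well.\<close>

definition ptime :: "('a::encodable \<Rightarrow> 'b::encodable) \<Rightarrow> bool" where
  "ptime f \<longleftrightarrow> (\<exists>c b. pbd b \<and>
     (\<forall>x. runs_le c [encode x] (b x) [encode (f x)] \<and> size (encode (f x)) \<le> b x))"

lemma runs_le_mono: "runs_le c xs b ys \<Longrightarrow> b \<le> b' \<Longrightarrow> runs_le c xs b' ys"
  unfolding runs_le_def using le_trans by blast

lemma ptimeI:
  assumes "pbd b" "pbd s" "\<And>x. runs_le c [encode x] (b x) [encode (f x)]" "\<And>x. size (encode (f x)) \<le> s x"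
  shows "ptime f"
  unfolding ptime_def
proof (intro exI conjI allI)
  show "pbd (\<lambda>x. b x + s x)" by (intro pbd_intros assms)
  show "runs_le c [encode x] (b x + s x) [encode (f x)]" for x
    using runs_le_mono[OF assms(3)] by simp
  show "size (encode (f x)) \<le> b x + s x" for x
    using assms(4)[of x] by simp
qed

text \<open>The bound is taken at any upper bound \<open>n\<close> of the input size, so that it
  applies to intermediate results whose size is only estimated.\<close>

definition realizes :: "com \<Rightarrow> nat poly \<Rightarrow> ('a::encodable \<Rightarrow> 'b::encodable) \<Rightarrow> bool" where
  "realizes c p f \<longleftrightarrow> (\<forall>x n. size (encode x) \<le> n \<longrightarrow>
     runs_le c [encode x] (poly p n) [encode (f x)] \<and> size (encode (f x)) \<le> poly p n)"

lemma realizesD: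
  assumes "realizes c p f" "size (encode x) \<le> n"
  shows "runs_le c [encode x] (poly p n) [encode (f x)]" "size (encode (f x)) \<le> poly p n"
  using assms by (auto simp: realizes_def)

lemma ptimeE:
  assumes "ptime f" obtains c p where "realizes c p f"
proof -
  from assms obtain c b where c: "pbd b" "\<And>x. runs_le c [encode x] (b x) [encode (f x)]"
    "\<And>x. size (encode (f x)) \<le> b x" unfolding ptime_def by blast
  then obtain p :: "nat poly" where p: "\<And>x. b x \<le> poly p (size (encode x))" unfolding pbd_def by blast
  have *: "b x \<le> poly p n" if "size (encode x) \<le> n" for x n
    using p[of x] poly_nat_mono[OF that] le_trans by blast
  have "realizes c p f"
    unfolding realizes_def using runs_le_mono[OF c(2) *] le_trans[OF c(3) *] by simp
  then show thesis by (rule that)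
qed

text \<open>Calling convention: the argument is copied to a fresh top variable, where the shifted
  program leaves its result; variable 0 keeps the argument for further calls.\<close>

lemma runs_le_push:
  assumes "realizes c p f" "d = Suc (length xs)"
  shows "runs_le (Seq (Assign d (Var 0)) (shift_com d c)) (encode x # xs)
    (poly p (size (encode x)) + 3) (encode x # xs @ [encode (f x)])"
proof (rule runs_le_Seq)
  show "runs_le (Assign d (Var 0)) (encode x # xs) 2 ((encode x # xs) @ [encode x])"
    by (rule runs_le_Assign) (simp_all add: stack_push assms(2) del: append_Cons)
  show "runs_le (shift_com d c) ((encode x # xs) @ [encode x]) (poly p (size (encode x)))
      (encode x # xs @ [encode (f x)])"
    using runs_le_shift[OF realizesD(1)[OF assms(1) order_refl], of d "encode x # xs" x] assms(2) by simp
qed simp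

lemma pbd_ptime: "ptime f \<Longrightarrow> pbd (\<lambda>x. size (encode (f x)))"
  unfolding ptime_def by (elim exE conjE, rule pbd_mono) auto

text \<open>\<open>ptime\<close> depends on a function only through the codes of its values, so the
  result type may be exchanged for another one with the same codes.\<close>

lemma ptime_encode_cong:
  assumes "ptime f" "\<And>x. encode (f x) = encode (g x)" shows "ptime g"
  using assms unfolding ptime_def by simp

lemma ptime_comp:
  assumes "ptime f" "ptime g" shows "ptime (\<lambda>x. g (f x))"
proof -
  obtain c p where c: "realizes c p f" by (rule ptimeE[OF assms(1)])
  obtain d q where d: "realizes d q g" by (rule ptimeE[OF assms(2)])
  note size = realizesD(2)[OF c order_refl]
  show ?thesis
  proof (rule ptimeI)
    show "runs_le (Seq c d) [encode x]
        (1 + poly p (size (encode x)) + poly q (poly p (size (encode x)))) [encode (g (f x))]" for x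
      by (rule runs_le_Seq[OF realizesD(1)[OF c order_refl] realizesD(1)[OF d size] order_refl])
    show "size (encode (g (f x))) \<le> poly q (poly p (size (encode x)))" for x
      by (rule realizesD(2)[OF d size])
  qed (intro pbd_intros)+
qed

section \<open>Constants, pairing, case distinction and loops\<close>

named_theorems ptime_intros

lemma ptime_id [ptime_intros]: "ptime (\<lambda>x. x)"
  by (rule ptimeI[where b = "\<lambda>_. 2" and c = "Assign 0 (Var 0)"])
    (auto intro!: pbd_intros runs_le_Assign simp: stack_def)

primrec tree_expr :: "tree \<Rightarrow> expr" where
  "tree_expr Leaf = LeafE"
| "tree_expr (Node l r) = NodeE (tree_expr l) (tree_expr r)"

lemma eval_tree_expr [simp]: "eval_expr (tree_expr t) s = t"
  by (induction t) auto

lemma ptime_const [ptime_intros]: "ptime (\<lambda>_. c)"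
  by (rule ptimeI[where b = "\<lambda>_. 1 + expr_cost (tree_expr (encode c))" and s = "\<lambda>_. size (encode c)"
        and c = "Assign 0 (tree_expr (encode c))"])
    (auto intro!: pbd_intros runs_le_Assign simp: stack_update)

lemma ptime_left_of: "ptime left_of"
proof (rule ptimeI[where b = "\<lambda>_. 3" and s = "\<lambda>x. size (encode x)" and c = "Assign 0 (LeftE (Var 0))"])
  show "size (encode (left_of x)) \<le> size (encode x)" for x by (cases x) auto
  show "runs_le (Assign 0 (LeftE (Var 0))) [encode x] 3 [encode (left_of x)]" for x
    by (rule runs_le_Assign) (simp_all add: stack_update)
qed (intro pbd_intros)+

lemma ptime_right_of: "ptime right_of"
proof (rule ptimeI[where b = "\<lambda>_. 3" and s = "\<lambda>x. size (encode x)" and c = "Assign 0 (RightE (Var 0))"])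
  show "size (encode (right_of x)) \<le> size (encode x)" for x by (cases x) auto
  show "runs_le (Assign 0 (RightE (Var 0))) [encode x] 3 [encode (right_of x)]" for x
    by (rule runs_le_Assign) (simp_all add: stack_update)
qed (intro pbd_intros)+

lemma ptime_encode: "ptime (encode :: 'a::encodable \<Rightarrow> tree)"
  by (rule ptime_encode_cong[OF ptime_id]) simp

lemma ptime_fst [ptime_intros]: "ptime f \<Longrightarrow> ptime (\<lambda>x. fst (f x))"
  by (rule ptime_encode_cong[OF ptime_comp[OF ptime_comp[OF _ ptime_encode] ptime_left_of]])
    (auto simp: encode_prod_def)

lemma ptime_snd [ptime_intros]: "ptime f \<Longrightarrow> ptime (\<lambda>x. snd (f x))"
  by (rule ptime_encode_cong[OF ptime_comp[OF ptime_comp[OF _ ptime_encode] ptime_right_of]])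
    (auto simp: encode_prod_def)

lemma ptime_Pair [ptime_intros]:
  assumes "ptime f" "ptime g" shows "ptime (\<lambda>x. (f x, g x))"
proof -
  obtain c p where c: "realizes c p f" by (rule ptimeE[OF assms(1)])
  obtain d q where d: "realizes d q g" by (rule ptimeE[OF assms(2)])
  show ?thesis
  proof (rule ptimeI)
    fix x
    let ?x = "encode x" and ?f = "encode (f x)" and ?g = "encode (g x)" and ?n = "size (encode x)"
    have 1: "runs_le (Seq (Assign 1 (Var 0)) (shift_com 1 c)) [?x] (poly p ?n + 3) [?x, ?f]"
      using runs_le_push[OF c, of 1 "[]" x] by simp
    have 2: "runs_le (Seq (Assign 2 (Var 0)) (shift_com 2 d)) [?x, ?f] (poly q ?n + 3) [?x, ?f, ?g]"
      using runs_le_push[OF d, of 2 "[?f]" x] by simp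
    have 3: "runs_le (Assign 0 (NodeE (Var 1) (Var 2))) [?x, ?f, ?g] 4 [Node ?f ?g, ?f, ?g]"
      by (rule runs_le_Assign) (auto simp: stack_update)
    have 4: "runs_le (Assign 2 LeafE) [Node ?f ?g, ?f, ?g] 2 [Node ?f ?g, ?f]"
      by (rule runs_le_Assign) (auto simp: stack_update stack_pop[of "[_, _]", simplified])
    have 5: "runs_le (Assign 1 LeafE) [Node ?f ?g, ?f] 2 [encode (f x, g x)]"
      by (rule runs_le_Assign) (auto simp: stack_update stack_pop[of "[_]", simplified])
    show "runs_le (Seq (Seq (Assign 1 (Var 0)) (shift_com 1 c)) (Seq (Seq (Assign 2 (Var 0)) (shift_com 2 d))
        (Seq (Assign 0 (NodeE (Var 1) (Var 2))) (Seq (Assign 2 LeafE) (Assign 1 LeafE)))))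
        [?x] (poly p ?n + poly q ?n + 18) [encode (f x, g x)]"
      by (rule runs_le_Seq[OF 1 runs_le_Seq[OF 2 runs_le_Seq[OF 3 runs_le_Seq[OF 4 5
              order_refl] order_refl] order_refl]]) simp
    show "size (encode (f x, g x)) \<le> poly p ?n + poly q ?n + 1"
      using realizesD(2)[OF c order_refl, of x] realizesD(2)[OF d order_refl, of x] by simp
  qed (intro pbd_intros)+
qed

lemma ptime_If [ptime_intros]:
  fixes b :: "'a::encodable \<Rightarrow> bool"
  assumes "ptime b" "ptime f" "ptime g" shows "ptime (\<lambda>x. if b x then f x else g x)"
proof -
  obtain a o' where a: "realizes a o' b" by (rule ptimeE[OF assms(1)])
  obtain c p where c: "realizes c p f" by (rule ptimeE[OF assms(2)])
  obtain d q where d: "realizes d q g" by (rule ptimeE[OF assms(3)])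
  let ?h = "\<lambda>x. if b x then f x else g x"
  show ?thesis
  proof (rule ptimeI)
    fix x :: 'a
    let ?x = "encode x" and ?n = "size (encode x)"
    have 1: "runs_le (Seq (Assign 1 (Var 0)) (shift_com 1 a)) [?x] (poly o' ?n + 3) [?x, encode (b x)]"
      using runs_le_push[OF a, of 1 "[]" x] by simp
    have 2: "runs_le (Assign 1 LeafE) [?x, encode (b x)] 2 [?x]"
      by (rule runs_le_Assign) (auto simp: stack_update stack_pop[of "[_]", simplified])
    have 3: "runs_le (If (Var 1) (Seq (Assign 1 LeafE) c) (Seq (Assign 1 LeafE) d)) [?x, encode (b x)]
        (5 + poly p ?n + poly q ?n) [encode (?h x)]"
    proof (cases "b x")
      case True
      show ?thesis unfolding if_P[OF True]
        by (rule runs_le_IfTrue[OF _ runs_le_Seq[OF 2 realizesD(1)[OF c order_refl] order_refl]])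
          (use True in simp_all)
    next
      case False
      show ?thesis unfolding if_not_P[OF False]
        by (rule runs_le_IfFalse[OF _ runs_le_Seq[OF 2 realizesD(1)[OF d order_refl] order_refl]])
          (use False in simp_all)
    qed
    show "runs_le (Seq (Seq (Assign 1 (Var 0)) (shift_com 1 a))
        (If (Var 1) (Seq (Assign 1 LeafE) c) (Seq (Assign 1 LeafE) d)))
        [?x] (poly o' ?n + poly p ?n + poly q ?n + 9) [encode (?h x)]"
      by (rule runs_le_Seq[OF 1 3]) simp
    show "size (encode (?h x)) \<le> poly p ?n + poly q ?n"
      using realizesD(2)[OF c order_refl, of x] realizesD(2)[OF d order_refl, of x] by simp
  qed (intro pbd_intros)+
qed

text \<open>A polynomial-time step may square the size of the accumulator in each round, so folding
  preserves polynomial time only under a bound on all intermediate accumulators. The size invariants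
  of the later parts serve this hypothesis.\<close>

lemma ptime_foldl:
  fixes l :: "'a::encodable \<Rightarrow> 'b::encodable list" and i :: "'a \<Rightarrow> 'c::encodable"
  assumes l: "ptime l" and i: "ptime i"
    and st: "ptime (\<lambda>p. step (fst p) (fst (snd p)) (snd (snd p)))"
    and b: "pbd b"
    and bound: "\<And>x j. size (encode (foldl (step x) (i x) (take j (l x)))) \<le> b x"
  shows "ptime (\<lambda>x. foldl (step x) (i x) (l x))"
proof -
  obtain a o' where a: "realizes a o' l" by (rule ptimeE[OF l])
  obtain c p where c: "realizes c p i" by (rule ptimeE[OF i])
  obtain d q where d: "realizes d q (\<lambda>p. step (fst p) (fst (snd p)) (snd (snd p)))" by (rule ptimeE[OF st])
  define body where "body = Seq (Assign 3 (NodeE (Var 0) (NodeE (Var 2) (LeftE (Var 1)))))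
    (Seq (shift_com 3 d) (Seq (Assign 2 (Var 3)) (Seq (Assign 3 LeafE) (Assign 1 (RightE (Var 1))))))"
  have loop: "runs_le (While (Var 1) body) [encode x, encode ys, encode s]
      (2 + length ys * (25 + poly q (size (encode x) + B + L + 2)))
      [encode x, Leaf, encode (foldl (step x) s ys)]"
    if "\<And>j. size (encode (foldl (step x) s (take j ys))) \<le> B" "size (encode ys) \<le> L" for x ys s B L
    using that
  proof (induction ys arbitrary: s)
    case Nil
    show ?case by (auto intro!: runs_le_WhileFalse simp: stack_def)
  next
    case (Cons y ys)
    let ?x = "encode x" and ?s = "encode s" and ?s' = "encode (step x s y)" and ?l = "encode (y # ys)"
    let ?q = "poly q (size (encode x) + B + L + 2)"
    let ?t = "Node ?x (Node ?s (encode y))"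
    have "size ?s \<le> B" using Cons.prems(1)[of 0] by simp
    then have sz: "size (encode (x, s, y)) \<le> size (encode x) + B + L + 2"
      using Cons.prems(2) by simp
    have 1: "runs_le (Assign 3 (NodeE (Var 0) (NodeE (Var 2) (LeftE (Var 1)))))
        [?x, ?l, ?s] 7 [?x, ?l, ?s, ?t]"
      by (rule runs_le_Assign) (auto simp: stack_push)
    have 2: "runs_le (shift_com 3 d) [?x, ?l, ?s, ?t] ?q [?x, ?l, ?s, ?s']"
      using runs_le_shift[OF realizesD(1)[OF d sz], of 3 "[?x, ?l, ?s]"] by simp
    have 3: "runs_le (Assign 2 (Var 3)) [?x, ?l, ?s, ?s'] 2 [?x, ?l, ?s', ?s']"
      by (rule runs_le_Assign) (auto simp: stack_update)
    have 4: "runs_le (Assign 3 LeafE) [?x, ?l, ?s', ?s'] 2 [?x, ?l, ?s']"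
      by (rule runs_le_Assign) (auto simp: stack_update stack_pop[of "[_, _, _]", simplified])
    have 5: "runs_le (Assign 1 (RightE (Var 1))) [?x, ?l, ?s'] 3 [?x, encode ys, ?s']"
      by (rule runs_le_Assign) (auto simp: stack_update)
    have 6: "runs_le body [?x, ?l, ?s] (?q + 18) [?x, encode ys, ?s']"
      unfolding body_def
      by (rule runs_le_Seq[OF 1 runs_le_Seq[OF 2 runs_le_Seq[OF 3 runs_le_Seq[OF 4 5
              order_refl] order_refl] order_refl]]) simp
    have "runs_le (While (Var 1) body) [?x, encode ys, ?s'] (2 + length ys * (25 + ?q))
        [?x, Leaf, encode (foldl (step x) (step x s y) ys)]"
    proof (rule Cons.IH)
      show "size (encode (foldl (step x) (step x s y) (take j ys))) \<le> B" for j
        using Cons.prems(1)[of "Suc j"] by simp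
      show "size (encode ys) \<le> L" using Cons.prems(2) by simp
    qed
    from runs_le_WhileTrue[OF _ 6 this order_refl]
    have "runs_le (While (Var 1) body) [?x, ?l, ?s]
        (1 + expr_cost (Var 1) + (?q + 18) + (2 + length ys * (25 + ?q)))
        [?x, Leaf, encode (foldl (step x) (step x s y) ys)]"
      by (auto simp: stack_def)
    from runs_le_mono[OF this, of "2 + length (y # ys) * (25 + ?q)"] show ?case by simp
  qed
  show ?thesis
  proof (rule ptimeI)
    fix x :: 'a
    let ?x = "encode x" and ?n = "size (encode x)" and ?r = "encode (foldl (step x) (i x) (l x))"
    let ?w = "2 + poly o' ?n * (25 + poly q (?n + b x + poly o' ?n + 2))"
    have 1: "runs_le (Seq (Assign 1 (Var 0)) (shift_com 1 a)) [?x] (poly o' ?n + 3) [?x, encode (l x)]"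
      using runs_le_push[OF a, of 1 "[]" x] by simp
    have 2: "runs_le (Seq (Assign 2 (Var 0)) (shift_com 2 c)) [?x, encode (l x)] (poly p ?n + 3)
        [?x, encode (l x), encode (i x)]"
      using runs_le_push[OF c, of 2 "[encode (l x)]" x] by simp
    note size = realizesD(2)[OF a order_refl, of x]
    have "length (l x) \<le> poly o' ?n" using length_le_size_encode[of "l x"] size by simp
    then have 3: "runs_le (While (Var 1) body) [?x, encode (l x), encode (i x)] ?w [?x, Leaf, ?r]"
      by (intro runs_le_mono[OF loop[OF bound size]] add_mono mult_mono) auto
    have 4: "runs_le (Assign 0 (Var 2)) [?x, Leaf, ?r] 2 [?r, Leaf, ?r]"
      by (rule runs_le_Assign) (auto simp: stack_update)
    have 5: "runs_le (Assign 2 LeafE) [?r, Leaf, ?r] 2 [?r]"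
      by (rule runs_le_Assign)
        (auto simp: stack_update stack_pop[of "[_, _]", simplified] stack_pop[of "[_]", simplified])
    show "runs_le (Seq (Seq (Assign 1 (Var 0)) (shift_com 1 a)) (Seq (Seq (Assign 2 (Var 0)) (shift_com 2 c))
        (Seq (While (Var 1) body) (Seq (Assign 0 (Var 2)) (Assign 2 LeafE)))))
        [?x] (poly o' ?n + poly p ?n + ?w + 18) [?r]"
      by (rule runs_le_Seq[OF 1 runs_le_Seq[OF 2 runs_le_Seq[OF 3 runs_le_Seq[OF 4 5
              order_refl] order_refl] order_refl]]) simp
    show "size ?r \<le> b x" using bound[of x "length (l x)"] by simp
  qed (intro pbd_intros b)+
qed

lemma ptime_is_Leaf: "ptime (\<lambda>t. t = Leaf)"
proof (rule ptimeI)
  show "runs_le (If (Var 0) (Assign 0 LeafE) (Assign 0 (NodeE LeafE LeafE))) [encode t] 6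
      [encode (t = Leaf)]" for t
  proof (cases t)
    case Leaf
    then show ?thesis
      by (auto intro!: runs_le_IfFalse[where ?b2.0 = 4] runs_le_Assign simp: stack_update)
  next
    case (Node l r)
    then show ?thesis
      by (auto intro!: runs_le_IfTrue[where ?b1.0 = 2] runs_le_Assign simp: stack_update)
  qed
  show "size (encode (t = Leaf)) \<le> 1" for t by (cases "t = Leaf") auto
qed (intro pbd_intros)+

lemma encode_list_Leaf_iff: "encode xs = Leaf \<longleftrightarrow> xs = []"
  by (cases xs) auto

lemma ptime_is_Nil [ptime_intros]: "ptime l \<Longrightarrow> ptime (\<lambda>x. l x = [])"
  using ptime_comp[OF ptime_comp[OF _ ptime_encode] ptime_is_Leaf, of l]
  by (simp add: encode_list_Leaf_iff)

lemma ptime_not_Nil [ptime_intros]: "ptime l \<Longrightarrow> ptime (\<lambda>x. l x \<noteq> [])"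
  by (rule ptime_encode_cong[where f = "\<lambda>x. if l x = [] then False else True"])
    (rule ptime_intros | assumption | simp)+

lemma ptime_Cons [ptime_intros]: "ptime f \<Longrightarrow> ptime l \<Longrightarrow> ptime (\<lambda>x. f x # l x)"
  by (rule ptime_encode_cong[OF ptime_Pair]) auto

text \<open>The junk value \<open>hd []\<close> is a constant as well, so that \<open>hd\<close> and \<open>tl\<close> are total programs.\<close>

lemma ptime_hd [ptime_intros]:
  assumes "ptime l" shows "ptime (\<lambda>x. hd (l x))"
proof (rule ptime_encode_cong)
  show "ptime (\<lambda>x. if l x = [] then encode (hd (l x)) else left_of (encode (l x)))"
  proof -
    have "ptime (\<lambda>x. if l x = [] then encode (hd ([] :: 'b list)) else left_of (encode (l x)))"
      by (intro ptime_intros assms ptime_comp[OF ptime_comp[OF assms ptime_encode] ptime_left_of])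
    also have "(\<lambda>x. if l x = [] then encode (hd ([] :: 'b list)) else left_of (encode (l x))) =
        (\<lambda>x. if l x = [] then encode (hd (l x)) else left_of (encode (l x)))" by auto
    finally show ?thesis .
  qed
  show "encode (if l x = [] then encode (hd (l x)) else left_of (encode (l x))) = encode (hd (l x))" for x
    by (cases "l x") auto
qed

lemma ptime_tl [ptime_intros]:
  assumes "ptime l" shows "ptime (\<lambda>x. tl (l x))"
proof (rule ptime_encode_cong)
  show "ptime (\<lambda>x. right_of (encode (l x)))"
    by (intro ptime_comp[OF ptime_comp[OF assms ptime_encode] ptime_right_of])
  show "encode (right_of (encode (l x))) = encode (tl (l x))" for x
    by (cases "l x") auto
qed

lemma ptime_Not [ptime_intros]: "ptime b \<Longrightarrow> ptime (\<lambda>x. \<not> b x)"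
  by (rule ptime_encode_cong[where f = "\<lambda>x. if b x then False else True"])
    (rule ptime_intros | assumption | simp)+

lemma ptime_conj [ptime_intros]: "ptime b \<Longrightarrow> ptime c \<Longrightarrow> ptime (\<lambda>x. b x \<and> c x)"
  by (rule ptime_encode_cong[where f = "\<lambda>x. if b x then c x else False"])
    (rule ptime_intros | assumption | simp)+

lemma ptime_eq_tree_const:
  assumes "ptime f" shows "ptime (\<lambda>x. f x = (c :: tree))"
  using assms
proof (induction c arbitrary: f)
  case Leaf
  then show ?case by (rule ptime_comp[OF _ ptime_is_Leaf])
next
  case (Node l r)
  have "ptime (\<lambda>x. if f x = Leaf then False else left_of (f x) = l \<and> right_of (f x) = r)"
    by (intro ptime_intros Node.IH ptime_comp[OF Node.prems ptime_is_Leaf]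
        ptime_comp[OF Node.prems ptime_left_of] ptime_comp[OF Node.prems ptime_right_of])
  also have "(\<lambda>x. if f x = Leaf then False else left_of (f x) = l \<and> right_of (f x) = r) =
      (\<lambda>x. f x = Node l r)"
    by (metis left_of.simps(2) right_of.simps(2) tree.distinct(1) tree.exhaust)
  finally show ?case .
qed

text \<open>Table lookup: one comparison with a fixed code for each element of \<open>A\<close>,
  where \<open>ptime_eq_tree_const\<close> unrolls the comparison along the fixed tree. Injectivity
  of \<open>encode\<close> lets codes stand for elements.\<close>

lemma ptime_finite_support:
  assumes "ptime f" "finite A" "inj (encode :: 'b::encodable \<Rightarrow> tree)"
  shows "ptime (\<lambda>x. if f x \<in> A then g (f x :: 'b) else d)"
  using assms(2)
proof (induction A rule: finite_induct)
  case empty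
  then show ?case by (simp add: ptime_const)
next
  case (insert a A)
  have "ptime (\<lambda>x. if encode (f x) = encode a then g a else if f x \<in> A then g (f x) else d)"
    by (intro ptime_intros insert.IH ptime_eq_tree_const ptime_comp[OF assms(1) ptime_encode])
  also have "(\<lambda>x. if encode (f x) = encode a then g a else if f x \<in> A then g (f x) else d) =
      (\<lambda>x. if f x \<in> insert a A then g (f x) else d)"
    using assms(3) by (auto simp: fun_eq_iff inj_eq)
  finally show ?case .
qed

section \<open>List functions\<close>

lemma size_encode_append: "size (encode (xs @ ys)) = size (encode xs) + size (encode ys)"
  by (simp add: size_encode_list)

lemma size_encode_rev [simp]: "size (encode (rev xs)) = size (encode xs)"
  by (induction xs) (auto simp: size_encode_append)

lemma size_encode_take: "size (encode (take j xs)) \<le> size (encode xs)"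
  using size_encode_append[of "take j xs" "drop j xs"] by simp

lemma foldl_Cons_conv: "foldl (\<lambda>acc y. f y # acc) acc xs = rev (map f xs) @ acc"
  by (induction xs arbitrary: acc) auto

lemma foldl_Cons_rev: "foldl (\<lambda>acc y. y # acc) acc xs = rev xs @ acc"
  by (induction xs arbitrary: acc) auto

lemma ptime_rev [ptime_intros]:
  assumes "ptime l" shows "ptime (\<lambda>x. rev (l x))"
proof -
  have "ptime (\<lambda>x. foldl (\<lambda>acc y. y # acc) [] (l x))"
  proof (rule ptime_foldl[where b = "\<lambda>x. size (encode (l x))"])
    show "size (encode (foldl (\<lambda>acc y. y # acc) [] (take j (l x)))) \<le> size (encode (l x))" for x j
      by (simp add: foldl_Cons_rev size_encode_take)
  qed (intro ptime_intros assms pbd_ptime)+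
  then show ?thesis by (simp add: foldl_Cons_rev)
qed

lemma ptime_map [ptime_intros]:
  assumes "ptime (\<lambda>p. h (fst p) (snd p))" "ptime l" shows "ptime (\<lambda>x. map (h x) (l x))"
proof -
  obtain c p where p: "realizes c p (\<lambda>y. h (fst y) (snd y))" by (rule ptimeE[OF assms(1)])
  define b where "b = (\<lambda>x. size (encode (l x)) *
      (poly p (size (encode x) + size (encode (l x)) + 1) + 1))"
  have "ptime (\<lambda>x. foldl (\<lambda>acc y. h x y # acc) [] (l x))"
  proof (rule ptime_foldl[where b = b])
    show "size (encode (foldl (\<lambda>acc y. h x y # acc) [] (take j (l x)))) \<le> b x" for x j
    proof -
      have "size (encode (h x y)) \<le> poly p (size (encode x) + size (encode (l x)) + 1)"
        if "y \<in> set (l x)" for y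
        using realizesD(2)[OF p, of "(x, y)" "size (encode x) + size (encode (l x)) + 1"]
          size_encode_member[OF that] by simp
      then have "size (encode (map (h x) (take j (l x)))) \<le> b x"
        unfolding b_def using length_le_size_encode[of "l x"]
        by (intro size_encode_list_le) (auto dest: in_set_takeD)
      then show ?thesis by (simp add: foldl_Cons_conv)
    qed
    show "ptime (\<lambda>p. h (fst p) (snd (snd p)) # fst (snd p))"
    proof (rule ptime_Cons)
      have "ptime (\<lambda>p. (fst p, snd (snd p)))" by (intro ptime_intros)
      from ptime_comp[OF this assms(1)] show "ptime (\<lambda>p. h (fst p) (snd (snd p)))" by simp
    qed (intro ptime_intros)
    show "pbd b" unfolding b_def by (intro pbd_intros pbd_ptime assms)
  qed (intro ptime_intros assms)+
  from ptime_rev[OF this] show ?thesis by (simp add: foldl_Cons_conv)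
qed

lemma ptime_append [ptime_intros]:
  assumes "ptime k" "ptime l" shows "ptime (\<lambda>x. k x @ l x)"
proof -
  have "ptime (\<lambda>x. foldl (\<lambda>acc y. y # acc) (l x) (rev (k x)))"
  proof (rule ptime_foldl[where b = "\<lambda>x. size (encode (k x)) + size (encode (l x))"])
    show "size (encode (foldl (\<lambda>acc y. y # acc) (l x) (take j (rev (k x)))))
        \<le> size (encode (k x)) + size (encode (l x))" for x j
      using size_encode_take[of j "rev (k x)"]
      by (simp add: foldl_Cons_rev size_encode_append)
  qed (intro ptime_intros assms pbd_intros pbd_ptime)+
  then show ?thesis by (simp add: foldl_Cons_rev)
qed

lemma foldl_append_conv: "foldl (@) acc xss = acc @ concat xss"
  by (induction xss arbitrary: acc) auto

lemma size_encode_concat: "size (encode (concat xss)) \<le> size (encode xss)"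
  by (induction xss) (auto simp: size_encode_append)

lemma ptime_concat [ptime_intros]:
  assumes "ptime l" shows "ptime (\<lambda>x. concat (l x))"
proof -
  have "ptime (\<lambda>x. foldl (@) [] (l x))"
  proof (rule ptime_foldl[where b = "\<lambda>x. size (encode (l x))"])
    show "size (encode (foldl (@) [] (take j (l x)))) \<le> size (encode (l x))" for x j
      unfolding foldl_append_conv append_Nil
      using size_encode_concat[of "take j (l x)"] size_encode_take[of j "l x"] by simp
  qed (intro ptime_intros assms pbd_intros pbd_ptime)+
  then show ?thesis by (simp add: foldl_append_conv)
qed

lemma filter_conv_concat: "filter P xs = concat (map (\<lambda>y. if P y then [y] else []) xs)"
  by (induction xs) auto

lemma ptime_filter [ptime_intros]:
  assumes "ptime (\<lambda>p. P (fst p) (snd p))" "ptime l" shows "ptime (\<lambda>x. filter (P x) (l x))"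
  unfolding filter_conv_concat by (intro ptime_intros assms)

lemma ptime_Bex [ptime_intros]:
  assumes "ptime (\<lambda>p. P (fst p) (snd p))" "ptime l" shows "ptime (\<lambda>x. \<exists>y \<in> set (l x). P x y)"
proof -
  have "(\<lambda>x. \<exists>y \<in> set (l x). P x y) = (\<lambda>x. filter (P x) (l x) \<noteq> [])"
    by (auto simp: fun_eq_iff filter_empty_conv)
  then show ?thesis by (simp only:) (intro ptime_intros assms)
qed

lemma ptime_Ball [ptime_intros]:
  assumes "ptime (\<lambda>p. P (fst p) (snd p))" "ptime l" shows "ptime (\<lambda>x. \<forall>y \<in> set (l x). P x y)"
proof -
  have "(\<lambda>x. \<forall>y \<in> set (l x). P x y) = (\<lambda>x. filter (\<lambda>y. \<not> P x y) (l x) = [])"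
    by (auto simp: fun_eq_iff filter_empty_conv)
  then show ?thesis by (simp only:) (intro ptime_intros assms)
qed

text \<open>The state holds the rest of the second list and the pairs found so far, in reverse
  order.\<close>

lemma foldl_zip_conv:
  "foldl (\<lambda>p y. if fst p = [] then p else (tl (fst p), (y, hd (fst p)) # snd p)) (ys, acc) xs =
     (drop (length xs) ys, rev (zip xs ys) @ acc)"
proof (induction xs arbitrary: ys acc)
  case (Cons x xs)
  then show ?case by (cases ys) auto
qed simp

lemma size_encode_zip: "size (encode (zip xs ys)) \<le> size (encode xs) + size (encode ys)"
proof (induction xs arbitrary: ys)
  case (Cons x xs)
  then show ?case by (cases ys) auto
qed simp

lemma size_encode_drop: "size (encode (drop j xs)) \<le> size (encode xs)"
  using size_encode_append[of "take j xs" "drop j xs"] by simp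

lemma ptime_zip [ptime_intros]:
  assumes "ptime k" "ptime l" shows "ptime (\<lambda>x. zip (k x) (l x))"
proof -
  have "ptime (\<lambda>x. foldl (\<lambda>p y. if fst p = [] then p else (tl (fst p), (y, hd (fst p)) # snd p))
      (l x, []) (k x))"
  proof (rule ptime_foldl[where b = "\<lambda>x. 2 * size (encode (l x)) + size (encode (k x)) + 1"])
    show "size (encode (foldl (\<lambda>p y. if fst p = [] then p else (tl (fst p), (y, hd (fst p)) # snd p))
      (l x, []) (take j (k x)))) \<le> 2 * size (encode (l x)) + size (encode (k x)) + 1" for x j
      unfolding foldl_zip_conv
      using size_encode_zip[of "take j (k x)" "l x"] size_encode_take[of j "k x"]
        size_encode_drop[of "length (take j (k x))" "l x"]
      by simp
  qed (intro ptime_intros assms pbd_intros pbd_ptime)+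
  then have "ptime (\<lambda>x. rev (snd (foldl (\<lambda>p y. if fst p = [] then p
      else (tl (fst p), (y, hd (fst p)) # snd p)) (l x, []) (k x))))"
    by (intro ptime_intros)
  then show ?thesis unfolding foldl_zip_conv by simp
qed

section \<open>Unary arithmetic and iteration\<close>

lemma encode_nat_conv: "encode (n :: nat) = encode (replicate n Leaf)"
  by (induction n) auto

lemma ptime_replicate_Leaf: "ptime n \<Longrightarrow> ptime (\<lambda>x. replicate (n x) Leaf)"
  by (rule ptime_encode_cong[of n]) (simp_all add: encode_nat_conv)

lemma ptime_length [ptime_intros]:
  assumes "ptime l" shows "ptime (\<lambda>x. length (l x))"
proof (rule ptime_encode_cong)
  show "ptime (\<lambda>x. map (\<lambda>_. Leaf) (l x))" by (intro ptime_intros assms)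
  show "encode (map (\<lambda>_. Leaf) (l x)) = encode (length (l x))" for x
    by (simp add: encode_nat_conv map_replicate_const)
qed

lemma ptime_replicate [ptime_intros]:
  assumes "ptime n" "ptime f" shows "ptime (\<lambda>x. replicate (n x) (f x))"
proof -
  have "ptime (\<lambda>x. map (\<lambda>_. f x) (replicate (n x) Leaf))"
    by (intro ptime_intros assms ptime_replicate_Leaf ptime_comp[OF ptime_fst[OF ptime_id] assms(2)])
  then show ?thesis by simp
qed

lemma ptime_Suc [ptime_intros]: "ptime n \<Longrightarrow> ptime (\<lambda>x. Suc (n x))"
  by (rule ptime_encode_cong[OF ptime_Pair[OF ptime_const[of Leaf]]]) auto

lemma ptime_times [ptime_intros]:
  assumes "ptime m" "ptime n" shows "ptime (\<lambda>x. m x * n x :: nat)"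
proof -
  have "ptime (\<lambda>x. length (concat (replicate (m x) (replicate (n x) Leaf))))"
    by (intro ptime_intros assms)
  then show ?thesis by (simp add: length_concat sum_list_replicate)
qed

lemma foldl_tl_conv: "foldl (\<lambda>r _. tl r) xs ys = drop (length ys) xs"
  by (induction ys arbitrary: xs) (auto simp: drop_Suc)

lemma ptime_drop [ptime_intros]:
  assumes "ptime n" "ptime l" shows "ptime (\<lambda>x. drop (n x) (l x))"
proof -
  have "ptime (\<lambda>x. foldl (\<lambda>r _. tl r) (l x) (replicate (n x) Leaf))"
    by (rule ptime_foldl[where b = "\<lambda>x. size (encode (l x))"])
      (intro ptime_intros assms pbd_ptime | simp add: foldl_tl_conv size_encode_drop)+
  then show ?thesis by (simp add: foldl_tl_conv)
qed

lemma map_fst_zip_replicate: "map fst (zip xs (replicate n c)) = take n xs"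
  by (induction xs arbitrary: n) (auto simp: take_Cons split: nat.split)

lemma ptime_take [ptime_intros]:
  assumes "ptime n" "ptime l" shows "ptime (\<lambda>x. take (n x) (l x))"
proof -
  have "ptime (\<lambda>x. map fst (zip (l x) (replicate (n x) Leaf)))"
    by (intro ptime_intros assms)
  then show ?thesis by (simp add: map_fst_zip_replicate)
qed

lemma ptime_le [ptime_intros]:
  assumes "ptime m" "ptime n" shows "ptime (\<lambda>x. m x \<le> (n x :: nat))"
proof -
  have "ptime (\<lambda>x. drop (n x) (replicate (m x) Leaf) = [])"
    by (intro ptime_intros assms)
  then show ?thesis by simp
qed

lemma ptime_less [ptime_intros]:
  assumes "ptime m" "ptime n" shows "ptime (\<lambda>x. m x < (n x :: nat))"
  unfolding less_eq_Suc_le by (intro ptime_intros assms)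

lemma ptime_eq_nat [ptime_intros]:
  assumes "ptime m" "ptime n" shows "ptime (\<lambda>x. m x = (n x :: nat))"
  unfolding eq_iff by (intro ptime_intros assms)

lemma ptime_min [ptime_intros]:
  assumes "ptime m" "ptime n" shows "ptime (\<lambda>x. min (m x) (n x :: nat))"
  unfolding min_def by (intro ptime_intros assms)

lemma foldl_replicate_conv: "foldl (\<lambda>s _. f s) s (replicate n c) = (f ^^ n) s"
  by (induction n arbitrary: s) (auto simp: funpow_swap1)

lemma ptime_funpow:
  fixes n :: "'a::encodable \<Rightarrow> nat" and f :: "'a \<Rightarrow> 'b::encodable \<Rightarrow> 'b"
  assumes "ptime (\<lambda>p. f (fst p) (snd p))" "ptime n" "ptime s" "pbd b"
    and bound: "\<And>x j. j \<le> n x \<Longrightarrow> size (encode ((f x ^^ j) (s x))) \<le> b x"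
  shows "ptime (\<lambda>x. (f x ^^ n x) (s x))"
proof -
  have "ptime (\<lambda>x. foldl (\<lambda>s _. f x s) (s x) (replicate (n x) Leaf))"
  proof (rule ptime_foldl[where b = b])
    have "ptime (\<lambda>p. (fst p, fst (snd p)))" by (intro ptime_intros)
    from ptime_comp[OF this assms(1)]
    show "ptime (\<lambda>p :: 'a \<times> 'b \<times> tree. f (fst p) (fst (snd p)))" by simp
    show "size (encode (foldl (\<lambda>s _. f x s) (s x) (take j (replicate (n x) Leaf)))) \<le> b x" for x j
      unfolding take_replicate foldl_replicate_conv by (rule bound) simp
  qed (intro ptime_intros assms)+
  then show ?thesis by (simp add: foldl_replicate_conv)
qed

lemma foldl_upt_conv: "foldl (\<lambda>acc _. acc @ [length acc]) [] (replicate n c) = [0..<n]"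
proof -
  have "((\<lambda>acc. acc @ [length acc]) ^^ n) [] = [0..<n]"
    by (induction n) auto
  then show ?thesis using foldl_replicate_conv[of "\<lambda>acc. acc @ [length acc]"] by metis
qed

lemma ptime_upt [ptime_intros]:
  assumes "ptime n" shows "ptime (\<lambda>x. [0..<n x])"
proof -
  have "ptime (\<lambda>x. foldl (\<lambda>acc _. acc @ [length acc]) [] (replicate (n x) Leaf))"
  proof (rule ptime_foldl[where b = "\<lambda>x. n x * (n x + 1)"])
    show "size (encode (foldl (\<lambda>acc _. acc @ [length acc]) [] (take j (replicate (n x) Leaf))))
        \<le> n x * (n x + 1)" for x j
      unfolding take_replicate foldl_upt_conv by (rule size_encode_list_le) auto
    show "pbd (\<lambda>x. n x * (n x + 1))"
      using pbd_ptime[OF assms] by (auto intro!: pbd_intros)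
  qed (intro ptime_intros assms)+
  then show ?thesis by (simp add: foldl_upt_conv)
qed

text \<open>A fixed number of rounds is a fixed composition, so closure under composition already
  controls the intermediate sizes.\<close>

lemma ptime_funpow_const:
  fixes f :: "'a::encodable \<Rightarrow> 'b::encodable \<Rightarrow> 'b"
  assumes "ptime (\<lambda>p. f (fst p) (snd p))" "ptime s"
  shows "ptime (\<lambda>x. (f x ^^ n) (s x))"
proof (induction n)
  case (Suc n)
  have "ptime (\<lambda>x. (x, (f x ^^ n) (s x)))" by (intro ptime_intros Suc)
  from ptime_comp[OF this assms(1)] show ?case by simp
qed (simp add: assms)

lemma foldl_select_mem: "foldl (\<lambda>u y. if P u y then y else u) c ys \<in> insert c (set ys)"
proof (induction ys arbitrary: c)
  case (Cons y ys)
  then show ?case using Cons[of y] Cons[of c] by auto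
qed simp

text \<open>For searches of an extremal list element: the accumulator is always the start value or
  an entry of the list, which bounds its size.\<close>

lemma ptime_foldl_select [ptime_intros]:
  fixes l :: "'a::encodable \<Rightarrow> 'b::encodable list"
  assumes "ptime (\<lambda>p. P (fst p) (fst (snd p)) (snd (snd p)))" "ptime c" "ptime l"
  shows "ptime (\<lambda>x. foldl (\<lambda>u y. if P x u y then y else u) (c x) (l x))"
proof (rule ptime_foldl[where b = "\<lambda>x. size (encode (c x)) + size (encode (l x))"])
  show "size (encode (foldl (\<lambda>u y. if P x u y then y else u) (c x) (take j (l x))))
      \<le> size (encode (c x)) + size (encode (l x))" for x j
    using foldl_select_mem[of "P x" "c x" "take j (l x)"] size_encode_member[of _ "l x"]
    by (fastforce dest: in_set_takeD)
qed (intro ptime_intros assms pbd_intros pbd_ptime)+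

section \<open>Strong generating sets in powers of a finite group\<close>

locale listed_group = group G for G (structure) +
  fixes el :: "'a list"
  assumes distinct_el: "distinct el" and set_el: "set el = carrier G"
begin

text \<open>Both operations are constant outside the carrier, which makes them table lookups.\<close>

definition op :: "'a \<Rightarrow> 'a \<Rightarrow> 'a" where
  "op a b = (if (a, b) \<in> carrier G \<times> carrier G then a \<otimes> b else \<one>)"

definition ldiv :: "'a \<Rightarrow> 'a \<Rightarrow> 'a" where
  "ldiv a b = (if (a, b) \<in> carrier G \<times> carrier G then inv a \<otimes> b else \<one>)"

definition vmul :: "'a list \<Rightarrow> 'a list \<Rightarrow> 'a list" where
  "vmul u v = map (\<lambda>p. op (fst p) (snd p)) (zip u v)"

definition vldiv :: "'a list \<Rightarrow> 'a list \<Rightarrow> 'a list" where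
  "vldiv u v = map (\<lambda>p. ldiv (fst p) (snd p)) (zip u v)"

definition ones :: "nat \<Rightarrow> 'a list" where
  "ones n = replicate n \<one>"

definition vecs :: "nat \<Rightarrow> 'a list set" where
  "vecs n = {v. length v = n \<and> set v \<subseteq> carrier G}"

lemma finite_carrier [simp]: "finite (carrier G)"
  using set_el by (metis List.finite_set)

lemma card_carrier: "card (carrier G) = length el"
  using distinct_el set_el by (metis distinct_card)

lemma op_closed [simp]: "op a b \<in> carrier G" and ldiv_closed [simp]: "ldiv a b \<in> carrier G"
  by (auto simp: op_def ldiv_def)

lemma op_eq: "a \<in> carrier G \<Longrightarrow> b \<in> carrier G \<Longrightarrow> op a b = a \<otimes> b"
  and ldiv_eq: "a \<in> carrier G \<Longrightarrow> b \<in> carrier G \<Longrightarrow> ldiv a b = inv a \<otimes> b"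
  by (auto simp: op_def ldiv_def)

lemma vmul_simps [simp]: "vmul [] v = []" "vmul u [] = []" "vmul (a # u) (b # v) = op a b # vmul u v"
  by (auto simp: vmul_def)

lemma vldiv_simps [simp]: "vldiv [] v = []" "vldiv u [] = []" "vldiv (a # u) (b # v) = ldiv a b # vldiv u v"
  by (auto simp: vldiv_def)

lemma length_vmul [simp]: "length (vmul u v) = min (length u) (length v)"
  and length_vldiv [simp]: "length (vldiv u v) = min (length u) (length v)"
  by (auto simp: vmul_def vldiv_def)

lemma ones_simps [simp]: "ones 0 = []" "ones (Suc n) = \<one> # ones n" "length (ones n) = n"
  by (auto simp: ones_def)

lemma vecs_0 [simp]: "vecs 0 = {[]}"
  by (auto simp: vecs_def)

lemma Cons_in_vecs [simp]: "a # v \<in> vecs (Suc n) \<longleftrightarrow> a \<in> carrier G \<and> v \<in> vecs n"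
  by (auto simp: vecs_def)

lemma vecs_SucE:
  assumes "v \<in> vecs (Suc n)"
  obtains a w where "v = a # w" "a \<in> carrier G" "w \<in> vecs n"
  using assms by (cases v) (auto simp: vecs_def)

lemma length_vecs: "v \<in> vecs n \<Longrightarrow> length v = n"
  by (simp add: vecs_def)

lemma hd_vecs: "v \<in> vecs (Suc n) \<Longrightarrow> hd v \<in> carrier G"
  and tl_vecs: "v \<in> vecs (Suc n) \<Longrightarrow> tl v \<in> vecs n"
  by (auto elim!: vecs_SucE)

lemma ones_in_vecs [simp]: "ones n \<in> vecs n"
  by (induction n) auto

lemma finite_vecs [simp]: "finite (vecs n)"
  using finite_lists_length_eq[OF finite_carrier, of n] by (simp add: vecs_def conj_commute)

lemma vmul_in_vecs [simp]: "u \<in> vecs n \<Longrightarrow> v \<in> vecs n \<Longrightarrow> vmul u v \<in> vecs n"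
  and vldiv_in_vecs [simp]: "u \<in> vecs n \<Longrightarrow> v \<in> vecs n \<Longrightarrow> vldiv u v \<in> vecs n"
  by (auto simp: vecs_def vmul_def vldiv_def)

lemma vmul_assoc:
  "u \<in> vecs n \<Longrightarrow> v \<in> vecs n \<Longrightarrow> w \<in> vecs n \<Longrightarrow> vmul (vmul u v) w = vmul u (vmul v w)"
proof (induction n arbitrary: u v w)
  case (Suc n)
  then show ?case by (auto elim!: vecs_SucE simp: op_eq m_assoc)
qed auto

lemma vmul_ones [simp]: "u \<in> vecs n \<Longrightarrow> vmul u (ones n) = u" "u \<in> vecs n \<Longrightarrow> vmul (ones n) u = u"
proof (induction n arbitrary: u)
  case (Suc n)
  {
    case 1
    then show ?case using Suc.IH by (auto elim!: vecs_SucE simp: op_eq)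
  next
    case 2
    then show ?case using Suc.IH by (auto elim!: vecs_SucE simp: op_eq)
  }
qed auto

lemma vmul_vldiv: "u \<in> vecs n \<Longrightarrow> v \<in> vecs n \<Longrightarrow> vmul u (vldiv u v) = v"
proof (induction n arbitrary: u v)
  case (Suc n)
  then show ?case by (auto elim!: vecs_SucE simp: op_eq ldiv_eq m_assoc[symmetric])
qed auto

lemma vldiv_vmul: "u \<in> vecs n \<Longrightarrow> v \<in> vecs n \<Longrightarrow> vldiv u (vmul u v) = v"
proof (induction n arbitrary: u v)
  case (Suc n)
  then show ?case by (auto elim!: vecs_SucE simp: op_eq ldiv_eq m_assoc[symmetric])
qed auto

lemma hd_vldiv_same: "u \<in> vecs (Suc n) \<Longrightarrow> v \<in> vecs (Suc n) \<Longrightarrow> hd u = hd v \<Longrightarrow> hd (vldiv u v) = \<one>"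
  by (auto elim!: vecs_SucE simp: ldiv_eq)

section \<open>Subgroups, levels of generators and normal forms\<close>

definition lsub :: "nat \<Rightarrow> 'a list set \<Rightarrow> bool" where
  "lsub n S \<longleftrightarrow> S \<subseteq> vecs n \<and> ones n \<in> S \<and>
     (\<forall>u\<in>S. \<forall>v\<in>S. vmul u v \<in> S) \<and> (\<forall>u\<in>S. \<forall>v\<in>S. vldiv u v \<in> S)"

lemma lsubD:
  assumes "lsub n S"
  shows "S \<subseteq> vecs n" "ones n \<in> S" "u \<in> S \<Longrightarrow> v \<in> S \<Longrightarrow> vmul u v \<in> S"
    "u \<in> S \<Longrightarrow> v \<in> S \<Longrightarrow> vldiv u v \<in> S"
  using assms by (auto simp: lsub_def)

lemma lsub_finite: "lsub n S \<Longrightarrow> finite S"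
  using finite_subset[OF _ finite_vecs] by (auto simp: lsub_def)

text \<open>By finiteness: left multiplication by \<open>u\<close> is injective on \<open>S\<close>,
  hence onto, so left quotients stay in \<open>S\<close>.\<close>

lemma lsubI:
  assumes "S \<subseteq> vecs n" "ones n \<in> S" "\<And>u v. u \<in> S \<Longrightarrow> v \<in> S \<Longrightarrow> vmul u v \<in> S"
  shows "lsub n S"
  unfolding lsub_def
proof (intro conjI ballI assms)
  fix u v assume uv: "u \<in> S" "v \<in> S"
  have fin: "finite S" using assms(1) finite_vecs by (rule finite_subset)
  have "inj_on (vmul u) S"
    by (rule inj_onI) (metis assms(1) subsetD uv(1) vldiv_vmul)
  moreover have "vmul u ` S \<subseteq> S" using assms(3) uv(1) by blast
  ultimately have "vmul u ` S = S" using fin by (metis endo_inj_surj)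
  then obtain w where "w \<in> S" "v = vmul u w" using uv(2) by blast
  moreover from this have "u \<in> vecs n" "w \<in> vecs n" using assms(1) uv(1) by auto
  ultimately show "vldiv u v \<in> S" by (simp add: vldiv_vmul)
qed auto

text \<open>Passes to the next level of the chain of subgroups with more and more trivial leading
  coordinates, the analogue of a stabilizer chain in the Schreier-Sims method.\<close>

definition tails :: "'a list list \<Rightarrow> 'a list list" where
  "tails R = map tl (filter (\<lambda>r. hd r = \<one>) R)"

lemma tails_vecs: "set R \<subseteq> vecs (Suc n) \<Longrightarrow> set (tails R) \<subseteq> vecs n"
  by (auto simp: tails_def intro!: tl_vecs)

lemma tails_iff: "set R \<subseteq> vecs (Suc n) \<Longrightarrow> w \<in> set (tails R) \<longleftrightarrow> \<one> # w \<in> set R"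
proof
  assume R: "set R \<subseteq> vecs (Suc n)"
  assume "w \<in> set (tails R)"
  then obtain r where "r \<in> set R" "hd r = \<one>" "w = tl r" by (auto simp: tails_def)
  moreover from this R have "r = hd r # tl r" by (auto elim!: vecs_SucE)
  ultimately show "\<one> # w \<in> set R" by simp
next
  assume "\<one> # w \<in> set R"
  then show "w \<in> set (tails R)" by (force simp: tails_def)
qed

text \<open>The transversal of the current level; \<open>ones n\<close> represents the trivial
  coset.\<close>

definition lvl :: "nat \<Rightarrow> 'a list list \<Rightarrow> 'a list set" where
  "lvl n R = insert (ones n) {r \<in> set R. hd r \<noteq> \<one>}"

lemma lvl_vecs: "set R \<subseteq> vecs n \<Longrightarrow> lvl n R \<subseteq> vecs n"
  by (auto simp: lvl_def)

text \<open>Normal forms: products with one transversal element from each level, in order. In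
  general this is only a set; \<open>sgs_lsub\<close> shows when it is a group.\<close>

fun span :: "nat \<Rightarrow> 'a list list \<Rightarrow> 'a list set" where
  "span 0 R = {[]}"
| "span (Suc n) R = (\<lambda>(u, w). vmul u (\<one> # w)) ` (lvl (Suc n) R \<times> span n (tails R))"

text \<open>A nontrivial head determines the generator within its level, as in a lookup table. The
  base case keeps trivial vectors out of \<open>R\<close>.\<close>

fun keyed :: "nat \<Rightarrow> 'a list list \<Rightarrow> bool" where
  "keyed 0 R \<longleftrightarrow> R = []"
| "keyed (Suc n) R \<longleftrightarrow> distinct (filter (\<lambda>a. a \<noteq> \<one>) (map hd R)) \<and> keyed n (tails R)"

lemma span_vecs: "set R \<subseteq> vecs n \<Longrightarrow> span n R \<subseteq> vecs n"
proof (induction n arbitrary: R)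
  case (Suc n)
  then show ?case
    using lvl_vecs[OF Suc.prems] Suc.IH[OF tails_vecs[OF Suc.prems]] by fastforce
qed auto

lemma finite_span: "set R \<subseteq> vecs n \<Longrightarrow> finite (span n R)"
  using span_vecs finite_vecs by (metis finite_subset)

lemma ones_in_span: "ones n \<in> span n R"
proof (induction n arbitrary: R)
  case (Suc n)
  have "vmul (ones (Suc n)) (\<one> # ones n) = ones (Suc n)"
    using vmul_ones(1)[OF ones_in_vecs, of "Suc n"] by simp
  then show ?case using Suc[of "tails R"] by (force simp: lvl_def)
qed simp

lemma lvl_subset_span: "set R \<subseteq> vecs n \<Longrightarrow> lvl n R \<subseteq> span n R"
proof (cases n)
  case (Suc m)
  assume R: "set R \<subseteq> vecs n"
  show ?thesis
  proof
    fix u assume u: "u \<in> lvl n R"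
    then have "u \<in> vecs n" using lvl_vecs[OF R] by blast
    then have "u = vmul u (\<one> # ones m)" using vmul_ones(1)[of u n] Suc by simp
    then show "u \<in> span n R" using u ones_in_span[of m "tails R"] Suc by force
  qed
qed (auto simp: lvl_def)

lemma Cons_one_in_span:
  assumes R: "set R \<subseteq> vecs (Suc n)" and w: "w \<in> span n (tails R)"
  shows "\<one> # w \<in> span (Suc n) R"
proof -
  have "w \<in> vecs n" using span_vecs[OF tails_vecs[OF R]] w by blast
  then have "\<one> # w = vmul (ones (Suc n)) (\<one> # w)"
    using vmul_ones(2)[of "\<one> # w" "Suc n"] by simp
  then show ?thesis using w by (force simp: lvl_def)
qed

lemma gens_in_span: "set R \<subseteq> vecs n \<Longrightarrow> set R \<subseteq> span n R"
proof (induction n arbitrary: R)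
  case (Suc n)
  show ?case
  proof
    fix r assume r: "r \<in> set R"
    show "r \<in> span (Suc n) R"
    proof (cases "hd r = \<one>")
      case True
      then obtain w where w: "r = \<one> # w" using r Suc.prems by (auto elim!: vecs_SucE)
      then have "w \<in> set (tails R)" using r tails_iff[OF Suc.prems] by simp
      then have "w \<in> span n (tails R)" using Suc.IH[OF tails_vecs[OF Suc.prems]] by blast
      then show ?thesis using Cons_one_in_span[OF Suc.prems] w by simp
    next
      case False
      then show ?thesis using lvl_subset_span[OF Suc.prems] r by (auto simp: lvl_def)
    qed
  qed
qed auto

text \<open>Serves as an induction principle: \<open>Z\<close> may be any product-closed property of
  vectors that holds for the generators.\<close>

lemma span_least:
  assumes "set R \<subseteq> Z" "Z \<subseteq> vecs n" "ones n \<in> Z" "\<And>u v. u \<in> Z \<Longrightarrow> v \<in> Z \<Longrightarrow> vmul u v \<in> Z"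
  shows "span n R \<subseteq> Z"
  using assms
proof (induction n arbitrary: R Z)
  case (Suc n)
  have R: "set R \<subseteq> vecs (Suc n)" using Suc.prems by blast
  have "span n (tails R) \<subseteq> {w. \<one> # w \<in> Z}"
  proof (rule Suc.IH)
    show "set (tails R) \<subseteq> {w. \<one> # w \<in> Z}" using tails_iff[OF R] Suc.prems(1) by blast
    show "{w. \<one> # w \<in> Z} \<subseteq> vecs n" using Suc.prems(2) by (auto dest: subsetD)
    show "ones n \<in> {w. \<one> # w \<in> Z}" using Suc.prems(3) by simp
    show "vmul u v \<in> {w. \<one> # w \<in> Z}" if "u \<in> {w. \<one> # w \<in> Z}" "v \<in> {w. \<one> # w \<in> Z}" for u v
      using Suc.prems(4)[of "\<one> # u" "\<one> # v"] that by (simp add: op_eq)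
  qed
  moreover have "lvl (Suc n) R \<subseteq> Z" using Suc.prems(1,3) by (auto simp: lvl_def)
  ultimately show ?case using Suc.prems(4) by fastforce
qed auto

text \<open>A finite test: only products of two generators are required to have a normal form, and
  \<open>sgs_mult\<close> extends this to the whole span.\<close>

definition sgs :: "nat \<Rightarrow> 'a list list \<Rightarrow> bool" where
  "sgs n R \<longleftrightarrow> keyed n R \<and> set R \<subseteq> vecs n \<and> (\<forall>a\<in>set R. \<forall>b\<in>set R. vmul a b \<in> span n R)"

lemma hd_vmul: "u \<in> vecs (Suc n) \<Longrightarrow> v \<in> vecs (Suc n) \<Longrightarrow> hd (vmul u v) = hd u \<otimes> hd v"
  by (auto elim!: vecs_SucE simp: op_eq)

lemma keyed_lvl_inj: "keyed (Suc n) R \<Longrightarrow> inj_on hd (lvl (Suc n) R)"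
proof -
  assume "keyed (Suc n) R"
  then have "distinct (map hd (filter (\<lambda>r. hd r \<noteq> \<one>) R))"
    by (simp add: filter_map o_def)
  then have "inj_on hd {r \<in> set R. hd r \<noteq> \<one>}" by (simp add: distinct_map)
  then show ?thesis by (auto simp: lvl_def inj_on_def)
qed

text \<open>The head of a normal form is the head of its first factor, and \<open>ones\<close> is
  the only transversal element with trivial head.\<close>

lemma span_Suc_hd_one:
  assumes R: "set R \<subseteq> vecs (Suc n)" and w: "\<one> # w \<in> span (Suc n) R"
  shows "w \<in> span n (tails R)"
proof -
  from w obtain u w' where uw: "u \<in> lvl (Suc n) R" "w' \<in> span n (tails R)" "\<one> # w = vmul u (\<one> # w')"
    by auto
  have v: "u \<in> vecs (Suc n)" "w' \<in> vecs n"
    using uw lvl_vecs[OF R] span_vecs[OF tails_vecs[OF R]] by blast+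
  have "hd u = \<one>" using hd_vmul[OF v(1), of "\<one> # w'"] v uw(3)
    by (metis Cons_in_vecs hd_vecs list.sel(1) one_closed r_one)
  then have "u = ones (Suc n)" using uw(1) by (auto simp: lvl_def)
  then show ?thesis using uw v vmul_ones(2)[of "\<one> # w'" "Suc n"] by simp
qed

lemma sgs_tails: assumes "sgs (Suc n) R" shows "sgs n (tails R)"
proof -
  from assms have R: "set R \<subseteq> vecs (Suc n)" "keyed n (tails R)"
    and m: "\<And>a b. a \<in> set R \<Longrightarrow> b \<in> set R \<Longrightarrow> vmul a b \<in> span (Suc n) R"
    by (auto simp: sgs_def)
  have "vmul a b \<in> span n (tails R)" if "a \<in> set (tails R)" "b \<in> set (tails R)" for a b
    using m[of "\<one> # a" "\<one> # b"] that span_Suc_hd_one[OF R(1)] tails_iff[OF R(1)]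
    by (simp add: op_eq del: span.simps)
  then show ?thesis using R tails_vecs by (auto simp: sgs_def)
qed

text \<open>A transversal element of the first level can be moved to the left past the next levels.\<close>

lemma sgs_mult:
  "sgs n R \<Longrightarrow> x \<in> span n R \<Longrightarrow> y \<in> span n R \<Longrightarrow> vmul x y \<in> span n R"
proof (induction n arbitrary: R x y)
  case (Suc n)
  let ?U = "lvl (Suc n) R" and ?Q = "span n (tails R)"
  have R: "set R \<subseteq> vecs (Suc n)" and keyed: "keyed (Suc n) R"
    and m: "\<And>a b. a \<in> set R \<Longrightarrow> b \<in> set R \<Longrightarrow> vmul a b \<in> span (Suc n) R"
    using Suc.prems(1) by (auto simp: sgs_def)
  have Uv: "?U \<subseteq> vecs (Suc n)" and Qv: "?Q \<subseteq> vecs n"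
    using lvl_vecs[OF R] span_vecs[OF tails_vecs[OF R]] by auto
  have Uspan: "?U \<subseteq> span (Suc n) R" using lvl_subset_span[OF R] .
  have Sv: "span (Suc n) R \<subseteq> vecs (Suc n)" using span_vecs[OF R] .
  have Qm: "vmul v w \<in> ?Q" if "v \<in> ?Q" "w \<in> ?Q" for v w
    using Suc.IH[OF sgs_tails[OF Suc.prems(1)]] that by blast
  have Cm: "vmul (\<one> # v) (\<one> # w) = \<one> # vmul v w" for v w by (simp add: op_eq)
  have Uprod: "vmul u1 u2 \<in> span (Suc n) R" if u: "u1 \<in> ?U" "u2 \<in> ?U" for u1 u2
  proof (cases "u1 = ones (Suc n) \<or> u2 = ones (Suc n)")
    case True
    then show ?thesis using u Uspan Uv by (metis subsetD vmul_ones)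
  next
    case False
    then show ?thesis using u m by (auto simp: lvl_def simp del: span.simps)
  qed
  \<comment> \<open>\<open>Z\<close> collects the tails that can be moved past every transversal
    element. For a generator this holds because the normal form given by \<open>m\<close> starts
    with an element of the same head, which is \<open>u\<close> itself as \<open>R\<close> is keyed.
    \<open>span_least\<close> then extends it to all of \<open>?Q\<close>.\<close>
  define Z where "Z = {w \<in> ?Q. \<forall>u\<in>?U. \<exists>w'\<in>?Q. vmul (\<one> # w) u = vmul u (\<one> # w')}"
  have "?Q \<subseteq> Z"
  proof (rule span_least)
    show "Z \<subseteq> vecs n" using Qv by (auto simp: Z_def)
    show "ones n \<in> Z"
    proof -
      have "vmul (\<one> # ones n) u = vmul u (\<one> # ones n)" if "u \<in> ?U" for u
        using vmul_ones[of u "Suc n"] that Uv by auto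
      then show ?thesis using ones_in_span by (auto simp: Z_def)
    qed
    show "set (tails R) \<subseteq> Z"
    proof
      fix w assume w: "w \<in> set (tails R)"
      then have wR: "\<one> # w \<in> set R" using tails_iff[OF R] by simp
      have wQ: "w \<in> ?Q" using gens_in_span[OF tails_vecs[OF R]] w by blast
      have "\<exists>w'\<in>?Q. vmul (\<one> # w) u = vmul u (\<one> # w')" if u: "u \<in> ?U" for u
      proof (cases "u = ones (Suc n)")
        case True
        then show ?thesis using wQ Qv vmul_ones[of "\<one> # w" "Suc n"] by (intro bexI[of _ w]) auto
      next
        case False
        then have "u \<in> set R" using u by (auto simp: lvl_def)
        from m[OF wR this] obtain u2 w2 where *: "u2 \<in> ?U" "w2 \<in> ?Q"
          "vmul (\<one> # w) u = vmul u2 (\<one> # w2)" by auto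
        have "hd u = hd u2"
        proof -
          have "hd (vmul (\<one> # w) u) = hd u" "hd (vmul u2 (\<one> # w2)) = hd u2"
            using hd_vmul[of "\<one> # w" n u] hd_vmul[of u2 n "\<one> # w2"] *(1,2) u Uv Qv wQ hd_vecs
            by (auto simp: subset_iff)
          then show ?thesis using *(3) by simp
        qed
        then have "u2 = u" using keyed_lvl_inj[OF keyed] *(1) u by (auto simp: inj_on_def)
        then show ?thesis using * by blast
      qed
      then show "w \<in> Z" using wQ by (simp add: Z_def)
    qed
    show "vmul v w \<in> Z" if vw: "v \<in> Z" "w \<in> Z" for v w
    proof -
      have q: "v \<in> ?Q" "w \<in> ?Q" using vw by (auto simp: Z_def)
      have "\<exists>w'\<in>?Q. vmul (\<one> # vmul v w) u = vmul u (\<one> # w')" if u: "u \<in> ?U" for u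
      proof -
        from vw(2) u obtain w1 where w1: "w1 \<in> ?Q" "vmul (\<one> # w) u = vmul u (\<one> # w1)"
          by (auto simp: Z_def)
        from vw(1) u obtain v1 where v1: "v1 \<in> ?Q" "vmul (\<one> # v) u = vmul u (\<one> # v1)"
          by (auto simp: Z_def)
        have in_v: "\<one> # v \<in> vecs (Suc n)" "\<one> # w \<in> vecs (Suc n)" "u \<in> vecs (Suc n)"
          "\<one> # v1 \<in> vecs (Suc n)" "\<one> # w1 \<in> vecs (Suc n)"
          using q w1 v1 u Qv Uv by (auto simp: subset_iff)
        have "vmul (\<one> # vmul v w) u = vmul (vmul (\<one> # v) (\<one> # w)) u" by (simp only: Cm)
        also have "\<dots> = vmul (\<one> # v) (vmul u (\<one> # w1))"
          using in_v by (simp only: vmul_assoc w1(2))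
        also have "\<dots> = vmul (vmul u (\<one> # v1)) (\<one> # w1)"
          using in_v by (simp only: vmul_assoc[symmetric] v1(2))
        also have "\<dots> = vmul u (\<one> # vmul v1 w1)"
          using in_v by (simp only: vmul_assoc Cm)
        finally show ?thesis using Qm[OF v1(1) w1(1)] by blast
      qed
      then show ?thesis using Qm[OF q] by (simp add: Z_def)
    qed
  qed
  then have comm: "\<exists>w'\<in>?Q. vmul (\<one> # w) u = vmul u (\<one> # w')" if "w \<in> ?Q" "u \<in> ?U" for w u
    using that by (auto simp: Z_def)
  from Suc.prems(2,3) obtain u1 w1 u2 w2 where
    x: "u1 \<in> ?U" "w1 \<in> ?Q" "x = vmul u1 (\<one> # w1)" and
    y: "u2 \<in> ?U" "w2 \<in> ?Q" "y = vmul u2 (\<one> # w2)" by auto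
  from comm[OF x(2) y(1)] obtain w3 where w3: "w3 \<in> ?Q" "vmul (\<one> # w1) u2 = vmul u2 (\<one> # w3)" by blast
  from Uprod[OF x(1) y(1)] obtain u4 w4 where
    u4: "u4 \<in> ?U" "w4 \<in> ?Q" "vmul u1 u2 = vmul u4 (\<one> # w4)" by auto
  have in_v: "u1 \<in> vecs (Suc n)" "u2 \<in> vecs (Suc n)" "u4 \<in> vecs (Suc n)" "\<one> # w1 \<in> vecs (Suc n)"
    "\<one> # w2 \<in> vecs (Suc n)" "\<one> # w3 \<in> vecs (Suc n)" "\<one> # w4 \<in> vecs (Suc n)"
    using x y w3 u4 Uv Qv by (auto simp: subset_iff)
  have "vmul x y = vmul u1 (vmul (vmul (\<one> # w1) u2) (\<one> # w2))"
    unfolding x y using in_v by (simp only: vmul_assoc vmul_in_vecs)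
  also have "\<dots> = vmul (vmul u1 u2) (vmul (\<one> # w3) (\<one> # w2))"
    unfolding w3(2) using in_v by (simp only: vmul_assoc vmul_in_vecs)
  also have "\<dots> = vmul u4 (vmul (\<one> # w4) (vmul (\<one> # w3) (\<one> # w2)))"
    unfolding u4(3) using in_v by (simp only: vmul_assoc vmul_in_vecs)
  also have "\<dots> = vmul u4 (\<one> # vmul w4 (vmul w3 w2))" by (simp only: Cm)
  finally show ?case using u4 w3 y Qm by force
qed auto

lemma sgs_lsub:
  assumes "sgs n R" shows "lsub n (span n R)"
proof (rule lsubI)
  show "span n R \<subseteq> vecs n" using assms by (intro span_vecs) (simp add: sgs_def)
qed (use assms ones_in_span sgs_mult in blast)+

end

section \<open>Sifting\<close>

type_synonym 'a sift_state = "'a list \<times> 'a list list \<times> 'a list \<times> bool"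

context listed_group begin

definition eql :: "'a \<Rightarrow> 'a \<Rightarrow> bool" where
  "eql a b \<longleftrightarrow> (if (a, b) \<in> carrier G \<times> carrier G then a = b else False)"

lemma eql_iff: "a \<in> carrier G \<Longrightarrow> b \<in> carrier G \<Longrightarrow> eql a b \<longleftrightarrow> a = b"
  by (simp add: eql_def)

text \<open>The state consists of the prefix already reduced to \<open>\<one>\<close>, the
  generators of the current level, the rest of the vector, and a flag that is set when no
  transversal element matches.\<close>

definition sift_step :: "'a sift_state \<Rightarrow> 'a sift_state" where
  "sift_step s =
     (if snd (snd (snd s)) then s
      else if hd (fst (snd (snd s))) = \<one>
      then (fst s @ [\<one>], tails (fst (snd s)), tl (fst (snd (snd s))), False)
      else if filter (\<lambda>r. eql (hd r) (hd (fst (snd (snd s))))) (fst (snd s)) = []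
      then (fst s, fst (snd s), fst (snd (snd s)), True)
      else (fst s @ [\<one>], tails (fst (snd s)),
        tl (vldiv (hd (filter (\<lambda>r. eql (hd r) (hd (fst (snd (snd s))))) (fst (snd s))))
          (fst (snd (snd s)))), False))"

definition sift :: "nat \<Rightarrow> 'a list list \<Rightarrow> 'a list \<Rightarrow> 'a list" where
  "sift n R v = (let s = (sift_step ^^ n) ([], R, v, False) in fst s @ fst (snd (snd s)))"

text \<open>The machine runs the iteration \<open>sift\<close>; the proofs use the recursion \<open>sift_rec\<close>, which agrees with
  it on well-formed vectors.\<close>

fun sift_rec :: "nat \<Rightarrow> 'a list list \<Rightarrow> 'a list \<Rightarrow> 'a list" where
  "sift_rec 0 R v = []"
| "sift_rec (Suc n) R v =
     (if hd v = \<one> then \<one> # sift_rec n (tails R) (tl v)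
      else case filter (\<lambda>r. eql (hd r) (hd v)) R of
        [] \<Rightarrow> v
      | r # _ \<Rightarrow> \<one> # sift_rec n (tails R) (tl (vldiv r v)))"

lemma sift_step_done: "(sift_step ^^ n) (acc, R, v, True) = (acc, R, v, True)"
  by (induction n) (auto simp: sift_step_def)

lemma sift_steps:
  "set R \<subseteq> vecs n \<Longrightarrow> v \<in> vecs n \<Longrightarrow>
    (let s = (sift_step ^^ n) (acc, R, v, False) in fst s @ fst (snd (snd s))) = acc @ sift_rec n R v"
proof (induction n arbitrary: acc R v)
  case (Suc n)
  let ?m = "filter (\<lambda>r. eql (hd r) (hd v)) R"
  note R' = tails_vecs[OF Suc.prems(1)]
  have *: "(sift_step ^^ Suc n) s = (sift_step ^^ n) (sift_step s)" for s
    by (simp add: funpow_swap1)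
  show ?case
  proof (cases "hd v = \<one>")
    case True
    then have st: "sift_step (acc, R, v, False) = (acc @ [\<one>], tails R, tl v, False)"
      by (simp add: sift_step_def)
    show ?thesis unfolding * st
      using Suc.IH[OF R' tl_vecs[OF Suc.prems(2)], of "acc @ [\<one>]"] True by simp
  next
    case hd: False
    show ?thesis
    proof (cases ?m)
      case Nil
      then have st: "sift_step (acc, R, v, False) = (acc, R, v, True)"
        using hd by (simp add: sift_step_def)
      show ?thesis unfolding * st sift_step_done using hd Nil by simp
    next
      case (Cons r rs)
      then have "r \<in> set ?m" by simp
      then have "r \<in> vecs (Suc n)" using Suc.prems(1) by auto
      then have "tl (vldiv r v) \<in> vecs n" using Suc.prems(2) tl_vecs vldiv_in_vecs by blast
      note IH = Suc.IH[OF R' this, of "acc @ [\<one>]"]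
      have st: "sift_step (acc, R, v, False) = (acc @ [\<one>], tails R, tl (vldiv r v), False)"
        using hd Cons by (simp add: sift_step_def)
      show ?thesis unfolding * st using IH hd Cons by simp
    qed
  qed
qed simp

lemma sift_eq: "set R \<subseteq> vecs n \<Longrightarrow> v \<in> vecs n \<Longrightarrow> sift n R v = sift_rec n R v"
  unfolding sift_def using sift_steps[of R n v "[]"] by simp

lemma sift_rec_cases [consumes 2, case_names one fresh known]:
  assumes R: "set R \<subseteq> vecs (Suc n)" and v: "v \<in> vecs (Suc n)"
  obtains
    w where "v = \<one> # w" "w \<in> vecs n" "sift_rec (Suc n) R v = \<one> # sift_rec n (tails R) w"
  | "hd v \<noteq> \<one>" "\<And>r. r \<in> set R \<Longrightarrow> hd r \<noteq> hd v" "sift_rec (Suc n) R v = v"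
  | r w where "r \<in> set R" "hd r \<noteq> \<one>" "vldiv r v = \<one> # w" "w \<in> vecs n"
    "v = vmul r (\<one> # w)" "sift_rec (Suc n) R v = \<one> # sift_rec n (tails R) w"
proof (cases "hd v = \<one>")
  case True
  then show ?thesis using v that(1)[of "tl v"] by (auto elim!: vecs_SucE)
next
  case hd: False
  let ?m = "filter (\<lambda>r. eql (hd r) (hd v)) R"
  have m: "?m = filter (\<lambda>r. hd r = hd v) R"
    using R hd_vecs[OF v] by (intro filter_cong) (auto intro!: eql_iff hd_vecs)
  show ?thesis
  proof (cases ?m)
    case Nil
    then have "\<And>r. r \<in> set R \<Longrightarrow> hd r \<noteq> hd v" unfolding m by (simp add: filter_empty_conv)
    then show ?thesis using that(2) hd Nil by simp
  next
    case (Cons r rs)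
    then have "r \<in> set ?m" by simp
    then have r: "r \<in> set R" "hd r = hd v" unfolding m by auto
    then have rv: "r \<in> vecs (Suc n)" using R by auto
    then have "vldiv r v \<in> vecs (Suc n)" using v by simp
    then obtain w where w: "vldiv r v = \<one> # w" "w \<in> vecs n"
      using hd_vldiv_same[OF rv v r(2)] by (auto elim!: vecs_SucE)
    show ?thesis
    proof (rule that(3))
      show "r \<in> set R" "hd r \<noteq> \<one>" using r hd by auto
      show "vldiv r v = \<one> # w" "w \<in> vecs n" by fact+
      show "v = vmul r (\<one> # w)" using vmul_vldiv[OF rv v] w(1) by simp
      show "sift_rec (Suc n) R v = \<one> # sift_rec n (tails R) w"
        using hd Cons w(1) by simp
    qed
  qed
qed

lemma sift_rec_vecs: "set R \<subseteq> vecs n \<Longrightarrow> v \<in> vecs n \<Longrightarrow> sift_rec n R v \<in> vecs n"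
proof (induction n arbitrary: R v)
  case (Suc n)
  note IH = Suc.IH[OF tails_vecs[OF Suc.prems(1)]]
  from Suc.prems show ?case
  proof (cases rule: sift_rec_cases)
    case (one w)
    then show ?thesis using IH by simp
  next
    case fresh
    then show ?thesis using Suc.prems(2) by simp
  next
    case (known r w)
    then show ?thesis using IH by simp
  qed
qed simp

lemma sift_rec_ones:
  "set R \<subseteq> vecs n \<Longrightarrow> v \<in> vecs n \<Longrightarrow> sift_rec n R v = ones n \<Longrightarrow> v \<in> span n R"
proof (induction n arbitrary: R v)
  case (Suc n)
  from Suc.prems(1,2) show ?case
  proof (cases rule: sift_rec_cases)
    case (one w)
    then have "w \<in> span n (tails R)"
      using Suc.IH[OF tails_vecs[OF Suc.prems(1)]] Suc.prems(3) by simp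
    then show ?thesis using one Cons_one_in_span[OF Suc.prems(1)] by simp
  next
    case fresh
    then show ?thesis using Suc.prems(3) by simp
  next
    case (known r w)
    then have "w \<in> span n (tails R)"
      using Suc.IH[OF tails_vecs[OF Suc.prems(1)]] Suc.prems(3) by simp
    then show ?thesis using known(1,2,5) by (force simp: lvl_def)
  qed
qed simp

lemma lsub_tail: "lsub (Suc n) S \<Longrightarrow> lsub n {w. \<one> # w \<in> S}"
proof (rule lsubI)
  assume S: "lsub (Suc n) S"
  show "{w. \<one> # w \<in> S} \<subseteq> vecs n" using lsubD(1)[OF S] by (auto dest: subsetD)
  show "ones n \<in> {w. \<one> # w \<in> S}" using lsubD(2)[OF S] by simp
  show "vmul u v \<in> {w. \<one> # w \<in> S}" if "u \<in> {w. \<one> # w \<in> S}" "v \<in> {w. \<one> # w \<in> S}" for u v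
    using lsubD(3)[OF S, of "\<one> # u" "\<one> # v"] that by (simp add: op_eq)
qed

lemma sift_rec_lsub: "lsub n S \<Longrightarrow> set R \<subseteq> S \<Longrightarrow> v \<in> S \<Longrightarrow> sift_rec n R v \<in> S"
proof (induction n arbitrary: R v S)
  case (Suc n)
  have R: "set R \<subseteq> vecs (Suc n)" and v: "v \<in> vecs (Suc n)"
    using Suc.prems lsubD(1) by blast+
  have "set (tails R) \<subseteq> {w. \<one> # w \<in> S}" using tails_iff[OF R] Suc.prems(2) by blast
  note IH = Suc.IH[OF lsub_tail[OF Suc.prems(1)] this]
  from R v show ?case
  proof (cases rule: sift_rec_cases)
    case (one w)
    then show ?thesis using IH Suc.prems(3) by simp
  next
    case fresh
    then show ?thesis using Suc.prems(3) by simp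
  next
    case (known r w)
    then have "\<one> # w \<in> S" using lsubD(4)[OF Suc.prems(1), of r v] Suc.prems(2,3) by auto
    then show ?thesis using IH known by simp
  qed
qed (auto simp: lsub_def)

lemma tails_Cons: "tails (r # R) = (if hd r = \<one> then tl r # tails R else tails R)"
  by (simp add: tails_def)

text \<open>A nontrivial residue has stopped at a level where its head is new, so adding it repeats
  no head.\<close>

lemma keyed_sift_rec:
  "set R \<subseteq> vecs n \<Longrightarrow> v \<in> vecs n \<Longrightarrow> keyed n R \<Longrightarrow> sift_rec n R v \<noteq> ones n \<Longrightarrow>
    keyed n (sift_rec n R v # R)"
proof (induction n arbitrary: R v)
  case (Suc n)
  note IH = Suc.IH[OF tails_vecs[OF Suc.prems(1)]]
  from Suc.prems(1,2) show ?case
  proof (cases rule: sift_rec_cases)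
    case (one w)
    then show ?thesis using IH[of w] Suc.prems(3,4) by (simp add: tails_Cons del: sift_rec.simps)
  next
    case fresh
    then have "hd v \<notin> hd ` set R" by force
    then show ?thesis using fresh(1,3) Suc.prems(3) by (simp add: tails_Cons del: sift_rec.simps)
  next
    case (known r w)
    then show ?thesis using IH[of w] Suc.prems(3,4) by (simp add: tails_Cons del: sift_rec.simps)
  qed
qed simp

lemma length_filter_tails:
  "length R = length (filter (\<lambda>a. a \<noteq> \<one>) (map hd R)) + length (tails R)"
  by (induction R) (auto simp: tails_def)

lemma keyed_length: "keyed n R \<Longrightarrow> set R \<subseteq> vecs n \<Longrightarrow> length R \<le> n * length el"
proof (induction n arbitrary: R)
  case (Suc n)
  let ?h = "filter (\<lambda>a. a \<noteq> \<one>) (map hd R)"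
  have "distinct ?h" using Suc.prems(1) by simp
  then have "length ?h = card (set ?h)" by (rule distinct_card[symmetric])
  also have "\<dots> \<le> card (carrier G)"
    by (rule card_mono) (use Suc.prems(2) hd_vecs in auto)
  finally have "length ?h \<le> length el" by (simp add: card_carrier)
  moreover have "length (tails R) \<le> n * length el"
    using Suc.IH[OF _ tails_vecs[OF Suc.prems(2)]] Suc.prems(1) by simp
  ultimately show ?case using length_filter_tails[of R] by simp
qed simp

section \<open>Completion to a strong generating set\<close>

definition cands :: "'a list list \<Rightarrow> 'a list list \<Rightarrow> 'a list list" where
  "cands gens R = gens @ concat (map (\<lambda>a. map (vmul a) R) R)"

definition nontriv :: "'a list \<Rightarrow> bool" where
  "nontriv v \<longleftrightarrow> (\<exists>a\<in>set v. a \<noteq> \<one>)"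

definition grow :: "nat \<Rightarrow> 'a list list \<Rightarrow> 'a list list \<Rightarrow> 'a list list" where
  "grow n gens R =
     (if filter nontriv (map (sift n R) (cands gens R)) = [] then R
      else hd (filter nontriv (map (sift n R) (cands gens R))) # R)"

text \<open>The number of rounds is the bound that \<open>keyed_length\<close> puts on the length of
  a keyed list.\<close>

definition closure :: "nat \<Rightarrow> 'a list list \<Rightarrow> 'a list list" where
  "closure n gens = (grow n gens ^^ (n * length el)) []"

lemma nontriv_iff: "v \<in> vecs n \<Longrightarrow> nontriv v \<longleftrightarrow> v \<noteq> ones n"
proof -
  assume "v \<in> vecs n"
  then have "length v = n" by (simp add: vecs_def)
  moreover have "\<not> nontriv v \<longleftrightarrow> v = ones (length v)"
    unfolding nontriv_def ones_def by (induction v) auto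
  ultimately show ?thesis by auto
qed

lemma grow_cases [consumes 2, case_names stable grown]:
  assumes gens: "set gens \<subseteq> vecs n" and R: "set R \<subseteq> vecs n"
  obtains "grow n gens R = R" "set gens \<subseteq> span n R"
      "\<And>a b. a \<in> set R \<Longrightarrow> b \<in> set R \<Longrightarrow> vmul a b \<in> span n R"
  | v where "v \<in> set (cands gens R)" "v \<in> vecs n" "sift_rec n R v \<noteq> ones n"
      "grow n gens R = sift_rec n R v # R"
proof -
  have c: "set (cands gens R) \<subseteq> vecs n"
    using gens R by (auto simp: cands_def subset_iff)
  let ?z = "filter nontriv (map (sift n R) (cands gens R))"
  have nt: "nontriv (sift n R v) \<longleftrightarrow> sift_rec n R v \<noteq> ones n" if "v \<in> set (cands gens R)" for v
    using that c sift_eq[OF R] nontriv_iff sift_rec_vecs[OF R] by (metis subsetD)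
  show ?thesis
  proof (cases ?z)
    case Nil
    then have "v \<in> span n R" if "v \<in> set (cands gens R)" for v
      using that nt[OF that] c sift_rec_ones[OF R, of v]
      by (auto simp: filter_empty_conv subset_iff)
    then show ?thesis using that(1) Nil by (auto simp: grow_def cands_def)
  next
    case (Cons z zs)
    then have "z \<in> set ?z" by simp
    then obtain v where v: "v \<in> set (cands gens R)" "z = sift n R v" "nontriv z" by auto
    then have "v \<in> vecs n" "z = sift_rec n R v" using c sift_eq[OF R] by auto
    then show ?thesis using that(2)[of v] v nt[OF v(1)] Cons by (auto simp: grow_def)
  qed
qed

lemma grow_inv:
  assumes "set gens \<subseteq> vecs n" "keyed n R" "set R \<subseteq> vecs n"
  shows "keyed n (grow n gens R) \<and> set (grow n gens R) \<subseteq> vecs n"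
  using assms(1,3)
proof (cases rule: grow_cases)
  case stable
  then show ?thesis using assms by simp
next
  case (grown v)
  then show ?thesis
    using keyed_sift_rec[OF assms(3) _ assms(2)] sift_rec_vecs[OF assms(3)] assms(3) by auto
qed

lemma closure_inv:
  assumes "set gens \<subseteq> vecs n"
  shows "keyed n ((grow n gens ^^ k) []) \<and> set ((grow n gens ^^ k) []) \<subseteq> vecs n"
proof (induction k)
  case 0
  have "keyed n []" by (induction n) (auto simp: tails_def)
  then show ?case by simp
qed (use grow_inv[OF assms] in auto)

lemma grow_lsub:
  assumes "lsub n S" "set gens \<subseteq> S" "set R \<subseteq> S"
  shows "set (grow n gens R) \<subseteq> S"
proof -
  have v: "set gens \<subseteq> vecs n" "set R \<subseteq> vecs n" using assms lsubD(1)[OF assms(1)] by auto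
  then show ?thesis
  proof (cases rule: grow_cases)
    case stable
    then show ?thesis using assms by simp
  next
    case (grown w)
    have "w \<in> S" using grown(1) assms lsubD(3)[OF assms(1)] by (auto simp: cands_def subset_iff)
    then show ?thesis using grown sift_rec_lsub[OF assms(1,3)] assms by auto
  qed
qed

lemma closure_lsub:
  assumes "lsub n S" "set gens \<subseteq> S" shows "set (closure n gens) \<subseteq> S"
proof -
  have "set ((grow n gens ^^ k) []) \<subseteq> S" for k
    by (induction k) (use grow_lsub[OF assms] in auto)
  then show ?thesis by (simp only: closure_def)
qed

text \<open>Each unstable step adds an element, but the number of distinct keys bounds the length.\<close>

lemma closure_stable:
  assumes gens: "set gens \<subseteq> vecs n"
  shows "grow n gens (closure n gens) = closure n gens"
proof -
  let ?R = "\<lambda>k. (grow n gens ^^ k) []"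
  have step: "grow n gens (?R k) = ?R k \<or> length (?R k) \<ge> k" for k
  proof (induction k)
    case (Suc k)
    have "set (?R k) \<subseteq> vecs n" using closure_inv[OF gens] by blast
    with gens show ?case
    proof (cases rule: grow_cases)
      case stable
      then show ?thesis by simp
    next
      case (grown v)
      then show ?thesis using Suc by auto
    qed
  qed simp
  let ?N = "n * length el"
  have "set (?R ?N) \<subseteq> vecs n" using closure_inv[OF gens] by blast
  with gens show ?thesis unfolding closure_def
  proof (cases rule: grow_cases)
    case stable
    then show "grow n gens (?R ?N) = ?R ?N" by simp
  next
    case (grown v)
    have "length (?R (Suc ?N)) \<le> ?N"
      using closure_inv[OF gens, of "Suc ?N"] keyed_length by blast
    moreover have "length (?R (Suc ?N)) = Suc (length (?R ?N))" using grown by simp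
    ultimately show "grow n gens (?R ?N) = ?R ?N" using step[of ?N] by auto
  qed
qed

lemma closure_vecs: "set gens \<subseteq> vecs n \<Longrightarrow> set (closure n gens) \<subseteq> vecs n"
  using closure_inv unfolding closure_def by blast

lemma closure_sgs:
  assumes gens: "set gens \<subseteq> vecs n"
  shows "sgs n (closure n gens)" "set gens \<subseteq> span n (closure n gens)"
proof -
  from gens closure_vecs[OF gens]
  have "(\<forall>a\<in>set (closure n gens). \<forall>b\<in>set (closure n gens). vmul a b \<in> span n (closure n gens))
      \<and> set gens \<subseteq> span n (closure n gens)"
  proof (cases rule: grow_cases)
    case (grown v)
    then show ?thesis using closure_stable[OF gens] by simp
  qed auto
  then show "sgs n (closure n gens)" "set gens \<subseteq> span n (closure n gens)"
    using closure_inv[OF gens, of "n * length el"] unfolding sgs_def closure_def by auto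
qed

text \<open>The generated subgroup, described by minimality: this form passes along homomorphisms
  and does not depend on how the elements are produced.\<close>

definition gensby :: "nat \<Rightarrow> 'a list list \<Rightarrow> 'a list set \<Rightarrow> bool" where
  "gensby n gens S \<longleftrightarrow> lsub n S \<and> set gens \<subseteq> S \<and> (\<forall>Z. lsub n Z \<longrightarrow> set gens \<subseteq> Z \<longrightarrow> S \<subseteq> Z)"

lemma gensby_vecs: "gensby n gens S \<Longrightarrow> set gens \<subseteq> vecs n"
  by (auto simp: gensby_def lsub_def)

lemma span_closure:
  assumes "gensby n gens S" shows "span n (closure n gens) = S"
proof
  have S: "lsub n S" "set gens \<subseteq> S" using assms by (auto simp: gensby_def)
  show "span n (closure n gens) \<subseteq> S"
    by (rule span_least) (use closure_lsub[OF S] lsubD[OF S(1)] in auto)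
  show "S \<subseteq> span n (closure n gens)"
    using assms closure_sgs[OF gensby_vecs[OF assms]] sgs_lsub by (auto simp: gensby_def)
qed

text \<open>Minimality of the image holds because the preimage of a subgroup \<open>Z\<close> is a
  subgroup that contains the generators.\<close>

lemma gensby_image:
  assumes g: "gensby n gens S"
    and f: "\<And>v. v \<in> vecs n \<Longrightarrow> f v \<in> vecs m" "f (ones n) = ones m"
      "\<And>u v. u \<in> vecs n \<Longrightarrow> v \<in> vecs n \<Longrightarrow> f (vmul u v) = vmul (f u) (f v)"
  shows "gensby m (map f gens) (f ` S)"
  unfolding gensby_def
proof (intro conjI allI impI)
  have S: "lsub n S" "set gens \<subseteq> S" using g by (auto simp: gensby_def)
  note Sv = lsubD(1)[OF S(1)]
  show "lsub m (f ` S)"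
  proof (rule lsubI)
    show "f ` S \<subseteq> vecs m" using f(1) Sv by auto
    show "ones m \<in> f ` S" using f(2) lsubD(2)[OF S(1)] by force
    show "vmul u v \<in> f ` S" if uv: "u \<in> f ` S" "v \<in> f ` S" for u v
    proof -
      from uv obtain u' v' where "u' \<in> S" "v' \<in> S" "u = f u'" "v = f v'" by blast
      then have "vmul u v = f (vmul u' v')" "vmul u' v' \<in> S"
        using f(3) Sv lsubD(3)[OF S(1)] by (auto simp: subset_iff)
      then show ?thesis by blast
    qed
  qed
  show "set (map f gens) \<subseteq> f ` S" using S by auto
  show "f ` S \<subseteq> Z" if Z: "lsub m Z" "set (map f gens) \<subseteq> Z" for Z
  proof -
    let ?Y = "{v \<in> vecs n. f v \<in> Z}"
    have "lsub n ?Y"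
      by (rule lsubI) (use f lsubD[OF Z(1)] in auto)
    moreover have "set gens \<subseteq> ?Y" using Z(2) S(2) Sv by auto
    ultimately have "S \<subseteq> ?Y" using g by (simp add: gensby_def)
    then show ?thesis by auto
  qed
qed

section \<open>Levels confined to a proper subgroup, and the order of the span\<close>

fun nproper :: "nat \<Rightarrow> 'a list list \<Rightarrow> nat" where
  "nproper 0 R = 0"
| "nproper (Suc n) R = (if hd ` lvl (Suc n) R = carrier G then 0 else 1) + nproper n (tails R)"

lemma nproper_le: "nproper n R \<le> n"
proof (induction n arbitrary: R)
  case (Suc n)
  have "nproper n (tails R) \<le> n" by (rule Suc)
  then show ?case by simp
qed simp

text \<open>Choosing one transversal element for each head gives an injection: the head of a product
  recovers the element, and left division the tail.\<close>

lemma card_span_Suc: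
  assumes R: "set R \<subseteq> vecs (Suc n)"
  shows "card (hd ` lvl (Suc n) R) * card (span n (tails R)) \<le> card (span (Suc n) R)"
proof -
  let ?U = "lvl (Suc n) R" and ?Q = "span n (tails R)"
  have Uv: "?U \<subseteq> vecs (Suc n)" and Qv: "?Q \<subseteq> vecs n"
    using lvl_vecs[OF R] span_vecs[OF tails_vecs[OF R]] by auto
  have "\<forall>a \<in> hd ` ?U. \<exists>u. u \<in> ?U \<and> hd u = a" by auto
  then obtain pick where pick: "\<And>a. a \<in> hd ` ?U \<Longrightarrow> pick a \<in> ?U \<and> hd (pick a) = a"
    by metis
  let ?f = "\<lambda>(a, w). vmul (pick a) (\<one> # w)"
  have inj: "inj_on ?f (hd ` ?U \<times> ?Q)"
  proof (rule inj_onI)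
    fix p p' assume pp: "p \<in> hd ` ?U \<times> ?Q" "p' \<in> hd ` ?U \<times> ?Q" "?f p = ?f p'"
    obtain a w b x where p: "p = (a, w)" "p' = (b, x)" by (cases p, cases p')
    have *: "a \<in> hd ` ?U" "w \<in> ?Q" "b \<in> hd ` ?U" "x \<in> ?Q"
      "vmul (pick a) (\<one> # w) = vmul (pick b) (\<one> # x)"
      using pp unfolding p by simp_all
    have v: "pick a \<in> vecs (Suc n)" "pick b \<in> vecs (Suc n)" "\<one> # w \<in> vecs (Suc n)"
      "\<one> # x \<in> vecs (Suc n)" using pick * Uv Qv by auto
    have "hd (pick a) = a" "hd (pick b) = b" using pick * by auto
    then have "hd (vmul (pick a) (\<one> # w)) = a" "hd (vmul (pick b) (\<one> # x)) = b"
      using hd_vmul[OF v(1,3)] hd_vmul[OF v(2,4)] hd_vecs[OF v(1)] hd_vecs[OF v(2)] by simp_all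
    then have "a = b" by (metis *(5))
    moreover have "\<one> # w = \<one> # x"
      using vldiv_vmul[OF v(1,3)] vldiv_vmul[OF v(2,4)] by (metis *(5) \<open>a = b\<close>)
    ultimately show "p = p'" using p by simp
  qed
  have "?f ` (hd ` ?U \<times> ?Q) \<subseteq> span (Suc n) R" using pick by fastforce
  then have "card (hd ` ?U \<times> ?Q) \<le> card (span (Suc n) R)"
    using card_inj_on_le[OF inj _ finite_span[OF R]] by blast
  then show ?thesis by (simp add: card_cartesian_product)
qed

lemma length_el_pos: "length el > 0"
  using set_el one_closed by (cases el) auto

text \<open>Each level with all of \<open>G\<close> as heads multiplies the order by
  \<open>|G|\<close>. Read the other way, a small subgroup has many proper levels, and these are
  where the greedy choice gains.\<close>

lemma card_span_proper: "set R \<subseteq> vecs n \<Longrightarrow> length el ^ (n - nproper n R) \<le> card (span n R)"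
proof (induction n arbitrary: R)
  case (Suc n)
  let ?c = "card (hd ` lvl (Suc n) R)" and ?Q = "span n (tails R)"
  have IH: "length el ^ (n - nproper n (tails R)) \<le> card ?Q"
    using Suc.IH[OF tails_vecs[OF Suc.prems]] .
  show ?case
  proof (cases "hd ` lvl (Suc n) R = carrier G")
    case True
    have "length el ^ (Suc n - nproper (Suc n) R) = length el * length el ^ (n - nproper n (tails R))"
      using True nproper_le[of n "tails R"] by (simp add: Suc_diff_le)
    also have "\<dots> \<le> ?c * card ?Q" using IH True by (simp add: card_carrier)
    finally show ?thesis using card_span_Suc[OF Suc.prems] by (rule le_trans)
  next
    case False
    have fin: "finite (lvl (Suc n) R)" by (rule finite_subset[OF lvl_vecs[OF Suc.prems] finite_vecs])
    then have "?c \<noteq> 0" by (simp add: lvl_def)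
    then have "card ?Q \<le> ?c * card ?Q" by simp
    then have "length el ^ (n - nproper n (tails R)) \<le> card (span (Suc n) R)"
      using IH card_span_Suc[OF Suc.prems] le_trans by blast
    then show ?thesis using False by (simp del: span.simps)
  qed
qed simp

text \<open>A level with \<open>t\<close> generators of its own offers at most
  \<open>t + 1 \<le> 2 ^ t\<close> factors.\<close>

lemma card_span_upper: "set R \<subseteq> vecs n \<Longrightarrow> card (span n R) \<le> 2 ^ length R"
proof (induction n arbitrary: R)
  case (Suc n)
  let ?h = "filter (\<lambda>a. a \<noteq> \<one>) (map hd R)" and ?Q = "span n (tails R)"
  have fin: "finite (lvl (Suc n) R)" by (rule finite_subset[OF lvl_vecs[OF Suc.prems] finite_vecs])
  have "card (lvl (Suc n) R) \<le> Suc (card (set (filter (\<lambda>r. hd r \<noteq> \<one>) R)))"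
    unfolding lvl_def by (simp add: card_insert_if)
  also have "\<dots> \<le> Suc (length ?h)"
    using card_length[of "filter (\<lambda>r. hd r \<noteq> \<one>) R"] by (simp add: filter_map o_def)
  also have "\<dots> \<le> 2 ^ length ?h" by (simp add: Suc_leI)
  finally have 1: "card (lvl (Suc n) R) \<le> 2 ^ length ?h" .
  have "card (span (Suc n) R) \<le> card (lvl (Suc n) R \<times> ?Q)"
    unfolding span.simps using fin finite_span[OF tails_vecs[OF Suc.prems]]
    by (intro card_image_le) simp
  also have "\<dots> \<le> 2 ^ length ?h * 2 ^ length (tails R)"
    unfolding card_cartesian_product using 1 Suc.IH[OF tails_vecs[OF Suc.prems]] by (rule mult_le_mono)
  finally show ?case by (metis length_filter_tails power_add)
qed simp

text \<open>A level with \<open>t > 0\<close> generators of its own has \<open>t + 1 \<ge> 2\<close>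
  heads and \<open>t \<le> |G|\<close>, so \<open>2 ^ t \<le> (t + 1) ^ |G|\<close>. Together with
  \<open>card_span_upper\<close>, this makes the length of \<open>R\<close> a computable estimate of
  \<open>\<delta>\<close>.\<close>

lemma card_span_lower:
  "set R \<subseteq> vecs n \<Longrightarrow> keyed n R \<Longrightarrow> 2 ^ length R \<le> card (span n R) ^ length el"
proof (induction n arbitrary: R)
  case (Suc n)
  let ?h = "filter (\<lambda>a. a \<noteq> \<one>) (map hd R)" and ?Q = "span n (tails R)"
  let ?c = "card (hd ` lvl (Suc n) R)"
  have dist: "distinct ?h" using Suc.prems(2) by simp
  have lvl: "hd ` lvl (Suc n) R = insert \<one> (set ?h)" by (auto simp: lvl_def)
  have c: "?c = Suc (length ?h)"
    unfolding lvl using dist distinct_card[OF dist] by (simp add: card_insert_if del: set_filter set_map) auto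
  have "set ?h \<subseteq> carrier G" using Suc.prems(1) hd_vecs by auto
  then have "card (set ?h) \<le> card (carrier G)" by (intro card_mono) auto
  then have "length ?h \<le> length el"
    using distinct_card[OF dist] by (simp only: card_carrier)
  have "(2::nat) ^ length ?h \<le> ?c ^ length el"
  proof (cases "length ?h = 0")
    case True
    then show ?thesis unfolding c True by simp
  next
    case False
    have "(2::nat) ^ length ?h \<le> 2 ^ length el"
      using \<open>length ?h \<le> length el\<close> by (intro power_increasing) auto
    also have "\<dots> \<le> ?c ^ length el" unfolding c using False by (intro power_mono) linarith+
    finally show ?thesis .
  qed
  moreover have "2 ^ length (tails R) \<le> card ?Q ^ length el"
    using Suc.IH[OF tails_vecs[OF Suc.prems(1)]] Suc.prems(2) by simp
  ultimately have "2 ^ length ?h * 2 ^ length (tails R) \<le> (?c * card ?Q) ^ length el"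
    unfolding power_mult_distrib by (rule mult_le_mono)
  also have "\<dots> \<le> card (span (Suc n) R) ^ length el"
    using card_span_Suc[OF Suc.prems(1)] by (intro power_mono) auto
  finally show ?case by (metis length_filter_tails power_add)
qed simp

end

section \<open>Escaping many subgroups\<close>

definition proj :: "bool list \<Rightarrow> 'a list \<Rightarrow> 'a list" where
  "proj T v = map snd (filter fst (zip T v))"

definition cnt :: "bool list \<Rightarrow> nat" where
  "cnt T = length (filter (\<lambda>b. b) T)"

lemma proj_simps [simp]: "proj [] v = []" "proj (b # T) (a # v) = (if b then a # proj T v else proj T v)"
  by (auto simp: proj_def)

lemma cnt_simps [simp]: "cnt [] = 0" "cnt (b # T) = (if b then Suc (cnt T) else cnt T)"
  by (auto simp: cnt_def)

lemma foldl_select_min: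
  fixes f :: "'a \<Rightarrow> 'b::linorder"
  shows "z \<in> insert c (set ys) \<Longrightarrow> f (foldl (\<lambda>u y. if f y < f u then y else u) c ys) \<le> f z"
proof (induction ys arbitrary: c z)
  case (Cons y ys)
  let ?c = "if f y < f c then y else c"
  have IH: "f (foldl (\<lambda>u y. if f y < f u then y else u) ?c ys) \<le> f w" if "w \<in> insert ?c (set ys)" for w
    using Cons.IH[OF that] .
  show ?case
  proof (cases "z \<in> set ys")
    case True
    then show ?thesis using IH by simp
  next
    case False
    then have "f ?c \<le> f z" using Cons.prems by auto
    then show ?thesis using IH[of ?c] by simp
  qed
qed simp

section \<open>The greedy choice\<close>

type_synonym 'a entry = "bool list \<times> 'a list list \<times> 'a list"

context listed_group begin

lemma proj_vecs: "length T = n \<Longrightarrow> v \<in> vecs n \<Longrightarrow> proj T v \<in> vecs (cnt T)"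
proof (induction T arbitrary: n v)
  case (Cons b T)
  then show ?case by (cases n) (auto elim!: vecs_SucE)
qed simp

lemma proj_ones: "length T = n \<Longrightarrow> proj T (ones n) = ones (cnt T)"
  by (induction T arbitrary: n) auto

lemma proj_vmul:
  "length T = n \<Longrightarrow> u \<in> vecs n \<Longrightarrow> v \<in> vecs n \<Longrightarrow> proj T (vmul u v) = vmul (proj T u) (proj T v)"
proof (induction T arbitrary: n u v)
  case (Cons b T)
  then show ?case by (cases n) (auto elim!: vecs_SucE)
qed simp

text \<open>An entry \<open>(T, R, y)\<close> stands for the coset \<open>y \<cdot> span R\<close> of possible continuations on the
  coordinates selected by \<open>T\<close>.\<close>

definition matches :: "'a entry \<Rightarrow> 'a \<Rightarrow> 'a list list" where
  "matches E g = filter (\<lambda>u. eql (op (hd (snd (snd E))) (hd u)) g)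
     (ones (length (snd (snd E))) # fst (snd E))"

definition rare :: "'a entry \<Rightarrow> bool" where
  "rare E \<longleftrightarrow> 2 * length (filter (\<lambda>h. matches E h \<noteq> []) el) \<le> length el"

text \<open>Multiplication by the matching transversal element sets the current entry to
  \<open>g\<close>; what remains is a coset of the next level, represented by the tail of the
  product.\<close>

definition advance :: "'a \<Rightarrow> 'a entry \<Rightarrow> 'a entry" where
  "advance g E = (tl (fst E), tails (fst (snd E)), tl (vmul (snd (snd E)) (hd (matches E g))))"

text \<open>Weights are kept as multiplicities, so that comparing weights means comparing lengths.
  This is affordable because the greedy choice never lets the total grow.\<close>

definition ext :: "'a \<Rightarrow> 'a entry \<Rightarrow> 'a entry list" where
  "ext g E =
     (if \<not> hd (fst E) then [(tl (fst E), snd E)]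
      else if matches E g = [] then []
      else if rare E then [advance g E, advance g E]
      else [advance g E])"

definition extend :: "'a \<Rightarrow> 'a entry list \<Rightarrow> 'a entry list" where
  "extend g L = concat (map (ext g) L)"

definition choose_elt :: "'a entry list \<Rightarrow> 'a" where
  "choose_elt L = foldl (\<lambda>u g. if length (extend g L) < length (extend u L) then g else u) \<one> el"

definition greedy_step :: "'a list \<times> 'a entry list \<Rightarrow> 'a list \<times> 'a entry list" where
  "greedy_step s = (fst s @ [choose_elt (snd s)], extend (choose_elt (snd s)) (snd s))"

definition greedy :: "nat \<Rightarrow> 'a entry list \<Rightarrow> 'a list" where
  "greedy n L = fst ((greedy_step ^^ n) ([], L))"

lemma choose_elt_carrier: "choose_elt L \<in> carrier G"
  using foldl_select_mem[of "\<lambda>u g. length (extend g L) < length (extend u L)" \<one> el]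
  by (auto simp: choose_elt_def set_el)

lemma choose_elt_min: "g \<in> carrier G \<Longrightarrow> length (extend (choose_elt L) L) \<le> length (extend g L)"
  using foldl_select_min[of g \<one> el "\<lambda>g. length (extend g L)"]
  by (simp add: choose_elt_def set_el)

text \<open>Doubling happens only if at most half of the elements let the entry survive.\<close>

lemma sum_length_ext: "(\<Sum>g\<leftarrow>el. length (ext g E)) \<le> length el"
proof (cases "hd (fst E)")
  case False
  then show ?thesis by (simp add: ext_def sum_list_triv)
next
  case True
  let ?c = "if rare E then 2 else 1 :: nat"
  have "length (ext g E) = (if matches E g \<noteq> [] then ?c else 0)" for g
    using True by (simp add: ext_def)
  then have "(\<Sum>g\<leftarrow>el. length (ext g E)) = (\<Sum>g\<leftarrow>el. if matches E g \<noteq> [] then ?c else 0)"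
    by simp
  also have "\<dots> = ?c * length (filter (\<lambda>g. matches E g \<noteq> []) el)"
  proof -
    have "(\<Sum>g\<leftarrow>xs. if matches E g \<noteq> [] then c else 0) = c * length (filter (\<lambda>g. matches E g \<noteq> []) xs)"
      for c :: nat and xs by (induction xs) auto
    then show ?thesis by blast
  qed
  also have "\<dots> \<le> length el" by (simp add: rare_def)
  finally show ?thesis .
qed

text \<open>Averaging: after exchanging the sums over \<open>el\<close> and \<open>L\<close>, the
  mean of the extended lengths is at most \<open>length L\<close>, so the minimum is too.\<close>

lemma length_extend_choose: "length (extend (choose_elt L) L) \<le> length L"
proof (rule ccontr)
  assume "\<not> ?thesis"
  then have *: "Suc (length L) \<le> length (extend g L)" if "g \<in> set el" for g
    using choose_elt_min[of g L] that set_el by auto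
  have "length el * Suc (length L) = (\<Sum>g\<leftarrow>el. Suc (length L))" by (simp add: sum_list_triv)
  also have "\<dots> \<le> (\<Sum>g\<leftarrow>el. length (extend g L))" using * by (rule sum_list_mono)
  also have "\<dots> = (\<Sum>g\<leftarrow>el. \<Sum>E\<leftarrow>L. length (ext g E))"
    by (simp add: extend_def length_concat o_def)
  also have "\<dots> = (\<Sum>E\<leftarrow>L. \<Sum>g\<leftarrow>el. length (ext g E))"
    by (induction L) (auto simp: sum_list_addf)
  also have "\<dots> \<le> (\<Sum>E\<leftarrow>L. length el)" by (rule sum_list_mono) (rule sum_length_ext)
  also have "\<dots> = length el * length L" by (simp add: sum_list_triv)
  finally show False using length_el_pos by simp
qed

abbreviation run :: "'a list \<Rightarrow> 'a entry list \<Rightarrow> 'a entry list" where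
  "run x L \<equiv> foldl (\<lambda>L g. extend g L) L x"

lemma greedy_steps:
  "(greedy_step ^^ k) ([], L) = (greedy k L, run (greedy k L) L) \<and>
     greedy k L \<in> vecs k \<and> length (run (greedy k L) L) \<le> length L"
proof (induction k)
  case (Suc k)
  let ?x = "greedy k L"
  let ?g = "choose_elt (run ?x L)"
  have s: "(greedy_step ^^ Suc k) ([], L) = (?x @ [?g], extend ?g (run ?x L))"
    by (simp only: funpow.simps(2) o_apply Suc[THEN conjunct1]) (simp add: greedy_step_def)
  then have g: "greedy (Suc k) L = ?x @ [?g]" by (simp add: greedy_def)
  have "length (run (?x @ [?g]) L) \<le> length L"
    using Suc length_extend_choose[of "run ?x L"] by simp
  moreover have "?x @ [?g] \<in> vecs (Suc k)"
    using Suc choose_elt_carrier by (auto simp: vecs_def)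
  ultimately show ?case unfolding s g by simp
qed (simp add: greedy_def)

lemma extend_append: "extend g (K @ L) = extend g K @ extend g L"
  by (simp add: extend_def)

lemma run_append: "run x (K @ L) = run x K @ run x L"
  by (induction x arbitrary: K L) (simp_all add: extend_append)

text \<open>Entries evolve independently, so the survivors of one entry are part of the
  total.\<close>

lemma run_member: "E \<in> set L \<Longrightarrow> length (run x [E]) \<le> length (run x L)"
proof -
  assume "E \<in> set L"
  then obtain K M where "L = K @ [E] @ M" by (auto dest: split_list)
  then show ?thesis by (simp only: run_append length_append)
qed

lemma left_cancel_iff:
  "a \<in> carrier G \<Longrightarrow> b \<in> carrier G \<Longrightarrow> c \<in> carrier G \<Longrightarrow> a \<otimes> b = a \<otimes> c \<longleftrightarrow> b = c"
  using Units_l_cancel Units_eq by simp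

text \<open>A proper subgroup has index at least 2 by Lagrange; closure under inverses comes from
  finiteness.\<close>

lemma subgroup_half:
  assumes A: "A \<subseteq> carrier G" "\<one> \<in> A" "\<And>a b. a \<in> A \<Longrightarrow> b \<in> A \<Longrightarrow> a \<otimes> b \<in> A" "A \<noteq> carrier G"
  shows "2 * card A \<le> length el"
proof -
  have fin: "finite A" by (rule finite_subset[OF A(1) finite_carrier])
  have "subgroup A G"
  proof (rule subgroupI)
    show "inv a \<in> A" if a: "a \<in> A" for a
    proof -
      have "inj_on ((\<otimes>) a) A" using A(1) a by (intro inj_onI) (simp add: left_cancel_iff subset_iff)
      moreover have "(\<otimes>) a ` A \<subseteq> A" using A(3) a by blast
      ultimately have "(\<otimes>) a ` A = A" using fin by (intro endo_inj_surj)
      then obtain b where "b \<in> A" "a \<otimes> b = \<one>" using A(2) by (metis imageE)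
      then show ?thesis using A(1) a inv_equality inv_comm by (metis subsetD)
    qed
  qed (use A in auto)
  from lagrange[OF this] have lag: "card (rcosets A) * card A = length el"
    by (simp add: Coset.order_def card_carrier)
  have "card A < length el"
    using psubset_card_mono[OF finite_carrier] A(1,4) by (simp add: card_carrier psubset_eq)
  then have "card (rcosets A) \<noteq> 0" "card (rcosets A) \<noteq> 1" using lag by (intro notI; simp)+
  then have "2 \<le> card (rcosets A)" by linarith
  then have "2 * card A \<le> card (rcosets A) * card A" by (rule mult_le_mono1)
  then show ?thesis using lag by simp
qed

text \<open>For a strong generating set, the heads of a level are the projection of the span to its
  first coordinate, hence a subgroup of \<open>G\<close>.\<close>

lemma sgs_heads_half:
  assumes R: "sgs (Suc n) R" and p: "hd ` lvl (Suc n) R \<noteq> carrier G"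
  shows "2 * card (hd ` lvl (Suc n) R) \<le> length el"
proof (rule subgroup_half[OF _ _ _ p])
  have Rv: "set R \<subseteq> vecs (Suc n)" using R by (simp add: sgs_def)
  have Uv: "lvl (Suc n) R \<subseteq> vecs (Suc n)" using lvl_vecs[OF Rv] .
  show "hd ` lvl (Suc n) R \<subseteq> carrier G" using Uv hd_vecs by auto
  show "\<one> \<in> hd ` lvl (Suc n) R" by (simp add: lvl_def)
  show "a \<otimes> b \<in> hd ` lvl (Suc n) R" if "a \<in> hd ` lvl (Suc n) R" "b \<in> hd ` lvl (Suc n) R" for a b
  proof -
    from that obtain u v where uv: "u \<in> lvl (Suc n) R" "v \<in> lvl (Suc n) R" "a = hd u" "b = hd v"
      by blast
    then have in_v: "u \<in> vecs (Suc n)" "v \<in> vecs (Suc n)" using Uv by auto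
    have "vmul u v \<in> span (Suc n) R"
      using sgs_mult[OF R] lvl_subset_span[OF Rv] uv by blast
    then obtain u' w where u': "u' \<in> lvl (Suc n) R" "w \<in> span n (tails R)" "vmul u v = vmul u' (\<one> # w)"
      by auto
    have w: "\<one> # w \<in> vecs (Suc n)" "u' \<in> vecs (Suc n)"
      using u' Uv span_vecs[OF tails_vecs[OF Rv]] by auto
    have "a \<otimes> b = hd (vmul u v)" using hd_vmul[OF in_v] uv by simp
    also have "\<dots> = hd u'" using hd_vmul[OF w(2,1)] hd_vecs[OF w(2)] by (simp add: u'(3))
    finally show ?thesis using u'(1) by simp
  qed
qed

text \<open>An entry whose coset contains the restriction of \<open>x\<close> is never discarded,
  and it doubles at each proper level, where \<open>sgs_heads_half\<close> makes it rare. The coset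
  representative \<open>y\<close> is general because \<open>advance\<close> changes it.\<close>

lemma run_survivors:
  "length T = n \<Longrightarrow> x \<in> vecs n \<Longrightarrow> sgs (cnt T) R \<Longrightarrow> y \<in> vecs (cnt T) \<Longrightarrow> w \<in> span (cnt T) R \<Longrightarrow>
     vmul y w = proj T x \<Longrightarrow> 2 ^ nproper (cnt T) R \<le> length (run x [(T, R, y)])"
proof (induction T arbitrary: n x R y w)
  case Nil
  then show ?case by simp
next
  case (Cons b T)
  let ?E = "(b # T, R, y)"
  obtain m where n: "n = Suc m" "length T = m" using Cons.prems(1) by (cases n) auto
  obtain g x' where x: "x = g # x'" "g \<in> carrier G" "x' \<in> vecs m"
    using Cons.prems(2) n by (auto elim!: vecs_SucE)
  have run: "run x [?E] = run x' (ext g ?E)" by (simp add: x extend_def)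
  show ?case
  proof (cases b)
    case False
    then have "ext g ?E = [(T, R, y)]" by (simp add: ext_def)
    then show ?thesis unfolding run
      using Cons.IH[OF n(2) x(3), of R y w] Cons.prems False x(1) by simp
  next
    case b: True
    let ?m = "cnt T"
    let ?U = "lvl (Suc ?m) R"
    have R: "sgs (Suc ?m) R" and y: "y \<in> vecs (Suc ?m)" and w: "w \<in> span (Suc ?m) R"
      and yw: "vmul y w = g # proj T x'" using Cons.prems b x(1) by simp_all
    have Rv: "set R \<subseteq> vecs (Suc ?m)" and keyed: "keyed (Suc ?m) R" using R by (auto simp: sgs_def)
    have Uv: "?U \<subseteq> vecs (Suc ?m)" using lvl_vecs[OF Rv] .
    from w obtain u w' where u: "u \<in> ?U" "w' \<in> span ?m (tails R)" "w = vmul u (\<one> # w')"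
      by auto
    have uv: "u \<in> vecs (Suc ?m)" "\<one> # w' \<in> vecs (Suc ?m)"
      using u Uv span_vecs[OF tails_vecs[OF Rv]] by auto
    obtain y0 y' where y0: "y = y0 # y'" "y0 \<in> carrier G" "y' \<in> vecs ?m"
      using y by (rule vecs_SucE)
    have ly: "ones (length y) = ones (Suc ?m)" using y by (simp add: length_vecs)
    have hu: "hd u \<in> carrier G" using hd_vecs[OF uv(1)] .
    have yuw: "vmul (vmul y u) (\<one> # w') = g # proj T x'"
      using vmul_assoc[OF y uv] yw u(3) by simp
    have gu: "y0 \<otimes> hd u = g"
    proof -
      have "hd (vmul (vmul y u) (\<one> # w')) = hd (vmul y u)"
        using hd_vmul[OF vmul_in_vecs[OF y uv(1)] uv(2)] hd_vecs[OF vmul_in_vecs[OF y uv(1)]] by simp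
      then show ?thesis using hd_vmul[OF y uv(1)] yuw y0 by simp
    qed
    have ones_R: "set (ones (Suc ?m) # R) \<subseteq> vecs (Suc ?m)" using Rv ones_in_vecs[of "Suc ?m"] by auto
    have matches: "matches ?E h = filter (\<lambda>v. y0 \<otimes> hd v = h) (ones (Suc ?m) # R)"
      if "h \<in> carrier G" for h
      unfolding matches_def snd_conv fst_conv ly
    proof (rule filter_cong[OF refl])
      fix v assume "v \<in> set (ones (Suc ?m) # R)"
      then have "hd v \<in> carrier G" using ones_R hd_vecs by blast
      then show "eql (op (hd y) (hd v)) h \<longleftrightarrow> y0 \<otimes> hd v = h"
        using that y0 by (simp add: op_eq eql_iff)
    qed
    have match_iff: "y0 \<otimes> hd v = g \<longleftrightarrow> hd v = hd u" if "v \<in> set (ones (Suc ?m) # R)" for v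
    proof -
      have "hd v \<in> carrier G" using that ones_R hd_vecs by blast
      then show ?thesis using left_cancel_iff[OF y0(2) _ hu, of "hd v"] gu by simp
    qed
    have mg: "matches ?E g = filter (\<lambda>v. hd v = hd u) (ones (Suc ?m) # R)"
      unfolding matches[OF x(2)] by (intro filter_cong refl match_iff)
    have uin: "u \<in> set (matches ?E g)" unfolding mg using u(1) by (auto simp: lvl_def)
    \<comment> \<open>If \<open>hd u = \<one>\<close>, generators of later levels match as well;
      since \<open>ones\<close> stands first in the list, \<open>hd\<close> still returns the
      transversal element. A nontrivial head has a unique match because \<open>R\<close> is
      keyed.\<close>
    have hdm: "hd (matches ?E g) = u"
    proof (cases "hd u = \<one>")
      case True
      then show ?thesis using u(1) unfolding mg by (auto simp: lvl_def)
    next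
      case False
      have "hd (matches ?E g) \<in> set (matches ?E g)" using uin by (intro hd_in_set) auto
      then have *: "hd (matches ?E g) \<in> set (ones (Suc ?m) # R)" "hd (hd (matches ?E g)) = hd u"
        unfolding mg by auto
      then have "hd (matches ?E g) \<in> ?U" using False by (auto simp: lvl_def)
      then show ?thesis using keyed_lvl_inj[OF keyed] u(1) *(2) by (auto simp: inj_on_def)
    qed
    let ?E' = "(T, tails R, tl (vmul y u))"
    have adv: "advance g ?E = ?E'" by (simp add: advance_def hdm)
    have "vmul y u \<in> vecs (Suc ?m)" using y uv by simp
    then obtain a z where yu: "vmul y u = a # z" "a \<in> carrier G" "z \<in> vecs ?m" by (rule vecs_SucE)
    have "vmul z w' = proj T x'" using yuw unfolding yu(1) by simp
    then have IH: "2 ^ nproper ?m (tails R) \<le> length (run x' [?E'])"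
      using Cons.IH[OF n(2) x(3) sgs_tails[OF R] yu(3) u(2)] yu(1) by simp
    have ext: "ext g ?E = (if rare ?E then [?E', ?E'] else [?E'])"
    proof -
      have "\<not> \<not> hd (fst ?E)" "matches ?E g \<noteq> []" using b uin by auto
      then show ?thesis unfolding ext_def adv by (simp only: if_False)
    qed
    show ?thesis
    proof (cases "hd ` ?U = carrier G")
      case True
      have "length (run x' [?E']) \<le> length (run x' (ext g ?E))"
        by (rule run_member) (simp add: ext)
      then show ?thesis unfolding run using IH True b by simp
    next
      case False
      have "filter (\<lambda>h. matches ?E h \<noteq> []) el = filter (\<lambda>h. h \<in> (\<otimes>) y0 ` hd ` ?U) el"
      proof (rule filter_cong[OF refl])
        fix h assume "h \<in> set el"
        then have "h \<in> carrier G" using set_el by simp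
        then show "matches ?E h \<noteq> [] \<longleftrightarrow> h \<in> (\<otimes>) y0 ` hd ` ?U"
          unfolding matches[OF \<open>h \<in> carrier G\<close>] by (force simp: filter_empty_conv lvl_def)
      qed
      then have "length (filter (\<lambda>h. matches ?E h \<noteq> []) el) =
          card (set (filter (\<lambda>h. h \<in> (\<otimes>) y0 ` hd ` ?U) el))"
        using distinct_el by (simp only: distinct_card distinct_filter)
      also have "\<dots> \<le> card ((\<otimes>) y0 ` hd ` ?U)"
        by (rule card_mono) (auto intro!: finite_imageI finite_subset[OF Uv finite_vecs])
      also have "\<dots> \<le> card (hd ` ?U)"
        by (rule card_image_le) (auto intro!: finite_imageI finite_subset[OF Uv finite_vecs])
      finally have "rare ?E" using sgs_heads_half[OF R False] by (simp add: rare_def)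
      then have "length (run x' (ext g ?E)) = 2 * length (run x' [?E'])"
        using run_append[of "[?E']" "[?E']" x'] by (simp add: ext)
      then show ?thesis unfolding run using IH False b by simp
    qed
  qed
qed

definition entry :: "'a list list \<Rightarrow> bool list \<Rightarrow> 'a entry" where
  "entry gens T = (T, closure (cnt T) (map (proj T) gens), ones (cnt T))"

definition solve :: "nat \<Rightarrow> bool list list \<Rightarrow> 'a list list \<Rightarrow> 'a list" where
  "solve n F gens = greedy n (map (entry gens) F)"

lemma solve_vecs: "solve n F gens \<in> vecs n"
  using greedy_steps unfolding solve_def by blast

text \<open>Otherwise the entry of \<open>T\<close> has \<open>2 ^ p\<close> survivors, where
  \<open>p\<close> is its number of proper levels, while the whole list never exceeds
  \<open>length F\<close>. The remaining levels are paid for by the order of the restricted group,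
  which is at most that of \<open>S\<close>.\<close>

lemma solve_escapes:
  assumes S: "gensby n gens S" and T: "T \<in> set F" "length T = n"
    and x: "proj T (solve n F gens) \<in> proj T ` S"
  shows "\<exists>p. 2 ^ p \<le> length F \<and> length el ^ (cnt T - p) \<le> card S"
proof -
  let ?x = "solve n F gens" and ?R = "closure (cnt T) (map (proj T) gens)"
  have g: "gensby (cnt T) (map (proj T) gens) (proj T ` S)"
    by (rule gensby_image[OF S]) (use T proj_vecs proj_ones proj_vmul in auto)
  note gv = gensby_vecs[OF g]
  note span = span_closure[OF g]
  have Sv: "lsub n S" using S by (simp add: gensby_def)
  have "proj T ?x \<in> vecs (cnt T)" using proj_vecs[OF T(2) solve_vecs] .
  then have "2 ^ nproper (cnt T) ?R \<le> length (run ?x [(T, ?R, ones (cnt T))])"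
    using run_survivors[OF T(2) solve_vecs closure_sgs(1)[OF gv] ones_in_vecs, of "proj T ?x"] x span
    by simp
  also have "\<dots> \<le> length (run ?x (map (entry gens) F))"
    by (rule run_member) (use T in \<open>auto simp: entry_def\<close>)
  also have "\<dots> \<le> length F"
    using greedy_steps[of n "map (entry gens) F"] by (simp add: solve_def)
  finally have 1: "2 ^ nproper (cnt T) ?R \<le> length F" .
  have "length el ^ (cnt T - nproper (cnt T) ?R) \<le> card (proj T ` S)"
    using card_span_proper[OF closure_vecs[OF gv]] span by simp
  also have "\<dots> \<le> card S" by (rule card_image_le[OF lsub_finite[OF Sv]])
  finally show ?thesis using 1 by (intro exI conjI)
qed

definition ndiff :: "'a list \<Rightarrow> 'a list \<Rightarrow> nat" where
  "ndiff x h = length (filter (\<lambda>p. \<not> eql (fst p) (snd p)) (zip x h))"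

lemma ndiff_conv:
  "x \<in> vecs n \<Longrightarrow> h \<in> vecs n \<Longrightarrow> ndiff x h = card {i. i < n \<and> x ! i \<noteq> h ! i}"
proof -
  assume v: "x \<in> vecs n" "h \<in> vecs n"
  have "filter (\<lambda>p. \<not> eql (fst p) (snd p)) (zip x h) = filter (\<lambda>p. fst p \<noteq> snd p) (zip x h)"
  proof (rule filter_cong[OF refl])
    fix p assume p: "p \<in> set (zip x h)"
    obtain a b where ab: "p = (a, b)" by (cases p)
    have "fst p \<in> set x" "snd p \<in> set h"
      using set_zip_leftD[of a b] set_zip_rightD[of a b] p unfolding ab by auto
    then have "fst p \<in> carrier G" "snd p \<in> carrier G" using v by (auto simp: vecs_def)
    then show "(\<not> eql (fst p) (snd p)) = (fst p \<noteq> snd p)" by (simp add: eql_iff)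
  qed
  then have "ndiff x h = card {i. i < length (zip x h) \<and> fst (zip x h ! i) \<noteq> snd (zip x h ! i)}"
    by (simp add: ndiff_def length_filter_conv_card)
  also have "{i. i < length (zip x h) \<and> fst (zip x h ! i) \<noteq> snd (zip x h ! i)} =
      {i. i < n \<and> x ! i \<noteq> h ! i}" using length_vecs[OF v(1)] length_vecs[OF v(2)] by auto
  finally show ?thesis .
qed

lemma proj_eqI: "length x = length h \<Longrightarrow> (\<And>i. i < length x \<Longrightarrow> i < length T \<Longrightarrow> T ! i \<Longrightarrow> x ! i = h ! i) \<Longrightarrow> proj T x = proj T h"
proof (induction x h arbitrary: T rule: list_induct2)
  case (Cons a x b h)
  show ?case
  proof (cases T)
    case (Cons c T')
    have "proj T' x = proj T' h"
      by (rule Cons.IH) (use Cons.prems[of "Suc _"] Cons in auto)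
    moreover have "c \<Longrightarrow> a = b" using Cons.prems[of 0] Cons by simp
    ultimately show ?thesis using Cons by simp
  qed simp
qed simp

end

section \<open>Unions of residue classes as selections\<close>

definition blen :: "nat \<Rightarrow> nat" where
  "blen n = (LEAST k. n < 2 ^ k)"

lemma less_blen_iff: "k < blen n \<longleftrightarrow> 2 ^ k \<le> n"
proof
  assume "k < blen n"
  then show "2 ^ k \<le> n" unfolding blen_def using not_less_Least by force
next
  assume "2 ^ k \<le> n"
  moreover have "n < 2 ^ blen n" unfolding blen_def by (rule LeastI[of _ n]) simp
  ultimately have "(2::nat) ^ k < 2 ^ blen n" by (rule le_less_trans)
  then show "k < blen n" by simp
qed

lemma less_two_power_blen: "n < 2 ^ blen n"
  using less_blen_iff[of "blen n" n] by simp

lemma two_power_blen_le: "2 ^ blen n \<le> 2 * n + 1"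
proof (cases "blen n")
  case (Suc k)
  then show ?thesis using less_blen_iff[of k n] by simp
qed simp

definition dbl :: "bool list list \<Rightarrow> bool list list" where
  "dbl F = concat (map (\<lambda>l. [True # l, False # l]) F)"

text \<open>Doubling as long as the list has at most \<open>n\<close> members stops at words of
  length \<open>blen n\<close>, so no logarithm has to be computed.\<close>

definition widen :: "nat \<Rightarrow> bool list list \<Rightarrow> bool list list" where
  "widen n F = (if length F \<le> n then dbl F else F)"

definition short_bits :: "nat \<Rightarrow> bool list list" where
  "short_bits n = (widen n ^^ n) [[]]"

definition prodl :: "'a list list \<Rightarrow> 'a list list \<Rightarrow> 'a list list" where
  "prodl F F' = concat (map (\<lambda>u. map (\<lambda>v. u @ v) F') F)"

text \<open>Words of length \<open>c * blen n\<close> arise from a constant number of products, each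
  in polynomial time, so \<open>ptime_funpow_const\<close> applies.\<close>

definition bitvecs :: "nat \<Rightarrow> nat \<Rightarrow> bool list list" where
  "bitvecs c n = (prodl (short_bits n) ^^ c) [[]]"

text \<open>Periodic continuation of \<open>M\<close>; the selected coordinates form a union of
  residue classes modulo \<open>length M\<close>.\<close>

definition mask :: "nat \<Rightarrow> bool list \<Rightarrow> bool list" where
  "mask n M = take n (concat (replicate n M))"

lemma length_dbl: "length (dbl F) = 2 * length F"
  by (induction F) (auto simp: dbl_def)

lemma set_dbl:
  assumes "set F = {l. length l = k}" shows "set (dbl F) = {l. length l = Suc k}"
proof -
  have "l \<in> set (dbl F)" if "length l = Suc k" for l
  proof (cases l)
    case (Cons b t)
    then have "t \<in> set F" using that assms by simp
    then show ?thesis using Cons by (cases b) (auto simp: dbl_def)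
  qed (use that in simp)
  then show ?thesis using assms by (auto simp: dbl_def)
qed

lemma short_bits_steps:
  "set ((widen n ^^ k) [[]]) = {l. length l = min k (blen n)} \<and>
   length ((widen n ^^ k) [[]]) = 2 ^ min k (blen n)"
proof (induction k)
  case (Suc k)
  let ?F = "(widen n ^^ k) [[]]"
  show ?case
  proof (cases "k < blen n")
    case True
    then have "2 ^ k \<le> n" by (simp add: less_blen_iff)
    then show ?thesis using Suc True set_dbl[of ?F k] by (simp add: widen_def[of n ?F] length_dbl min_def)
  next
    case False
    then have "\<not> 2 ^ blen n \<le> n" using less_two_power_blen[of n] by simp
    then show ?thesis using Suc False by (simp add: widen_def[of n ?F] min_def)
  qed
qed (auto simp: min_def)

lemma short_bits:
  "set (short_bits n) = {l. length l = blen n}" "length (short_bits n) = 2 ^ blen n"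
proof -
  have "\<not> n < blen n" unfolding less_blen_iff not_le by (rule less_exp)
  then have "min n (blen n) = blen n" by simp
  then show "set (short_bits n) = {l. length l = blen n}" "length (short_bits n) = 2 ^ blen n"
    using short_bits_steps[of n n] by (simp_all only: short_bits_def)
qed

lemma bitvecs: "set (bitvecs c n) = {l. length l = c * blen n} \<and> length (bitvecs c n) = 2 ^ (c * blen n)"
proof (induction c)
  case (Suc c)
  let ?F = "bitvecs c n"
  have b: "bitvecs (Suc c) n = prodl (short_bits n) ?F" by (simp add: bitvecs_def)
  have "length (bitvecs (Suc c) n) = 2 ^ (Suc c * blen n)"
    unfolding b prodl_def using Suc short_bits[of n]
    by (simp add: length_concat o_def sum_list_triv power_add)
  moreover have "l \<in> set (bitvecs (Suc c) n)" if "length l = Suc c * blen n" for l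
  proof -
    have "take (blen n) l \<in> set (short_bits n)" "drop (blen n) l \<in> set ?F"
      using that Suc short_bits[of n] by auto
    moreover have "l = take (blen n) l @ drop (blen n) l" by simp
    ultimately show ?thesis unfolding b prodl_def by (metis (no_types, lifting) UN_iff imageI list.set_map set_concat)
  qed
  moreover have "length l = Suc c * blen n" if "l \<in> set (bitvecs (Suc c) n)" for l
    using that Suc short_bits[of n] unfolding b prodl_def by auto
  ultimately show ?case by blast
qed (simp add: bitvecs_def)

lemma nth_concat_uniform:
  "(\<And>xs. xs \<in> set xss \<Longrightarrow> length xs = b) \<Longrightarrow> j < length xss \<Longrightarrow> i < b \<Longrightarrow>
    concat xss ! (j * b + i) = xss ! j ! i"
proof (induction xss arbitrary: j)
  case (Cons xs xss)
  then show ?case by (cases j) (auto simp: nth_append)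
qed simp

lemma length_concat_uniform:
  "(\<And>xs. xs \<in> set xss \<Longrightarrow> length xs = b) \<Longrightarrow> length (concat xss) = length xss * b"
  by (induction xss) auto

lemma mask_nth:
  assumes "length M = m" "m > 0" "i < n" shows "mask n M ! i = M ! (i mod m)"
proof -
  have "i div m < n" using assms by (metis div_le_dividend le_less_trans)
  then have "concat (replicate n M) ! (i div m * m + i mod m) = replicate n M ! (i div m) ! (i mod m)"
    using assms by (intro nth_concat_uniform) auto
  then show ?thesis using assms \<open>i div m < n\<close> by (simp add: mask_def)
qed

lemma length_mask:
  assumes "length M > 0" shows "length (mask n M) = n"
proof -
  have "length (concat (replicate n M)) = n * length M"
    using length_concat_uniform[of "replicate n M" "length M"] by simp
  moreover have "n * 1 \<le> n * length M" using assms by (intro mult_le_mono2) linarith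
  ultimately show ?thesis by (simp add: mask_def)
qed

lemma card_mod_class_le:
  assumes "finite E" "m > 0"
  shows "card {i. i < n \<and> i mod m \<in> E} \<le> card E * (n div m + 1)"
proof -
  have "{i. i < n \<and> i mod m \<in> E} \<subseteq> (\<lambda>(e, j). j * m + e) ` (E \<times> {..n div m})"
  proof
    fix i assume i: "i \<in> {i. i < n \<and> i mod m \<in> E}"
    then have "i = (\<lambda>(e, j). j * m + e) (i mod m, i div m)" by simp
    moreover have "(i mod m, i div m) \<in> E \<times> {..n div m}" using i by (auto intro: div_le_mono)
    ultimately show "i \<in> (\<lambda>(e, j). j * m + e) ` (E \<times> {..n div m})" by blast
  qed
  then have "card {i. i < n \<and> i mod m \<in> E} \<le> card ((\<lambda>(e, j). j * m + e) ` (E \<times> {..n div m}))"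
    using assms by (intro card_mono) auto
  also have "\<dots> \<le> card (E \<times> {..n div m})" using assms by (intro card_image_le) auto
  finally show ?thesis by (simp add: card_cartesian_product)
qed

section \<open>One block, and the concatenation of blocks\<close>

context listed_group begin

definition block :: "nat \<Rightarrow> nat \<Rightarrow> 'a list list \<Rightarrow> 'a list" where
  "block c n gens = solve n (map (mask n) (bitvecs c n)) gens"

lemma block_vecs: "block c n gens \<in> vecs n"
  unfolding block_def by (rule solve_vecs)

text \<open>At most \<open>r\<close> errors meet at most \<open>r\<close> residue classes, which
  spoil at most \<open>r * (n div m + 1)\<close> coordinates. On the union of the other classes the
  output agrees with \<open>h\<close>, and this union is among the selections that were escaped. The
  \<open>- m\<close> in the exponent pays for there being \<open>2 ^ m\<close> selections.\<close>

lemma block_far: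
  assumes S: "gensby n gens S" and m: "m = c * blen n" "m > 0"
    and card: "card S < length el ^ (n - r * (n div m + 1) - m)" and h: "h \<in> S"
  shows "r < ndiff (block c n gens) h"
proof (rule ccontr)
  assume near: "\<not> r < ndiff (block c n gens) h"
  let ?x = "block c n gens" and ?F = "map (mask n) (bitvecs c n)"
  have hv: "h \<in> vecs n" using S h by (auto simp: gensby_def lsub_def)
  define E where "E = (\<lambda>i. i mod m) ` {i. i < n \<and> ?x ! i \<noteq> h ! i}"
  have "card E \<le> card {i. i < n \<and> ?x ! i \<noteq> h ! i}" unfolding E_def by (rule card_image_le) simp
  then have cE: "card E \<le> r" using near ndiff_conv[OF block_vecs hv] by simp
  define M where "M = map (\<lambda>e. e \<notin> E) [0..<m]"
  have lM: "length M = m" by (simp add: M_def)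
  define T where "T = mask n M"
  have lT: "length T = n" using length_mask[of M n] lM m(2) by (simp add: T_def)
  have nthT: "T ! i \<longleftrightarrow> i mod m \<notin> E" if "i < n" for i
    using mask_nth[OF lM m(2) that] m(2) by (simp add: T_def M_def)
  have "M \<in> set (bitvecs c n)" using bitvecs[of c n] lM m(1) by blast
  then have TF: "T \<in> set ?F" by (simp add: T_def)
  have "proj T ?x = proj T h"
    by (rule proj_eqI) (use length_vecs[OF block_vecs] length_vecs[OF hv] nthT in \<open>auto simp: E_def\<close>)
  then have "proj T ?x \<in> proj T ` S" using h by auto
  then obtain p where p: "2 ^ p \<le> length ?F" "length el ^ (cnt T - p) \<le> card S"
    using solve_escapes[OF S TF lT] unfolding block_def by blast
  have "(2::nat) ^ p \<le> 2 ^ m" using p(1) bitvecs[of c n] m(1) by simp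
  then have "p \<le> m" by simp
  have "n \<le> cnt T + r * (n div m + 1)"
  proof -
    have "cnt T = card {i. i < n \<and> i mod m \<notin> E}"
      unfolding cnt_def length_filter_conv_card lT using nthT by (intro arg_cong[where f = card]) auto
    moreover have "card {i. i < n \<and> i mod m \<in> E} \<le> r * (n div m + 1)"
    proof -
      have "finite E" by (simp add: E_def)
      from card_mod_class_le[OF this m(2)] mult_le_mono1[OF cE] show ?thesis by (rule le_trans)
    qed
    moreover have "card {i. i < n \<and> i mod m \<notin> E} + card {i. i < n \<and> i mod m \<in> E} = n"
    proof -
      have "card ({i. i < n \<and> i mod m \<notin> E} \<union> {i. i < n \<and> i mod m \<in> E}) =
          card {i. i < n \<and> i mod m \<notin> E} + card {i. i < n \<and> i mod m \<in> E}"
        by (rule card_Un_disjoint) auto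
      moreover have "{i. i < n \<and> i mod m \<notin> E} \<union> {i. i < n \<and> i mod m \<in> E} = {..<n}" by auto
      ultimately show ?thesis by simp
    qed
    ultimately show ?thesis by linarith
  qed
  then have "n - r * (n div m + 1) - m \<le> cnt T - p" using \<open>p \<le> m\<close> by linarith
  then have "length el ^ (n - r * (n div m + 1) - m) \<le> length el ^ (cnt T - p)"
    using length_el_pos by (intro power_increasing) (simp_all add: Suc_le_eq del: length_greater_0_conv)
  then show False using p(2) card by linarith
qed

definition slice :: "nat \<Rightarrow> nat \<Rightarrow> 'a list \<Rightarrow> 'a list" where
  "slice b j v = take b (drop (j * b) v)"

text \<open>Using \<open>n\<close> block indices avoids computing \<open>n div b\<close>;
  \<open>take\<close> cuts off the surplus, and an incomplete last block merely fills up the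
  length.\<close>

definition remote :: "nat \<Rightarrow> nat \<Rightarrow> nat \<Rightarrow> 'a list list \<Rightarrow> 'a list" where
  "remote c n b gens = take n (concat (map (\<lambda>j. block c b (map (slice b j) gens)) [0..<n]))"

lemma length_slice: "length v = n \<Longrightarrow> Suc j * b \<le> n \<Longrightarrow> length (slice b j v) = b"
  by (simp add: slice_def)

lemma gensby_slice:
  assumes "gensby n gens S" "Suc j * b \<le> n"
  shows "gensby b (map (slice b j) gens) (slice b j ` S)"
proof (rule gensby_image[OF assms(1)])
  show "slice b j v \<in> vecs b" if "v \<in> vecs n" for v
    using that length_slice[of v n j b] assms(2)
    by (auto simp: vecs_def slice_def dest!: in_set_takeD in_set_dropD)
  show "slice b j (ones n) = ones b" using assms(2) by (simp add: slice_def ones_def)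
  show "slice b j (vmul u v) = vmul (slice b j u) (slice b j v)" for u v
    by (simp add: slice_def vmul_def take_map drop_map take_zip drop_zip)
qed

lemma remote_vecs:
  assumes "b > 0" shows "remote c n b gens \<in> vecs n"
proof -
  let ?B = "\<lambda>j. block c b (map (slice b j) gens)"
  have "length (concat (map ?B [0..<n])) = n * b"
    using length_concat_uniform[of "map ?B [0..<n]" b] length_vecs[OF block_vecs] by auto
  then have "length (remote c n b gens) = n"
    using assms by (simp add: remote_def)
  moreover have "set (remote c n b gens) \<subseteq> carrier G"
    using block_vecs[of c b] by (fastforce simp: remote_def vecs_def dest!: in_set_takeD)
  ultimately show ?thesis by (simp add: vecs_def)
qed

lemma slice_remote:
  assumes "b > 0" "Suc j * b \<le> n"
  shows "slice b j (remote c n b gens) = block c b (map (slice b j) gens)"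
proof (rule nth_equalityI)
  let ?B = "\<lambda>j. block c b (map (slice b j) gens)"
  show len: "length (slice b j (remote c n b gens)) = length (?B j)"
    using length_slice[OF length_vecs[OF remote_vecs[OF assms(1)]] assms(2)] length_vecs[OF block_vecs] by simp
  fix i assume "i < length (slice b j (remote c n b gens))"
  then have i: "i < b" using len length_vecs[OF block_vecs] by simp
  have "j * b + i < n" using assms(2) i by simp
  moreover have "j < n" using assms by (metis Suc_le_eq le_trans mult.right_neutral mult_le_mono2 One_nat_def Suc_leI)
  moreover have "concat (map ?B [0..<n]) ! (j * b + i) = map ?B [0..<n] ! j ! i"
    using i \<open>j < n\<close> length_vecs[OF block_vecs] by (intro nth_concat_uniform) auto
  moreover have "slice b j (remote c n b gens) ! i = remote c n b gens ! (j * b + i)"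
    using i \<open>j * b + i < n\<close> length_vecs[OF remote_vecs[OF assms(1), of c n gens]] by (simp add: slice_def)
  ultimately show "slice b j (remote c n b gens) ! i = ?B j ! i"
    by (simp add: remote_def)
qed

text \<open>Errors in disjoint blocks add up, and restriction to a block does not increase the order
  of \<open>S\<close>.\<close>

lemma remote_far:
  assumes S: "gensby n gens S" and m: "m = c * blen b" "m > 0" and b: "b > 0" "J * b \<le> n"
    and card: "card S < length el ^ (b - r * (b div m + 1) - m)" and h: "h \<in> S"
  shows "J * (r + 1) \<le> ndiff (remote c n b gens) h"
proof -
  let ?x = "remote c n b gens"
  have xv: "?x \<in> vecs n" using remote_vecs[OF b(1)] .
  have hv: "h \<in> vecs n" using S h by (auto simp: gensby_def lsub_def)
  have Sfin: "finite S" using S lsub_finite by (auto simp: gensby_def)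
  have blk: "r + 1 \<le> card {i. i < b \<and> ?x ! (j * b + i) \<noteq> h ! (j * b + i)}" if j: "Suc j * b \<le> n" for j
  proof -
    note g = gensby_slice[OF S j]
    have "card (slice b j ` S) \<le> card S" by (rule card_image_le[OF Sfin])
    then have "r < ndiff (slice b j ?x) (slice b j h)"
      unfolding slice_remote[OF b(1) j] using block_far[OF g m] card h by simp
    also have "ndiff (slice b j ?x) (slice b j h) =
        card {i. i < b \<and> slice b j ?x ! i \<noteq> slice b j h ! i}"
      using g h block_vecs[of c b] slice_remote[OF b(1) j, of c gens]
      by (intro ndiff_conv) (auto simp: gensby_def lsub_def)
    also have "{i. i < b \<and> slice b j ?x ! i \<noteq> slice b j h ! i} =
        {i. i < b \<and> ?x ! (j * b + i) \<noteq> h ! (j * b + i)}"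
      using j length_vecs[OF xv] length_vecs[OF hv] by (auto simp: slice_def)
    finally show ?thesis by simp
  qed
  have "J * (r + 1) \<le> card {i. i < J * b \<and> ?x ! i \<noteq> h ! i}" using b(2)
  proof (induction J)
    case (Suc J)
    let ?A = "{i. i < J * b \<and> ?x ! i \<noteq> h ! i}"
      and ?B = "{i. i < b \<and> ?x ! (J * b + i) \<noteq> h ! (J * b + i)}"
    have "card (?A \<union> (\<lambda>i. J * b + i) ` ?B) \<le> card {i. i < Suc J * b \<and> ?x ! i \<noteq> h ! i}"
      by (rule card_mono) auto
    moreover have "card (?A \<union> (\<lambda>i. J * b + i) ` ?B) = card ?A + card ((\<lambda>i. J * b + i) ` ?B)"
      by (rule card_Un_disjoint) auto
    moreover have "card ((\<lambda>i. J * b + i) ` ?B) = card ?B" by (rule card_image) (simp add: inj_on_def)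
    moreover have "J * (r + 1) \<le> card ?A" using Suc by simp
    ultimately show ?case using blk[OF Suc.prems] by simp
  qed simp
  also have "\<dots> \<le> card {i. i < n \<and> ?x ! i \<noteq> h ! i}"
    by (rule card_mono) (use b(2) in auto)
  also have "\<dots> = ndiff ?x h" using ndiff_conv[OF xv hv] by simp
  finally show ?thesis .
qed

text \<open>Let \<open>L = blen b\<close>. With \<open>m = 8 * c * L\<close> and
  \<open>c * L\<close> errors, the exponent in \<open>block_far\<close> loses at most
  \<open>b / 8 + 9 * c * L\<close>, which is below \<open>b / 2\<close> as
  \<open>24 * c * L < b\<close>; the bound on \<open>card S * card S\<close> says that half of
  \<open>b\<close> is enough. Since \<open>b \<le> n\<close>, there are at least
  \<open>n / (2 * b)\<close> full blocks, whence the factor 2 in the denominator.\<close>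

lemma remote_far_log:
  assumes S: "gensby n gens S" and b: "b \<le> n" "24 * c * blen b < b" and c: "c > 0"
    and card: "card S * card S \<le> length el ^ b" and q: "length el \<ge> 2" and h: "h \<in> S"
  shows "real c * real n * log 2 (real b) / (2 * real b) < real (ndiff (remote (8 * c) n b gens) h)"
proof -
  let ?L = "blen b"
  define m where "m = 8 * c * ?L"
  have b0: "b > 0" using b(2) by simp
  have L: "?L > 0" using less_blen_iff[of 0 b] b0 by simp
  have m0: "m > 0" using c L by (simp add: m_def)
  let ?r = "c * ?L"
  let ?e = "b - ?r * (b div m + 1) - m"
  have "8 * (?r * (b div m)) = m * (b div m)" by (simp add: m_def)
  also have "\<dots> \<le> b" by simp
  finally have 1: "8 * (?r * (b div m)) \<le> b" .
  have "?r * (b div m + 1) = ?r * (b div m) + ?r" by simp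
  then have "b < 2 * ?e" using 1 b(2) unfolding m_def by linarith
  have card': "card S < length el ^ ?e"
  proof (rule ccontr)
    assume "\<not> ?thesis"
    then have "length el ^ ?e * length el ^ ?e \<le> card S * card S" by (intro mult_le_mono) auto
    then have "length el ^ (2 * ?e) \<le> length el ^ b"
      using card by (simp add: power_add mult_2)
    moreover have "length el ^ b < length el ^ (2 * ?e)"
      using \<open>b < 2 * ?e\<close> q by (intro power_strict_increasing) auto
    ultimately show False by simp
  qed
  let ?J = "n div b"
  have far: "?J * (?r + 1) \<le> ndiff (remote (8 * c) n b gens) h"
    by (rule remote_far[OF S m_def m0 b0 _ card' h]) simp
  have "n < (?J + 1) * b" using b0 by (metis Suc_eq_plus1 dividend_less_times_div mult.commute mult_Suc_right add.commute)
  moreover have "1 \<le> ?J" using b(1) b0 by (simp add: Suc_le_eq div_greater_zero_iff)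
  then have "(?J + 1) * b \<le> (2 * ?J) * b" by (intro mult_le_mono1) simp
  ultimately have "n \<le> 2 * ?J * b" by linarith
  then have "real n \<le> 2 * real ?J * real b" by (metis of_nat_le_iff of_nat_mult of_nat_numeral)
  then have J: "real n / (2 * real b) \<le> real ?J" using b0 by (simp add: field_simps)
  have "real b \<le> real (2 ^ ?L)"
    using less_two_power_blen[of b] by (simp only: of_nat_le_iff)
  then have "log 2 (real b) \<le> log 2 (2 ^ ?L)"
    using b0 by (subst log_le_cancel_iff) auto
  then have lg: "log 2 (real b) \<le> real ?L" by simp
  have "real c * real n * log 2 (real b) / (2 * real b) = real n / (2 * real b) * (real c * log 2 (real b))"
    by simp
  also have "\<dots> \<le> real n / (2 * real b) * (real c * real ?L)"
    using lg by (intro mult_left_mono) auto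
  \<comment> \<open>Strictness comes from the extra error \<open>+ 1\<close> in every block.\<close>
  also have "\<dots> < real n / (2 * real b) * (real c * real ?L + 1)"
    using b b0 by (intro mult_strict_left_mono) auto
  also have "\<dots> \<le> real ?J * (real c * real ?L + 1)"
    using J by (intro mult_right_mono) auto
  also have "\<dots> = real (?J * (?r + 1))" by (simp add: distrib_left)
  also have "\<dots> \<le> real (ndiff (remote (8 * c) n b gens) h)" using far by (rule of_nat_mono)
  finally show ?thesis .
qed

end

section \<open>Growth of the binary length\<close>

lemma square_le_two_power: "4 \<le> k \<Longrightarrow> k * k \<le> (2::nat) ^ k"
proof (induction k rule: nat_induct_at_least)
  case (Suc k)
  have "Suc k * Suc k \<le> 2 * (k * k)" using Suc.hyps by (cases "k = 4") (auto simp: algebra_simps intro: order_trans[OF _ mult_le_mono1[of 4 k k]])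
  then show ?case using Suc.IH by simp
qed simp

lemma blen_small: "\<exists>B. \<forall>b\<ge>B. c * blen b < b"
proof (intro exI allI impI)
  \<comment> \<open>Up to \<open>blen b = 2 * c + 5\<close> the threshold suffices directly. Beyond
    it, with \<open>L = blen b\<close>,
    \<open>(2 * c + 5) * L \<le> L * L \<le> 2 ^ L \<le> 2 * b + 1\<close>, and the
    \<open>5 * L\<close> absorbs the \<open>+ 1\<close>.\<close>
  fix b assume b: "c * (2 * c + 5) + 1 \<le> b"
  show "c * blen b < b"
  proof (cases "blen b \<le> 2 * c + 5")
    case True
    then have "c * blen b \<le> c * (2 * c + 5)" by (rule mult_le_mono2)
    then show ?thesis using b by linarith
  next
    case False
    let ?L = "blen b"
    have "(2 * c + 5) * ?L \<le> ?L * ?L" using False by (intro mult_le_mono1) simp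
    also have "\<dots> \<le> 2 ^ ?L" using False by (intro square_le_two_power) simp
    also have "\<dots> \<le> 2 * b + 1" by (rule two_power_blen_le)
    finally have "2 * (c * ?L) + 5 * ?L \<le> 2 * b + 1" by (simp add: algebra_simps)
    moreover have "?L \<ge> 1" using False by simp
    ultimately show ?thesis by linarith
  qed
qed

section \<open>Exact search for boundedly many codewords\<close>

lemma foldl_select_max:
  fixes f :: "'a \<Rightarrow> nat"
  shows "z \<in> insert c (set ys) \<Longrightarrow> f z \<le> f (foldl (\<lambda>u y. if f u < f y then y else u) c ys)"
proof (induction ys arbitrary: c z)
  case (Cons y ys)
  let ?c = "if f c < f y then y else c"
  have IH: "f w \<le> f (foldl (\<lambda>u y. if f u < f y then y else u) ?c ys)" if "w \<in> insert ?c (set ys)" for w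
    using Cons.IH[OF that] .
  show ?case
  proof (cases "z \<in> set ys")
    case True
    then show ?thesis using IH by simp
  next
    case False
    then have "f z \<le> f ?c" using Cons.prems by auto
    then show ?thesis using IH[of ?c] by simp
  qed
qed simp

section \<open>Enumeration of a short span\<close>

context listed_group begin

definition prods :: "'a list list \<Rightarrow> 'a list list \<Rightarrow> 'a list list" where
  "prods R E = E @ concat (map (\<lambda>e. map (vmul e) R) E)"

text \<open>Words of at most \<open>k\<close> generators, listed with repetitions; for constant
  \<open>k\<close> and boundedly many generators the list has bounded length.\<close>

definition elements :: "nat \<Rightarrow> nat \<Rightarrow> 'a list list \<Rightarrow> 'a list list" where
  "elements k n R = (prods R ^^ k) [ones n]"

lemma set_prods: "set (prods R E) = set E \<union> {vmul e r |e r. e \<in> set E \<and> r \<in> set R}"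
  by (auto simp: prods_def)

lemma elements_Suc: "elements (Suc k) n R = prods R (elements k n R)"
  by (simp add: elements_def)

lemma elements_mono: "k \<le> l \<Longrightarrow> set (elements k n R) \<subseteq> set (elements l n R)"
proof (induction l rule: dec_induct)
  case (step l)
  then show ?case by (auto simp: elements_Suc set_prods)
qed simp

lemma elements_lsub: "lsub n S \<Longrightarrow> set R \<subseteq> S \<Longrightarrow> set (elements k n R) \<subseteq> S"
proof (induction k)
  case 0
  then show ?case by (simp add: elements_def lsubD)
next
  case (Suc k)
  then show ?case using lsubD(3)[OF Suc.prems(1)] by (auto simp: elements_Suc set_prods)
qed

text \<open>Normal forms grow on the left, \<open>elements\<close> on the right; associativity
  reconciles the two.\<close>

lemma elements_left_mult:
  assumes R: "set R \<subseteq> vecs n" and u: "u \<in> set R"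
  shows "v \<in> set (elements k n R) \<Longrightarrow> vmul u v \<in> set (elements (Suc k) n R)"
proof (induction k arbitrary: v)
  case 0
  then have "v = ones n" by (simp add: elements_def)
  moreover have "u \<in> vecs n" using R u by auto
  ultimately have "vmul u v = vmul (ones n) u" by simp
  moreover have "ones n \<in> set (elements 0 n R)" by (simp add: elements_def)
  ultimately show ?case using u by (auto simp: elements_Suc set_prods)
next
  case (Suc k)
  have "lsub n (vecs n)" by (rule lsubI) auto
  note ev = elements_lsub[OF this R, of k]
  from Suc.prems consider "v \<in> set (elements k n R)" |
    e r where "v = vmul e r" "e \<in> set (elements k n R)" "r \<in> set R"
    by (auto simp: elements_Suc set_prods)
  then show ?case
  proof cases
    case 1
    then show ?thesis using Suc.IH elements_mono[of "Suc k" "Suc (Suc k)"] by auto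
  next
    case 2
    have v: "u \<in> vecs n" "e \<in> vecs n" "r \<in> vecs n" using 2 R u ev by auto
    have "vmul u v = vmul (vmul u e) r" unfolding 2(1) using vmul_assoc[OF v] by simp
    then show ?thesis using Suc.IH[OF 2(2)] 2(3) by (subst elements_Suc) (auto simp: set_prods)
  qed
qed

lemma Cons_one_elements:
  assumes R: "set R \<subseteq> vecs (Suc n)"
  shows "v \<in> set (elements k n (tails R)) \<Longrightarrow> \<one> # v \<in> set (elements k (Suc n) R)"
proof (induction k arbitrary: v)
  case 0
  then show ?case by (simp add: elements_def)
next
  case (Suc k)
  from Suc.prems consider "v \<in> set (elements k n (tails R))" |
    e r where "v = vmul e r" "e \<in> set (elements k n (tails R))" "r \<in> set (tails R)"
    by (auto simp: elements_Suc set_prods)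
  then show ?case
  proof cases
    case 1
    then show ?thesis using Suc.IH by (auto simp: elements_Suc set_prods)
  next
    case 2
    then have "\<one> # r \<in> set R" using tails_iff[OF R] by simp
    moreover have "\<one> # v = vmul (\<one> # e) (\<one> # r)" using 2(1) by (simp add: op_eq)
    ultimately show ?thesis using Suc.IH[OF 2(2)] by (auto simp: elements_Suc set_prods)
  qed
qed

text \<open>A normal form uses at most one generator per level, and the levels use different
  generators, so words of length \<open>length R\<close> reach everything.\<close>

lemma span_elements: "set R \<subseteq> vecs n \<Longrightarrow> span n R \<subseteq> set (elements (length R) n R)"
proof (induction n arbitrary: R)
  case 0
  have "[] \<in> set (elements 0 0 R)" by (simp add: elements_def)
  then show ?case using elements_mono[of 0 "length R" 0 R] by auto
next
  case (Suc n)
  show ?case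
  proof
    fix x assume "x \<in> span (Suc n) R"
    then obtain u w where x: "u \<in> lvl (Suc n) R" "w \<in> span n (tails R)" "x = vmul u (\<one> # w)" by auto
    have w: "\<one> # w \<in> set (elements (length (tails R)) (Suc n) R)"
      using Cons_one_elements[OF Suc.prems] Suc.IH[OF tails_vecs[OF Suc.prems]] x(2) by blast
    show "x \<in> set (elements (length R) (Suc n) R)"
    proof (cases "u = ones (Suc n)")
      case True
      have "\<one> # w \<in> vecs (Suc n)" using x(2) span_vecs[OF tails_vecs[OF Suc.prems]] by auto
      then have "x = \<one> # w" unfolding x(3) True by (rule vmul_ones(2))
      moreover have "length (tails R) \<le> length R" using length_filter_tails[of R] by simp
      ultimately show ?thesis using w elements_mono by blast
    next
      case False
      then have u: "u \<in> set R" "hd u \<noteq> \<one>" using x(1) by (auto simp: lvl_def)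
      then have "hd u \<in> set (filter (\<lambda>a. a \<noteq> \<one>) (map hd R))" by auto
      then have "0 < length (filter (\<lambda>a. a \<noteq> \<one>) (map hd R))" by (rule length_pos_if_in_set)
      then have "Suc (length (tails R)) \<le> length R" using length_filter_tails[of R] by linarith
      moreover have "x \<in> set (elements (Suc (length (tails R))) (Suc n) R)"
        unfolding x(3) by (rule elements_left_mult[OF Suc.prems u(1) w])
      ultimately show ?thesis using elements_mono by blast
    qed
  qed
qed

lemma elements_closure:
  assumes "gensby n gens S" "length (closure n gens) \<le> k"
  shows "set (elements k n (closure n gens)) = S"
proof
  have S: "lsub n S" "set gens \<subseteq> S" using assms(1) by (auto simp: gensby_def)
  show "set (elements k n (closure n gens)) \<subseteq> S"
    by (rule elements_lsub[OF S(1) closure_lsub[OF S]])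
  show "S \<subseteq> set (elements k n (closure n gens))"
    using span_elements[OF closure_vecs[OF gensby_vecs[OF assms(1)]]] span_closure[OF assms(1)]
      elements_mono[OF assms(2)] by blast
qed

lemma length_elements: "length (elements k n R) = (1 + length R) ^ k"
proof (induction k)
  case (Suc k)
  then show ?case
    by (simp add: elements_Suc prods_def length_concat o_def sum_list_triv)
qed (simp add: elements_def)

section \<open>Dynamic programming over distance profiles\<close>

definition insert_profile :: "'a list list \<Rightarrow> 'a list list \<Rightarrow> 'a list \<Rightarrow> 'a list list" where
  "insert_profile E acc x =
     (if \<exists>y\<in>set acc. \<forall>h\<in>set E. ndiff y h = ndiff x h then acc else x # acc)"

definition extensions :: "'a list list \<Rightarrow> 'a list list" where
  "extensions L = concat (map (\<lambda>x. map (\<lambda>g. x @ [g]) el) L)"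

definition dp_step :: "'a list list \<Rightarrow> 'a list list \<Rightarrow> 'a list list" where
  "dp_step E L = foldl (insert_profile E) [] (extensions L)"

definition dp :: "nat \<Rightarrow> 'a list list \<Rightarrow> 'a list list" where
  "dp n E = (dp_step E ^^ n) [[]]"

text \<open>The start value \<open>n\<close> is the largest distance possible for vectors of length
  \<open>n\<close>, so it is harmless when \<open>E\<close> is nonempty.\<close>

definition min_ndiff :: "nat \<Rightarrow> 'a list list \<Rightarrow> 'a list \<Rightarrow> nat" where
  "min_ndiff n E x = foldl (\<lambda>m d. if d < m then d else m) n (map (ndiff x) E)"

definition farthest :: "nat \<Rightarrow> 'a list list \<Rightarrow> 'a list" where
  "farthest n E = foldl (\<lambda>u y. if min_ndiff n E u < min_ndiff n E y then y else u)
     (hd (dp n E)) (dp n E)"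

lemma dedup:
  fixes E acc L
  defines "D \<equiv> foldl (insert_profile E) acc L"
  shows "set acc \<subseteq> set D" "set D \<subseteq> set acc \<union> set L"
    "\<forall>x\<in>set L. \<exists>y\<in>set D. \<forall>h\<in>set E. ndiff y h = ndiff x h"
    "distinct (map (\<lambda>x. map (ndiff x) E) acc) \<Longrightarrow> distinct (map (\<lambda>x. map (ndiff x) E) D)"
proof -
  have "set acc \<subseteq> set (foldl (insert_profile E) acc L) \<and>
      set (foldl (insert_profile E) acc L) \<subseteq> set acc \<union> set L \<and>
      (\<forall>x\<in>set L. \<exists>y\<in>set (foldl (insert_profile E) acc L). \<forall>h\<in>set E. ndiff y h = ndiff x h) \<and>
      (distinct (map (\<lambda>x. map (ndiff x) E) acc) \<longrightarrow>
       distinct (map (\<lambda>x. map (ndiff x) E) (foldl (insert_profile E) acc L)))"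
  proof (induction L arbitrary: acc)
    case (Cons x L)
    let ?a = "insert_profile E acc x"
    have a: "set acc \<subseteq> set ?a" "set ?a \<subseteq> set acc \<union> {x}"
      "\<exists>y\<in>set ?a. \<forall>h\<in>set E. ndiff y h = ndiff x h"
      by (auto simp: insert_profile_def)
    have d: "distinct (map (\<lambda>x. map (ndiff x) E) acc) \<Longrightarrow> distinct (map (\<lambda>x. map (ndiff x) E) ?a)"
      by (auto simp: insert_profile_def)
    show ?case using Cons.IH[of ?a] a d by (auto 4 4)
  qed auto
  then show "set acc \<subseteq> set D" "set D \<subseteq> set acc \<union> set L"
    "\<forall>x\<in>set L. \<exists>y\<in>set D. \<forall>h\<in>set E. ndiff y h = ndiff x h"
    "distinct (map (\<lambda>x. map (ndiff x) E) acc) \<Longrightarrow> distinct (map (\<lambda>x. map (ndiff x) E) D)"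
    unfolding D_def by blast+
qed

lemma zip_take_left: "zip x (take (length x) h) = zip x h"
proof (induction x arbitrary: h)
  case (Cons a x)
  then show ?case by (cases h) auto
qed simp

lemma ndiff_snoc: "ndiff (x @ [g]) h = ndiff x h + ndiff [g] (drop (length x) h)"
  by (simp add: ndiff_def zip_append1 zip_take_left)

lemma ndiff_le: "ndiff x h \<le> length x"
  unfolding ndiff_def by (rule order_trans[OF length_filter_le]) simp

lemma dp_Suc: "dp (Suc k) E = dp_step E (dp k E)"
  by (simp add: dp_def)

lemma dp_vecs: "set (dp k E) \<subseteq> vecs k"
proof (induction k)
  case (Suc k)
  have "set (extensions (dp k E)) \<subseteq> vecs (Suc k)"
    using Suc set_el by (auto simp: extensions_def vecs_def subset_iff)
  then show ?case unfolding dp_Suc dp_step_def using dedup(2)[of E "[]"] by fastforce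
qed (simp add: dp_def)

text \<open>Exchange argument: prefixes of equal length and equal profile are interchangeable,
  because appending the same entry changes each distance by the same amount. The distance from a
  prefix to a longer \<open>h\<close> only sees the matching part of \<open>h\<close>, as
  \<open>zip\<close> truncates.\<close>

lemma dp_profiles: "x \<in> vecs k \<Longrightarrow> \<exists>y\<in>set (dp k E). \<forall>h\<in>set E. ndiff y h = ndiff x h"
proof (induction k arbitrary: x)
  case (Suc k)
  then obtain x' g where x: "x = x' @ [g]" "x' \<in> vecs k" "g \<in> carrier G"
    by (cases x rule: rev_cases) (auto simp: vecs_def)
  from Suc.IH[OF x(2)] obtain y where y: "y \<in> set (dp k E)" "\<forall>h\<in>set E. ndiff y h = ndiff x' h"
    by blast
  have "length y = length x'" using y(1) dp_vecs x(2) length_vecs by (metis subsetD)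
  then have yg: "\<forall>h\<in>set E. ndiff (y @ [g]) h = ndiff x h" using y(2) by (simp add: ndiff_snoc x(1))
  have "y @ [g] \<in> set (extensions (dp k E))" using y(1) x(3) set_el by (auto simp: extensions_def)
  then obtain z where "z \<in> set (dp (Suc k) E)" "\<forall>h\<in>set E. ndiff z h = ndiff (y @ [g]) h"
    unfolding dp_Suc dp_step_def using dedup(3)[where L = "extensions (dp k E)"] by blast
  then show ?case using yg by auto
qed (simp add: dp_def)

text \<open>The kept vectors have distinct profiles, and a profile is a list of
  \<open>length E\<close> numbers in \<open>{..k}\<close>. For a bounded number of codewords this is
  polynomial.\<close>

lemma length_dp: "length (dp k E) \<le> (k + 1) ^ length E"
proof -
  let ?p = "\<lambda>x. map (ndiff x) E"
  have "distinct (map ?p (dp k E))"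
  proof (cases k)
    case (Suc j)
    then show ?thesis unfolding Suc dp_Suc dp_step_def by (intro dedup(4)) simp
  qed (simp add: dp_def)
  then have "length (dp k E) = card (set (map ?p (dp k E)))"
    using distinct_card by fastforce
  also have "\<dots> \<le> card {l. set l \<subseteq> {..k} \<and> length l = length E}"
  proof (rule card_mono)
    show "finite {l. set l \<subseteq> {..k} \<and> length l = length E}" by (rule finite_lists_length_eq) simp
    show "set (map ?p (dp k E)) \<subseteq> {l. set l \<subseteq> {..k} \<and> length l = length E}"
      using dp_vecs[of k E] ndiff_le length_vecs by fastforce
  qed
  also have "\<dots> = (k + 1) ^ length E" by (subst card_lists_length_eq) auto
  finally show ?thesis .
qed

lemma min_ndiff_le: "d \<in> insert n (set (map (ndiff x) E)) \<Longrightarrow> min_ndiff n E x \<le> d"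
  unfolding min_ndiff_def by (rule foldl_select_min[where f = "\<lambda>d. d"])

lemma min_ndiff_mem: "min_ndiff n E x \<in> insert n (set (map (ndiff x) E))"
  unfolding min_ndiff_def by (rule foldl_select_mem)

lemma farthest_dp: "farthest n E \<in> set (dp n E)"
proof -
  have "dp n E \<noteq> []" using dp_profiles[OF ones_in_vecs, of n E] by auto
  then have "hd (dp n E) \<in> set (dp n E)" by simp
  then show ?thesis
    unfolding farthest_def
    using foldl_select_mem[of "\<lambda>u y. min_ndiff n E u < min_ndiff n E y" "hd (dp n E)" "dp n E"]
    by auto
qed

lemma farthest_vecs: "farthest n E \<in> vecs n"
  using farthest_dp dp_vecs by blast

lemma farthest_far:
  assumes x: "x \<in> vecs n" "\<And>h. h \<in> set E \<Longrightarrow> r < ndiff x h" and E: "E \<noteq> []" and h: "h \<in> set E"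
  shows "r < ndiff (farthest n E) h"
proof -
  obtain y where y: "y \<in> set (dp n E)" "\<forall>h\<in>set E. ndiff y h = ndiff x h"
    using dp_profiles[OF x(1)] by blast
  \<comment> \<open>The start value \<open>n\<close> of the minimum has to exceed \<open>r\<close>
    too; this follows from any single distance.\<close>
  have "r < ndiff x (hd E)" using x(2) E by simp
  also have "\<dots> \<le> n" using ndiff_le[of x] length_vecs[OF x(1)] by simp
  finally have "r < n" .
  then have "r < min_ndiff n E y" using min_ndiff_mem[of n E y] y(2) x(2) by auto
  also have "\<dots> \<le> min_ndiff n E (farthest n E)"
    unfolding farthest_def using y(1) by (intro foldl_select_max[where f = "min_ndiff n E"]) simp
  also have "\<dots> \<le> ndiff (farthest n E) h" using h by (intro min_ndiff_le) simp
  finally show ?thesis .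
qed

end

section \<open>The algorithm and its running time\<close>

context listed_group begin

text \<open>In its branch, \<open>take D\<close> is the identity; it makes the running time polynomial regardless of the branch.\<close>

definition rpp_solution :: "nat \<Rightarrow> nat \<Rightarrow> nat \<Rightarrow> 'a list list \<Rightarrow> 'a list" where
  "rpp_solution c D n gens =
     (if length (closure n gens) \<le> D
      then farthest n (elements D n (take D (closure n gens)))
      else remote (8 * c) n (min n (2 * length (closure n gens))) gens)"

end

text \<open>Running times are established for groups whose elements are trees and thus their own
  codes; an arbitrary \<open>G\<close> is transported to such a group at the end.\<close>

locale tree_group = listed_group G el
  for G :: "(tree, 'm) monoid_scheme" (structure) and el
begin

lemma inj_encode_pair: "inj (encode :: tree \<times> tree \<Rightarrow> tree)"
  by (auto intro!: injI simp: encode_prod_def)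

text \<open>Form for \<open>THEN\<close>: it reuses an assumption about a function of the outer
  argument under a \<open>map\<close> or \<open>filter\<close>, where that argument has become a
  component of a tuple.\<close>

lemmas ptime_lift = ptime_comp[rotated]

lemma ptime_op [ptime_intros]:
  assumes "ptime f" "ptime g" shows "ptime (\<lambda>x. op (f x) (g x))"
proof -
  have "ptime (\<lambda>x. if (f x, g x) \<in> carrier G \<times> carrier G then (\<lambda>p. fst p \<otimes> snd p) (f x, g x) else \<one>)"
    by (rule ptime_finite_support[OF ptime_Pair[OF assms] _ inj_encode_pair]) simp
  then show ?thesis by (simp only: op_def fst_conv snd_conv)
qed

lemma ptime_ldiv [ptime_intros]:
  assumes "ptime f" "ptime g" shows "ptime (\<lambda>x. ldiv (f x) (g x))"
proof -
  have "ptime (\<lambda>x. if (f x, g x) \<in> carrier G \<times> carrier G then (\<lambda>p. inv (fst p) \<otimes> snd p) (f x, g x) else \<one>)"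
    by (rule ptime_finite_support[OF ptime_Pair[OF assms] _ inj_encode_pair]) simp
  then show ?thesis by (simp only: ldiv_def fst_conv snd_conv)
qed

lemma ptime_eql [ptime_intros]:
  assumes "ptime f" "ptime g" shows "ptime (\<lambda>x. eql (f x) (g x))"
proof -
  have "ptime (\<lambda>x. if (f x, g x) \<in> carrier G \<times> carrier G then (\<lambda>p. fst p = snd p) (f x, g x) else False)"
    by (rule ptime_finite_support[OF ptime_Pair[OF assms] _ inj_encode_pair]) simp
  then show ?thesis by (simp only: eql_def fst_conv snd_conv)
qed

lemma ptime_vmul [ptime_intros]: "ptime f \<Longrightarrow> ptime g \<Longrightarrow> ptime (\<lambda>x. vmul (f x) (g x))"
  unfolding vmul_def by (intro ptime_intros)

lemma ptime_vldiv [ptime_intros]: "ptime f \<Longrightarrow> ptime g \<Longrightarrow> ptime (\<lambda>x. vldiv (f x) (g x))"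
  unfolding vldiv_def by (intro ptime_intros)

lemma ptime_ones [ptime_intros]: "ptime n \<Longrightarrow> ptime (\<lambda>x. ones (n x))"
  unfolding ones_def by (intro ptime_intros)

lemma ptime_tails [ptime_intros]: "ptime R \<Longrightarrow> ptime (\<lambda>x. tails (R x))"
  unfolding tails_def by (intro ptime_intros ptime_eq_tree_const)

lemma size_tails: "size (encode (tails R)) \<le> size (encode R)"
proof (induction R)
  case (Cons r R)
  have "size (encode (tl r)) \<le> size (encode r)" by (cases r) auto
  then show ?case using Cons by (auto simp: tails_Cons)
qed (simp add: tails_def)

definition esz :: nat where
  "esz = size (encode el)"

lemma size_carrier: "a \<in> carrier G \<Longrightarrow> size (encode a) \<le> esz"
  using size_encode_member[of a el] set_el by (simp add: esz_def)

lemma set_vmul: "set (vmul u v) \<subseteq> carrier G" and set_vldiv: "set (vldiv u v) \<subseteq> carrier G"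
  by (auto simp: vmul_def vldiv_def)

lemma set_tl: "set (tl v) \<subseteq> set v"
  by (cases v) auto

text \<open>\<open>ptime\<close> quantifies over all inputs, including vectors with entries outside
  the group. As the group operations always return group elements, every entry that occurs is a
  group element or stems from the input, which is what \<open>N\<close> bounds.\<close>

lemma size_vec_le:
  assumes "set v \<subseteq> carrier G \<union> {a. size (encode a) \<le> N}" "length v \<le> l" "esz \<le> N"
  shows "size (encode (v :: tree list)) \<le> l * (N + 1)"
  by (rule size_encode_list_le) (use assms size_carrier le_trans in blast)+

definition sift_inv :: "tree sift_state \<Rightarrow> nat \<Rightarrow> tree sift_state \<Rightarrow> bool" where
  "sift_inv s0 j s \<longleftrightarrow> set (fst s) \<subseteq> carrier G \<and> length (fst s) \<le> j \<and>
     size (encode (fst (snd s))) \<le> size (encode (fst (snd s0))) \<and>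
     set (fst (snd (snd s))) \<subseteq> carrier G \<union> set (fst (snd (snd s0))) \<and>
     length (fst (snd (snd s))) \<le> length (fst (snd (snd s0)))"

lemma sift_inv_step:
  assumes "sift_inv s0 j s" shows "sift_inv s0 (Suc j) (sift_step s)"
proof -
  obtain acc R v fl where s: "s = (acc, R, v, fl)" by (cases s)
  have "set (tl v) \<subseteq> set v" "\<And>r. set (tl (vldiv r v)) \<subseteq> carrier G"
    "size (encode (tails R)) \<le> size (encode R)"
    using set_tl[of v] set_tl[of "vldiv _ v"] set_vldiv[of _ v] size_tails[of R] by blast+
  then show ?thesis
    using assms unfolding s sift_step_def sift_inv_def by auto
qed

lemma sift_inv: "sift_inv ([], R, v, False) j ((sift_step ^^ j) ([], R, v, False))"
proof (induction j)
  case (Suc j)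
  from sift_inv_step[OF this] show ?case by simp
qed (simp add: sift_inv_def)

lemma ptime_sift_step [ptime_intros]:
  assumes "ptime s" shows "ptime (\<lambda>x. sift_step (s x))"
  unfolding sift_step_def by (intro ptime_intros ptime_eq_tree_const assms[THEN ptime_lift])

lemma ptime_sift [ptime_intros]:
  assumes "ptime n" "ptime R" "ptime v" shows "ptime (\<lambda>x. sift (n x) (R x) (v x))"
proof -
  define b where "b = (\<lambda>x. n x * (esz + 1) + size (encode (R x)) +
    size (encode (v x)) * (esz + size (encode (v x)) + 1) + 4)"
  have "ptime (\<lambda>x. (sift_step ^^ n x) ([], R x, v x, False))"
  proof (rule ptime_funpow[where b = b and f = "\<lambda>_. sift_step"])
    fix x j assume j: "j \<le> n x"
    let ?s = "(sift_step ^^ j) ([], R x, v x, False)"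
    obtain acc R' v' fl where s: "?s = (acc, R', v', fl)" by (cases ?s)
    have inv: "set acc \<subseteq> carrier G" "length acc \<le> j" "size (encode R') \<le> size (encode (R x))"
      "set v' \<subseteq> carrier G \<union> set (v x)" "length v' \<le> length (v x)"
      using sift_inv[of "R x" "v x" j] unfolding s sift_inv_def by auto
    have "size (encode acc) \<le> n x * (esz + 1)"
      using inv(1,2) j by (intro size_vec_le) auto
    moreover have "size (encode v') \<le> size (encode (v x)) * (esz + size (encode (v x)) + 1)"
    proof (rule size_vec_le)
      show "set v' \<subseteq> carrier G \<union> {a. size (encode a) \<le> esz + size (encode (v x))}"
        using inv(4) size_encode_member[of _ "v x"] by (fastforce intro: less_imp_le trans_le_add2)
      show "length v' \<le> size (encode (v x))" using inv(5) length_le_size_encode[of "v x"] by simp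
    qed simp
    moreover have "size (encode fl) \<le> 1" by (cases fl) auto
    ultimately show "size (encode ?s) \<le> b x" using inv(3) unfolding s b_def by simp
  next
    show "pbd b" unfolding b_def
      using pbd_ptime[OF assms(1)] by (intro pbd_intros pbd_ptime assms) simp
  qed (intro ptime_intros assms)+
  then show ?thesis unfolding sift_def Let_def by (intro ptime_intros)
qed

lemma sift_bound:
  "set (sift n R v) \<subseteq> carrier G \<union> set v" "length (sift n R v) \<le> n + length v"
  using sift_inv[of R v n] by (auto simp: sift_def sift_inv_def Let_def)

lemma ptime_cands [ptime_intros]:
  assumes "ptime g" "ptime R" shows "ptime (\<lambda>x. cands (g x) (R x))"
  unfolding cands_def by (intro ptime_intros assms[THEN ptime_lift])

lemma ptime_nontriv [ptime_intros]: "ptime v \<Longrightarrow> ptime (\<lambda>x. nontriv (v x))"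
  unfolding nontriv_def by (intro ptime_intros ptime_eq_tree_const)

lemma ptime_grow [ptime_intros]:
  assumes "ptime n" "ptime g" "ptime R" shows "ptime (\<lambda>x. grow (n x) (g x) (R x))"
  unfolding grow_def by (intro ptime_intros assms[THEN ptime_lift])

text \<open>On malformed input, sifting may change the length of a vector, but it adds at most
  \<open>n\<close> entries; over polynomially many rounds this stays polynomial.\<close>

lemma grow_bound:
  assumes "\<And>r. r \<in> set R \<Longrightarrow> set r \<subseteq> carrier G \<union> A \<and> length r \<le> l"
    and "\<And>r. r \<in> set gens \<Longrightarrow> set r \<subseteq> A \<and> length r \<le> l"
  shows "length (grow n gens R) \<le> Suc (length R)"
    and "r \<in> set (grow n gens R) \<Longrightarrow> set r \<subseteq> carrier G \<union> A \<and> length r \<le> n + l"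
proof -
  have c: "set v \<subseteq> carrier G \<union> A \<and> length v \<le> l" if "v \<in> set (cands gens R)" for v
    using that assms set_vmul by (fastforce simp: cands_def)
  let ?z = "filter nontriv (map (sift n R) (cands gens R))"
  show "length (grow n gens R) \<le> Suc (length R)" by (simp add: grow_def)
  assume r: "r \<in> set (grow n gens R)"
  show "set r \<subseteq> carrier G \<union> A \<and> length r \<le> n + l"
  proof (cases "r \<in> set R")
    case True
    then show ?thesis using assms(1)[OF True] by simp
  next
    case False
    then have "?z \<noteq> []" "r = hd ?z" using r by (auto simp: grow_def split: if_splits)
    then have "r \<in> set ?z" by (metis hd_in_set)
    then obtain v where v: "v \<in> set (cands gens R)" "r = sift n R v" by auto
    show ?thesis using c[OF v(1)] sift_bound[of n R v] unfolding v(2) by auto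
  qed
qed

lemma grow_bounds:
  assumes "\<And>r. r \<in> set gens \<Longrightarrow> set r \<subseteq> A \<and> length r \<le> l"
  shows "length ((grow n gens ^^ j) []) \<le> j \<and>
    (\<forall>r\<in>set ((grow n gens ^^ j) []). set r \<subseteq> carrier G \<union> A \<and> length r \<le> j * n + l)"
proof (induction j)
  case (Suc j)
  let ?R = "(grow n gens ^^ j) []"
  have 1: "set r \<subseteq> carrier G \<union> A \<and> length r \<le> j * n + l" if "r \<in> set ?R" for r
    using that Suc by blast
  have 2: "set r \<subseteq> A \<and> length r \<le> j * n + l" if "r \<in> set gens" for r
    using assms[OF that] by simp
  show ?case
    using grow_bound[where R = ?R and A = A and l = "j * n + l" and gens = gens and n = n, OF 1 2] Suc
    by (auto simp: add.assoc)
qed simp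

lemma ptime_closure [ptime_intros]:
  assumes "ptime n" "ptime g" shows "ptime (\<lambda>x. closure (n x) (g x))"
proof -
  let ?N = "\<lambda>x. esz + size (encode (g x))"
  let ?k = "\<lambda>x. n x * length el"
  define b where "b = (\<lambda>x. ?k x * ((?k x * n x + size (encode (g x))) * (?N x + 1) + 1))"
  have "ptime (\<lambda>x. (grow (n x) (g x) ^^ (n x * length el)) [])"
  proof (rule ptime_funpow[where b = b])
    fix x j assume j: "j \<le> n x * length el"
    have g: "set r \<subseteq> {a. size (encode a) \<le> ?N x} \<and> length r \<le> size (encode (g x))"
      if "r \<in> set (g x)" for r
      using size_encode_member[OF that] size_encode_member[of _ r] length_le_size_encode[of r]
      by fastforce
    have gb: "length ((grow (n x) (g x) ^^ j) []) \<le> j \<and>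
      (\<forall>r\<in>set ((grow (n x) (g x) ^^ j) []). set r \<subseteq> carrier G \<union> {a. size (encode a) \<le> ?N x} \<and>
        length r \<le> j * n x + size (encode (g x)))"
      by (rule grow_bounds) (rule g)
    show "size (encode ((grow (n x) (g x) ^^ j) [])) \<le> b x"
      unfolding b_def
    proof (rule size_encode_list_le)
      fix r assume r: "r \<in> set ((grow (n x) (g x) ^^ j) [])"
      have "j * n x \<le> ?k x * n x" using j by (rule mult_le_mono1)
      moreover have "set r \<subseteq> carrier G \<union> {a. size (encode a) \<le> ?N x}"
        "length r \<le> j * n x + size (encode (g x))" using gb r by blast+
      ultimately show "size (encode r) \<le> (?k x * n x + size (encode (g x))) * (?N x + 1)"
        by (intro size_vec_le) (assumption | linarith | simp)+
    next
      show "length ((grow (n x) (g x) ^^ j) []) \<le> ?k x"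
        using gb j by (meson le_trans)
    qed
  next
    show "pbd b" unfolding b_def
      using pbd_ptime[OF assms(1)] by (intro pbd_intros pbd_ptime assms) simp_all
  qed (intro ptime_intros assms[THEN ptime_lift])+
  then show ?thesis unfolding closure_def .
qed

lemma ptime_proj [ptime_intros]:
  assumes "ptime T" "ptime v" shows "ptime (\<lambda>x. proj (T x) (v x) :: tree list)"
  unfolding proj_def by (intro ptime_intros assms)

lemma ptime_cnt [ptime_intros]: "ptime T \<Longrightarrow> ptime (\<lambda>x. cnt (T x))"
  unfolding cnt_def by (intro ptime_intros)

lemma ptime_matches [ptime_intros]:
  assumes "ptime E" "ptime g" shows "ptime (\<lambda>x. matches (E x) (g x))"
  unfolding matches_def by (intro ptime_intros assms[THEN ptime_lift])

lemma ptime_rare [ptime_intros]: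
  assumes "ptime E" shows "ptime (\<lambda>x. rare (E x))"
  unfolding rare_def by (intro ptime_intros assms[THEN ptime_lift])

lemma ptime_advance [ptime_intros]:
  assumes "ptime E" "ptime g" shows "ptime (\<lambda>x. advance (g x) (E x))"
  unfolding advance_def by (intro ptime_intros assms)

lemma ptime_ext [ptime_intros]:
  assumes "ptime E" "ptime g" shows "ptime (\<lambda>x. ext (g x) (E x))"
  unfolding ext_def by (intro ptime_intros assms)

lemma ptime_extend [ptime_intros]:
  assumes "ptime L" "ptime g" shows "ptime (\<lambda>x. extend (g x) (L x))"
  unfolding extend_def by (intro ptime_intros assms[THEN ptime_lift])

lemma ptime_choose_elt [ptime_intros]:
  assumes "ptime L" shows "ptime (\<lambda>x. choose_elt (L x))"
  unfolding choose_elt_def by (intro ptime_intros assms[THEN ptime_lift])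

lemma ptime_greedy_step [ptime_intros]:
  assumes "ptime s" shows "ptime (\<lambda>x. greedy_step (s x))"
  unfolding greedy_step_def by (intro ptime_intros assms)

definition entry_le :: "nat \<Rightarrow> tree entry \<Rightarrow> bool" where
  "entry_le N E \<longleftrightarrow> size (encode (fst E)) \<le> N \<and> size (encode (fst (snd E))) \<le> N \<and>
     length (snd (snd E)) \<le> N \<and> set (snd (snd E)) \<subseteq> carrier G \<union> {a. size (encode a) \<le> N}"

text \<open>No component of an entry outgrows its bound during a run, so only the number of entries
  matters, which \<open>greedy_steps\<close> controls.\<close>

lemma entry_le_ext:
  assumes "entry_le N E" "E' \<in> set (ext g E)" shows "entry_le N E'"
proof -
  obtain T R y where E: "E = (T, R, y)" by (cases E)
  have "size (encode (tl T)) \<le> size (encode T)" by (cases T) auto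
  moreover have "set (tl (vmul y r)) \<subseteq> carrier G" for r
    using set_tl[of "vmul y r"] set_vmul[of y r] by blast
  moreover note size_tails[of R]
  ultimately show ?thesis using assms unfolding E
    by (auto simp: entry_le_def ext_def advance_def split: if_splits)
qed

lemma greedy_entries:
  "(\<And>E. E \<in> set L \<Longrightarrow> entry_le N E) \<Longrightarrow> E \<in> set (snd ((greedy_step ^^ j) ([], L))) \<Longrightarrow> entry_le N E"
proof (induction j arbitrary: E)
  case (Suc j)
  let ?L = "snd ((greedy_step ^^ j) ([], L))"
  have "snd (greedy_step s) = extend (choose_elt (snd s)) (snd s)" for s
    by (simp add: greedy_step_def)
  then have "E \<in> set (extend (choose_elt ?L) ?L)" using Suc.prems(2) by simp
  then obtain E0 where E0: "E0 \<in> set ?L" "E \<in> set (ext (choose_elt ?L) E0)"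
    unfolding extend_def by auto
  show ?case by (rule entry_le_ext[OF Suc.IH[OF Suc.prems(1) E0(1)] E0(2)])
qed simp

lemma size_entry_le:
  assumes "entry_le N E" "esz \<le> N" shows "size (encode E) \<le> 2 * N + N * (N + 1) + 2"
proof -
  have "size (encode (snd (snd E))) \<le> N * (N + 1)"
    using assms by (intro size_vec_le) (auto simp: entry_le_def)
  then show ?thesis using assms(1) by (simp add: encode_prod_def entry_le_def)
qed

lemma ptime_greedy [ptime_intros]:
  assumes "ptime n" "ptime L" shows "ptime (\<lambda>x. greedy (n x) (L x))"
proof -
  let ?N = "\<lambda>x. esz + size (encode (L x))"
  define b where "b = (\<lambda>x. n x * (esz + 1) +
    size (encode (L x)) * (2 * ?N x + ?N x * (?N x + 1) + 2 + 1) + 1)"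
  have "ptime (\<lambda>x. (greedy_step ^^ n x) ([], L x))"
  proof (rule ptime_funpow[where b = b and f = "\<lambda>_. greedy_step"])
    fix x j assume j: "j \<le> n x"
    have e: "entry_le (?N x) E" if "E \<in> set (L x)" for E
    proof -
      have "size (encode E) < size (encode (L x))" by (rule size_encode_member[OF that])
      moreover obtain T R y where E: "E = (T, R, y)" by (cases E)
      moreover have "size (encode a) < size (encode y)" if "a \<in> set y" for a
        by (rule size_encode_member[OF that])
      ultimately show ?thesis using length_le_size_encode[of y] by (fastforce simp: entry_le_def)
    qed
    let ?x = "greedy j (L x)" and ?L = "run (greedy j (L x)) (L x)"
    have s: "(greedy_step ^^ j) ([], L x) = (?x, ?L)" "?x \<in> vecs j" "length ?L \<le> length (L x)"
      using greedy_steps[of j "L x"] by blast+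
    have "size (encode ?x) \<le> n x * (esz + 1)"
      using s(2) j by (intro size_vec_le) (auto simp: vecs_def)
    moreover have "size (encode ?L) \<le> size (encode (L x)) * (2 * ?N x + ?N x * (?N x + 1) + 2 + 1)"
    proof (rule size_encode_list_le)
      show "size (encode E) \<le> 2 * ?N x + ?N x * (?N x + 1) + 2" if "E \<in> set ?L" for E
        using greedy_entries[of "L x" "?N x" E j] e that s(1) by (intro size_entry_le) auto
      show "length ?L \<le> size (encode (L x))"
        using s(3) length_le_size_encode[of "L x"] by simp
    qed
    ultimately show "size (encode ((greedy_step ^^ j) ([], L x))) \<le> b x"
      unfolding s(1) b_def by simp
  next
    show "pbd b" unfolding b_def
      using pbd_ptime[OF assms(1)] by (intro pbd_intros pbd_ptime assms) simp_all
  qed (intro ptime_intros assms)+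
  then show ?thesis unfolding greedy_def by (intro ptime_intros)
qed

lemma ptime_entry [ptime_intros]:
  assumes "ptime gens" "ptime T" shows "ptime (\<lambda>x. entry (gens x) (T x))"
  unfolding entry_def by (intro ptime_intros assms[THEN ptime_lift])

lemma ptime_solve [ptime_intros]:
  assumes "ptime n" "ptime F" "ptime gens" shows "ptime (\<lambda>x. solve (n x) (F x) (gens x))"
  unfolding solve_def by (intro ptime_intros assms[THEN ptime_lift])

lemma ptime_dbl [ptime_intros]: "ptime F \<Longrightarrow> ptime (\<lambda>x. dbl (F x))"
  unfolding dbl_def by (intro ptime_intros)

lemma ptime_widen [ptime_intros]:
  assumes "ptime n" "ptime F" shows "ptime (\<lambda>x. widen (n x) (F x))"
  unfolding widen_def by (intro ptime_intros assms)

lemma ptime_short_bits [ptime_intros]: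
  assumes "ptime n" shows "ptime (\<lambda>x. short_bits (n x))"
proof -
  have "ptime (\<lambda>x. (widen (n x) ^^ n x) [[]])"
  proof (rule ptime_funpow[where b = "\<lambda>x. (2 * n x + 1) * (n x * 2 + 1)"])
    fix x j assume j: "j \<le> n x"
    let ?F = "(widen (n x) ^^ j) [[]]"
    note F = short_bits_steps[where n = "n x" and k = j]
    show "size (encode ?F) \<le> (2 * n x + 1) * (n x * 2 + 1)"
    proof (rule size_encode_list_le)
      fix l assume "l \<in> set ?F"
      then have "length l \<le> n x" using F j by auto
      moreover have "size (encode b) \<le> 1" for b :: bool by (cases b) auto
      ultimately show "size (encode l) \<le> n x * 2"
        using size_encode_list_le[of l 1 "n x"] by simp
    next
      have "(2::nat) ^ min j (blen (n x)) \<le> 2 ^ blen (n x)" by (intro power_increasing) auto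
      then show "length ?F \<le> 2 * n x + 1" using F two_power_blen_le[of "n x"] by linarith
    qed
  next
    show "pbd (\<lambda>x. (2 * n x + 1) * (n x * 2 + 1))"
      using pbd_ptime[OF assms] by (intro pbd_intros) simp_all
  qed (intro ptime_intros assms[THEN ptime_lift] assms)+
  then show ?thesis unfolding short_bits_def .
qed

lemma ptime_prodl [ptime_intros]:
  assumes "ptime F" "ptime F'" shows "ptime (\<lambda>x. prodl (F x) (F' x))"
  unfolding prodl_def by (intro ptime_intros assms[THEN ptime_lift])

lemma ptime_bitvecs [ptime_intros]:
  assumes "ptime n" shows "ptime (\<lambda>x. bitvecs c (n x))"
  unfolding bitvecs_def by (intro ptime_funpow_const ptime_intros assms[THEN ptime_lift])

lemma ptime_mask [ptime_intros]:
  assumes "ptime n" "ptime M" shows "ptime (\<lambda>x. mask (n x) (M x))"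
  unfolding mask_def by (intro ptime_intros assms)

lemma ptime_block [ptime_intros]:
  assumes "ptime n" "ptime g" shows "ptime (\<lambda>x. block c (n x) (g x))"
  unfolding block_def by (intro ptime_intros assms[THEN ptime_lift])

lemma ptime_slice [ptime_intros]:
  assumes "ptime b" "ptime j" "ptime v" shows "ptime (\<lambda>x. slice (b x) (j x) (v x) :: tree list)"
  unfolding slice_def by (intro ptime_intros assms)

lemma ptime_remote [ptime_intros]:
  assumes "ptime n" "ptime b" "ptime g" shows "ptime (\<lambda>x. remote c (n x) (b x) (g x))"
  unfolding remote_def by (intro ptime_intros assms[THEN ptime_lift])

lemma ptime_prods [ptime_intros]:
  assumes "ptime R" "ptime E" shows "ptime (\<lambda>x. prods (R x) (E x))"
  unfolding prods_def by (intro ptime_intros assms[THEN ptime_lift])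

lemma ptime_elements [ptime_intros]:
  assumes "ptime n" "ptime R" shows "ptime (\<lambda>x. elements k (n x) (R x))"
  unfolding elements_def by (intro ptime_funpow_const ptime_intros assms[THEN ptime_lift])

lemma ptime_ndiff [ptime_intros]:
  assumes "ptime u" "ptime v" shows "ptime (\<lambda>x. ndiff (u x) (v x))"
  unfolding ndiff_def by (intro ptime_intros assms)

lemma ptime_insert_profile [ptime_intros]:
  assumes "ptime E" "ptime a" "ptime v" shows "ptime (\<lambda>x. insert_profile (E x) (a x) (v x))"
  unfolding insert_profile_def by (intro ptime_intros assms[THEN ptime_lift])

lemma ptime_extensions [ptime_intros]: "ptime L \<Longrightarrow> ptime (\<lambda>x. extensions (L x))"
  unfolding extensions_def by (intro ptime_intros)

lemma length_dedup: "length (foldl (insert_profile E) acc L) \<le> length acc + length L"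
proof (induction L arbitrary: acc)
  case (Cons x L)
  have "length (insert_profile E acc x) \<le> Suc (length acc)" by (simp add: insert_profile_def)
  then show ?case using Cons[of "insert_profile E acc x"] by simp
qed simp

lemma ptime_dp_step [ptime_intros]:
  assumes "ptime E" "ptime L" shows "ptime (\<lambda>x. dp_step (E x) (L x))"
  unfolding dp_step_def
proof (rule ptime_foldl[where b = "\<lambda>x. size (encode (extensions (L x))) * (size (encode (extensions (L x))) + 1)"])
  fix x j
  let ?X = "extensions (L x)"
  show "size (encode (foldl (insert_profile (E x)) [] (take j ?X))) \<le>
      size (encode ?X) * (size (encode ?X) + 1)"
  proof (rule size_encode_list_le)
    fix v assume "v \<in> set (foldl (insert_profile (E x)) [] (take j ?X))"
    then have "v \<in> set ?X" using dedup(2)[of "E x" "[]" "take j ?X"] by (auto dest: in_set_takeD)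
    then show "size (encode v) \<le> size (encode ?X)" using size_encode_member by (metis less_imp_le)
  next
    show "length (foldl (insert_profile (E x)) [] (take j ?X)) \<le> size (encode ?X)"
      using length_dedup[of "E x" "[]" "take j ?X"] length_le_size_encode[of ?X] by simp
  qed
qed (intro ptime_intros assms[THEN ptime_lift] pbd_intros pbd_ptime)+

text \<open>The number of codewords is the exponent in \<open>length_dp\<close>; the uniform bound
  \<open>M\<close> turns it into a constant.\<close>

lemma ptime_dp:
  assumes "ptime n" "ptime E" "\<And>x. length (E x) \<le> M" shows "ptime (\<lambda>x. dp (n x) (E x))"
proof -
  have "ptime (\<lambda>x. (dp_step (E x) ^^ n x) [[]])"
  proof (rule ptime_funpow[where b = "\<lambda>x. (n x + 1) ^ M * (n x * (esz + 1) + 1)"])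
    fix x j assume j: "j \<le> n x"
    have "size (encode (dp j (E x))) \<le> (n x + 1) ^ M * (n x * (esz + 1) + 1)"
    proof (rule size_encode_list_le)
      fix v assume "v \<in> set (dp j (E x))"
      then have "v \<in> vecs j" using dp_vecs by blast
      then show "size (encode v) \<le> n x * (esz + 1)" using j by (intro size_vec_le) (auto simp: vecs_def)
    next
      have "(j + 1) ^ length (E x) \<le> (n x + 1) ^ length (E x)" using j by (intro power_mono) auto
      also have "\<dots> \<le> (n x + 1) ^ M" using assms(3) by (intro power_increasing) auto
      finally show "length (dp j (E x)) \<le> (n x + 1) ^ M" using length_dp[of j "E x"] by simp
    qed
    then show "size (encode ((dp_step (E x) ^^ j) [[]])) \<le> (n x + 1) ^ M * (n x * (esz + 1) + 1)"
      by (simp add: dp_def)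
  next
    show "pbd (\<lambda>x. (n x + 1) ^ M * (n x * (esz + 1) + 1))"
      using pbd_ptime[OF assms(1)] by (intro pbd_intros) simp_all
  qed (intro ptime_intros assms(1,2)[THEN ptime_lift] assms)+
  then show ?thesis unfolding dp_def .
qed

lemma ptime_min_ndiff [ptime_intros]:
  assumes "ptime n" "ptime E" "ptime v" shows "ptime (\<lambda>x. min_ndiff (n x) (E x) (v x))"
  unfolding min_ndiff_def by (intro ptime_intros assms[THEN ptime_lift])

lemma ptime_farthest:
  assumes "ptime n" "ptime E" "\<And>x. length (E x) \<le> M" shows "ptime (\<lambda>x. farthest (n x) (E x))"
  unfolding farthest_def by (intro ptime_intros ptime_dp[OF assms] assms(1,2)[THEN ptime_lift])

lemma ptime_rpp_solution:
  assumes "ptime n" "ptime g" shows "ptime (\<lambda>x. rpp_solution c D (n x) (g x))"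
  unfolding rpp_solution_def
proof (intro ptime_intros ptime_farthest assms)
  show "length (elements D (n x) (take D (closure (n x) (g x)))) \<le> (1 + D) ^ D" for x
    unfolding length_elements by (intro power_mono) auto
qed


section \<open>Distance guarantees in terms of the block length, of \<open>\<delta>\<close> and of
  \<open>k\<close>\<close>

lemma card_lsub_pos: "lsub n S \<Longrightarrow> 0 < card S"
  using lsub_finite lsubD(2) card_gt_0_iff by blast

text \<open>Carries a guarantee for \<open>\<delta>\<close> over to every larger \<open>k\<close>.
  The threshold 3 is an upper bound of \<open>exp 1\<close>.\<close>

lemma log_div_antimono:
  assumes "3 \<le> x" "x \<le> (y::real)" shows "log 2 y / y \<le> log 2 x / x"
proof -
  have "exp 1 \<le> x" using exp_le assms(1) by linarith
  then have "ln y / y \<le> ln x / x" using ln_x_over_x_mono assms(2) by blast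
  then have "ln y / y / ln 2 \<le> ln x / x / ln 2" by (rule divide_right_mono) simp
  then show ?thesis by (simp add: log_def field_simps)
qed

lemma card_square_le:
  assumes "lsub n S" "2 \<le> length el" "2 * log (length el) (card S) \<le> real b"
  shows "card S * card S \<le> length el ^ b"
proof -
  let ?q = "real (length el)"
  have S: "real (card S) = ?q powr log ?q (card S)"
    using card_lsub_pos[OF assms(1)] assms(2) by (intro powr_log_cancel[symmetric]) linarith+
  have "real (card S) * real (card S) = ?q powr (2 * log ?q (card S))"
    by (subst (1 2) S) (simp add: powr_add[symmetric])
  also have "\<dots> \<le> ?q powr real b" using assms(2,3) by (intro powr_mono) auto
  also have "\<dots> = real (length el ^ b)" using assms(2) by (subst powr_realpow) (linarith, simp)
  finally show ?thesis by (metis of_nat_le_iff of_nat_mult)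
qed

text \<open>Applied with \<open>x = \<delta>\<close> for the algorithm and with \<open>x = K\<close>
  for existence. The last hypothesis on \<open>x\<close> gives
  \<open>2 * c * b \<le> 4 * c * |G|^2 * x \<le> C * x\<close>, that is,
  \<open>c / x \<le> C / (2 * b)\<close>; this is where the size required of \<open>C\<close> comes
  from.\<close>

lemma remote_far_bound:
  fixes c :: real
  assumes S: "gensby n gens S" and q: "2 \<le> length el" and c: "0 < c"
    and C: "4 * c * length el * length el \<le> real C" and b: "b \<le> n" "24 * C * blen b < b"
    and d: "2 * log (length el) (card S) \<le> real b"
    and x: "3 \<le> x" "x \<le> K" "x \<le> real b" "real b \<le> 2 * real (length el) * real (length el) * x"
    and r: "real r \<le> c * real n * log 2 K / K" and h: "h \<in> S"
  shows "r < ndiff (remote (8 * C) n b gens) h"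
proof -
  let ?q = "real (length el)"
  have lsub: "lsub n S" using S by (simp add: gensby_def)
  have "0 < ?q" using q by linarith
  then have "0 < 4 * c * ?q * ?q" using c by simp
  then have "0 < real C" using C by linarith
  then have C0: "0 < C" by simp
  have "real r \<le> c * real n * (log 2 K / K)" using r by simp
  also have "\<dots> \<le> c * real n * (log 2 x / x)"
    using log_div_antimono[OF x(1,2)] c by (intro mult_left_mono) auto
  also have "\<dots> \<le> c * real n * (log 2 (real b) / x)"
    using x c by (intro mult_left_mono divide_right_mono) auto
  also have "\<dots> \<le> real C * real n * log 2 (real b) / (2 * real b)"
  proof -
    have lb: "0 \<le> log 2 (real b)" using x by simp
    have "4 * c * ?q * ?q * x \<le> real C * x" using C x(1) by (intro mult_right_mono) auto
    moreover have "2 * c * real b \<le> 2 * c * (2 * ?q * ?q * x)"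
      using x(4) c by (intro mult_left_mono) auto
    ultimately have "2 * c * real b \<le> real C * x" by (simp add: algebra_simps)
    then have "c / x \<le> real C / (2 * real b)" using x by (simp add: field_simps)
    then have "c / x * (real n * log 2 (real b)) \<le> real C / (2 * real b) * (real n * log 2 (real b))"
      using lb by (intro mult_right_mono) auto
    then show ?thesis by (simp add: field_simps)
  qed
  also have "\<dots> < real (ndiff (remote (8 * C) n b gens) h)"
    by (rule remote_far_log[OF S b C0 card_square_le[OF lsub q d] q h])
  finally show ?thesis by simp
qed

text \<open>If \<open>K \<le> B + 3\<close>, the strong generating set has length at most
  \<open>D\<close>, so the exact search runs and only needs that some remote point exists; this
  includes \<open>K = 0\<close>, where the quotient is 0 by convention. In the other branch
  \<open>\<delta>\<close> is large enough for all asymptotic estimates.\<close>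

lemma rpp_solution_correct:
  fixes c :: real
  assumes S: "gensby n gens S" and q: "2 \<le> length el" and c: "0 < c"
    and C: "4 * c * length el * length el \<le> real C" and B: "\<forall>b\<ge>B. 24 * C * blen b < b"
    and D: "D = (B + 3) * length el * length el"
    and K: "log (length el) (card S) \<le> K" "K \<le> real n / 2"
    and r: "real r \<le> c * real n * log 2 K / K"
    and ex: "\<exists>x\<in>vecs n. \<forall>h\<in>S. r < ndiff x h" and h: "h \<in> S"
  shows "r < ndiff (rpp_solution C D n gens) h"
proof (cases "length (closure n gens) \<le> D")
  case True
  have E: "set (elements D n (take D (closure n gens))) = S"
    using elements_closure[OF S True] True by simp
  obtain x where x: "x \<in> vecs n" "\<And>h. h \<in> S \<Longrightarrow> r < ndiff x h" using ex by blast
  have "elements D n (take D (closure n gens)) \<noteq> []" using E h by auto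
  then have "r < ndiff (farthest n (elements D n (take D (closure n gens)))) h"
    using x h E by (intro farthest_far[of x]) auto
  then show ?thesis using True by (simp add: rpp_solution_def)
next
  case False
  let ?R = "closure n gens" and ?q = "real (length el)"
  define d where "d = log ?q (card S)"
  define b where "b = min n (2 * length ?R)"
  have lsub: "lsub n S" using S by (simp add: gensby_def)
  have S0: "0 < card S" using card_lsub_pos[OF lsub] .
  note Rv = closure_vecs[OF gensby_vecs[OF S]]
  have keyed: "keyed n ?R" using closure_sgs(1)[OF gensby_vecs[OF S]] by (simp add: sgs_def)
  have low: "2 ^ length ?R \<le> card S ^ length el" and up: "card S \<le> 2 ^ length ?R"
    using card_span_lower[OF Rv keyed] card_span_upper[OF Rv] span_closure[OF S] by simp_all
  have q1: "1 < ?q" using q by linarith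
  then have Sq: "real (card S) = ?q powr d"
    using S0 unfolding d_def by (intro powr_log_cancel[symmetric]) linarith+
  have d0: "0 \<le> d" using S0 q by (simp add: d_def)
  have d_le: "d \<le> real (length ?R)"
  proof -
    have "real (card S) \<le> 2 ^ length ?R" using up by (metis of_nat_le_iff of_nat_numeral of_nat_power)
    also have "\<dots> \<le> ?q ^ length ?R" using q by (intro power_mono) auto
    finally have "?q powr d \<le> ?q powr real (length ?R)"
      using q1 by (simp only: Sq powr_realpow)
    then show ?thesis using q1 by (simp only: powr_le_cancel_iff)
  qed
  \<comment> \<open>One factor \<open>?q\<close> is the exponent in \<open>card_span_lower\<close>,
    the other bounds \<open>log 2 ?q\<close> when the base changes from \<open>?q\<close> to
    2.\<close>
  have R_le: "real (length ?R) \<le> ?q * ?q * d"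
  proof -
    have "real (2 ^ length ?R) \<le> real (card S ^ length el)" using low by (simp only: of_nat_le_iff)
    then have "log 2 (2 ^ length ?R) \<le> log 2 (real (card S) ^ length el)"
      using S0 by (subst log_le_cancel_iff) auto
    then have "real (length ?R) \<le> ?q * log 2 (real (card S))" using S0 by (simp add: log_nat_power)
    also have "log 2 (real (card S)) = d * log 2 ?q" using q by (simp add: Sq log_powr)
    also have "?q * (d * log 2 ?q) \<le> ?q * (d * ?q)"
    proof -
      have "length el \<le> 2 ^ length el" using less_exp[of "length el"] by simp
      then have "real (length el) \<le> real (2 ^ length el)" by (simp only: of_nat_le_iff)
      then have "log 2 ?q \<le> log 2 (2 ^ length el)" using q1 by (subst log_le_cancel_iff) auto
      then have "log 2 ?q \<le> ?q" by simp
      then show ?thesis using d0 by (intro mult_left_mono) auto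
    qed
    finally show ?thesis by (simp add: mult.commute mult.left_commute)
  qed
  \<comment> \<open>The choice of \<open>D\<close> cancels the factor \<open>?q * ?q\<close>: a long
    generating set forces \<open>d > B + 3\<close>, so that \<open>b > B\<close> and
    \<open>d \<ge> 3\<close>.\<close>
  have "real ((B + 3) * length el * length el) < real (length ?R)"
    using False D by (simp only: of_nat_less_iff not_le)
  then have "?q * ?q * real (B + 3) < ?q * ?q * d" using R_le by (simp add: algebra_simps)
  then have dB: "real (B + 3) < d" using q by (simp add: mult_less_cancel_left)
  \<comment> \<open>Here \<open>k \<le> n / 2\<close> enters: even if the block length is cut down
    to \<open>n\<close>, it is at least \<open>2 * d\<close>.\<close>
  have d2n: "2 * d \<le> real n" using K by (simp add: d_def)
  have d2b: "2 * d \<le> real b" using d2n d_le by (simp add: b_def min_def)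
  have "r < ndiff (remote (8 * C) n b gens) h"
  proof (rule remote_far_bound[OF S q c C _ _ _ _ _ _ _ r h])
    show "b \<le> n" by (simp add: b_def)
    have "real B \<le> real b" using dB d2b by simp
    then show "24 * C * blen b < b" using B by simp
    show "2 * log ?q (card S) \<le> real b" using d2b by (simp add: d_def)
    show "3 \<le> d" "d \<le> K" using dB K(1) by (simp_all add: d_def)
    show "d \<le> real b" using d2b d0 by simp
    have "real b \<le> 2 * real (length ?R)" by (simp add: b_def min_def)
    then show "real b \<le> 2 * ?q * ?q * d" using R_le by simp
  qed
  then show ?thesis using False by (simp add: rpp_solution_def b_def)
qed

text \<open>The construction itself supplies the witness. All of \<open>S\<close> serves as its list
  of generators, and the block length is taken from \<open>K\<close> instead of
  \<open>\<delta>\<close>, so that subgroups of every order up to the bound are covered.\<close>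

lemma remote_point_exists:
  fixes c :: real
  assumes S: "lsub n S" and q: "2 \<le> length el" and c: "0 < c"
    and C: "4 * c * length el * length el \<le> real C" and B: "\<forall>b\<ge>B. 24 * C * blen b < b"
    and K: "real (B + 3) \<le> K" "log (length el) (card S) \<le> K" "K \<le> real n / 2"
    and r: "real r \<le> c * real n * log 2 K / K"
  shows "\<exists>x\<in>vecs n. \<forall>h\<in>S. r < ndiff x h"
proof -
  obtain gens where gens: "set gens = S" using finite_list[OF lsub_finite[OF S]] by blast
  have g: "gensby n gens S" using S gens by (simp add: gensby_def)
  let ?q = "real (length el)"
  define b where "b = nat \<lceil>2 * K\<rceil>"
  have b1: "2 * K \<le> real b" "real b \<le> 2 * K + 1" using K(1) unfolding b_def by linarith+
  \<comment> \<open>Rounding \<open>2 * K\<close> up stays below \<open>n\<close>, because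
    \<open>n\<close> is an integer.\<close>
  have "b \<le> n" using K unfolding b_def by linarith
  have "r < ndiff (remote (8 * C) n b gens) h" if h: "h \<in> S" for h
  proof (rule remote_far_bound[OF g q c C \<open>b \<le> n\<close> _ _ _ _ _ _ r h])
    have "real B \<le> real b" using K b1 by simp
    then show "24 * C * blen b < b" using B by simp
    show "2 * log ?q (card S) \<le> real b" using b1 K by simp
    show "3 \<le> K" "K \<le> K" "K \<le> real b" using K b1 by simp_all
    have "2 * K + 1 \<le> 3 * K" using K(1) by simp
    also have "\<dots> \<le> 2 * ?q * ?q * K"
    proof (rule mult_right_mono)
      have "2 * 2 \<le> ?q * ?q" using q by (intro mult_mono) auto
      then show "3 \<le> 2 * ?q * ?q" by simp
    qed (use K in simp)
    finally show "real b \<le> 2 * ?q * ?q * K" using b1 by simp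
  qed
  moreover have "0 < b" using b1 K by simp
  ultimately show ?thesis using remote_vecs[of b "8 * C" n gens] by blast
qed

lemma rpp_solution_vecs: "rpp_solution C D n gens \<in> vecs n"
proof (cases "length (closure n gens) \<le> D")
  case True
  then show ?thesis by (simp add: rpp_solution_def farthest_vecs)
next
  case False
  show ?thesis
  proof (cases "n = 0")
    case True
    then show ?thesis using False by (simp add: rpp_solution_def remote_def)
  next
    case n: False
    have "0 < length (closure n gens)" using False by linarith
    then have "0 < min n (2 * length (closure n gens))" using n by simp
    then show ?thesis using False by (simp only: rpp_solution_def if_False remote_vecs)
  qed
qed

end

section \<open>Transfer to the power group\<close>

lemma ptime_computes_in:
  assumes "ptime f"
  shows "\<exists>P (p :: nat poly). \<forall>x. \<exists>t. computes_in P (encode x) t (encode (f x)) \<and>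
    t \<le> poly p (size (encode x))"
proof -
  obtain c p where c: "realizes c p f" by (rule ptimeE[OF assms])
  have "\<exists>t. computes_in c (encode x) t (encode (f x)) \<and> t \<le> poly p (size (encode x))" for x
  proof -
    obtain t where t: "t \<le> poly p (size (encode x))" "runs c (stack [encode x]) t (stack [encode (f x)])"
      using realizesD(1)[OF c order_refl, of x] unfolding runs_le_def by blast
    have "computes_in c (encode x) t (encode (f x))"
      unfolding computes_in_def
    proof (intro exI conjI)
      show "runs c ((\<lambda>_. Leaf)(0 := encode x)) t (stack [encode (f x)])"
        using t(2) by (simp only: stack_singleton)
    qed simp
    with t(1) show ?thesis by blast
  qed
  then show ?thesis by blast
qed

section \<open>Transport of the group to its codes\<close>

locale coded_group = group G for G (structure) +
  fixes e :: "'a \<Rightarrow> tree"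
  assumes fin: "finite (carrier G)" and inj: "inj_on e (carrier G)"
begin

definition dec :: "tree \<Rightarrow> 'a" where
  "dec = the_inv_into (carrier G) e"

definition code_group :: "tree monoid" where
  "code_group = \<lparr>carrier = e ` carrier G, monoid.mult = (\<lambda>s t. e (dec s \<otimes> dec t)), one = e \<one>\<rparr>"

lemma dec_e [simp]: "a \<in> carrier G \<Longrightarrow> dec (e a) = a"
  unfolding dec_def by (rule the_inv_into_f_f[OF inj])

lemma code_group_simps [simp]:
  "carrier code_group = e ` carrier G" "\<one>\<^bsub>code_group\<^esub> = e \<one>"
  "s \<otimes>\<^bsub>code_group\<^esub> t = e (dec s \<otimes> dec t)"
  by (simp_all add: code_group_def)

lemma e_eq_iff: "a \<in> carrier G \<Longrightarrow> b \<in> carrier G \<Longrightarrow> e a = e b \<longleftrightarrow> a = b"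
  using inj by (auto simp: inj_on_def)

lemma group_code_group: "group code_group"
proof (rule groupI)
  show "\<exists>t\<in>carrier code_group. t \<otimes>\<^bsub>code_group\<^esub> s = \<one>\<^bsub>code_group\<^esub>"
    if "s \<in> carrier code_group" for s
    using that by (auto intro!: bexI[of _ "inv _"] simp: l_inv)
qed (auto simp: m_assoc)

text \<open>Any enumeration will do; it is fixed along with the group and thus hard-wired into the
  program.\<close>

definition codes :: "tree list" where
  "codes = (SOME l. set l = e ` carrier G \<and> distinct l)"

lemma codes: "distinct codes" "set codes = e ` carrier G"
  using someI_ex[OF finite_distinct_list[OF finite_imageI[OF fin, of e]]] unfolding codes_def by blast+

sublocale cg: tree_group code_group codes
  using group_code_group codes
  by (simp add: tree_group_def listed_group_def listed_group_axioms_def)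

lemma length_codes: "length codes = card (carrier G)"
  using codes card_image[OF inj] distinct_card[of codes] by simp

definition vec :: "nat \<Rightarrow> (nat \<Rightarrow> 'a) \<Rightarrow> tree list" where
  "vec n x = map (\<lambda>i. e (x i)) [0..<n]"

abbreviation pow :: "nat \<Rightarrow> (nat \<Rightarrow> 'a) monoid" where
  "pow n \<equiv> power_group G n"

lemma group_pow: "group (pow n)"
  by (rule product_group) (rule is_group)

lemma pow_mem: "x \<in> carrier (pow n) \<Longrightarrow> i < n \<Longrightarrow> x i \<in> carrier G"
  by (auto simp: PiE_iff)

lemma vec_vecs: "x \<in> carrier (pow n) \<Longrightarrow> vec n x \<in> cg.vecs n"
proof -
  assume x: "x \<in> carrier (pow n)"
  have "e (x i) \<in> e ` carrier G" if "i < n" for i using pow_mem[OF x that] by (rule imageI)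
  then show ?thesis by (auto simp: vec_def cg.vecs_def)
qed

text \<open>Elements of the product group are \<open>undefined\<close> outside
  \<open>{..<n}\<close>, so their first \<open>n\<close> values determine them.\<close>

lemma inj_on_vec: "inj_on (vec n) (carrier (pow n))"
proof (rule inj_onI)
  fix x y assume xy: "x \<in> carrier (pow n)" "y \<in> carrier (pow n)" "vec n x = vec n y"
  show "x = y"
  proof (rule ext)
    fix i
    show "x i = y i"
    proof (cases "i < n")
      case True
      then have "e (x i) = e (y i)" using arg_cong[OF xy(3), of "\<lambda>v. v ! i"] by (simp add: vec_def)
      then show ?thesis by (rule inj_onD[OF inj _ pow_mem[OF xy(1) True] pow_mem[OF xy(2) True]])
    next
      case False
      then have i: "i \<notin> {..<n}" by simp
      have "x \<in> {..<n} \<rightarrow>\<^sub>E carrier G" "y \<in> {..<n} \<rightarrow>\<^sub>E carrier G" using xy(1,2) by simp_all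
      from this[THEN PiE_arb, OF i] show ?thesis by (rule trans[OF _ sym])
    qed
  qed
qed

lemma vec_surj: "v \<in> cg.vecs n \<Longrightarrow> \<exists>x\<in>carrier (pow n). vec n x = v"
proof
  assume v: "v \<in> cg.vecs n"
  let ?x = "\<lambda>i\<in>{..<n}. dec (v ! i)"
  have m: "\<exists>a\<in>carrier G. v ! i = e a" if "i < n" for i
    using v that by (auto simp: cg.vecs_def subset_iff image_iff)
  show "?x \<in> carrier (pow n)" using m by (force simp: PiE_iff)
  show "vec n ?x = v"
  proof (rule nth_equalityI)
    show "length (vec n ?x) = length v" using v by (simp add: vec_def cg.vecs_def)
    show "vec n ?x ! i = v ! i" if "i < length (vec n ?x)" for i
      using that m[of i] by (auto simp: vec_def)
  qed
qed

lemma vec_one: "vec n \<one>\<^bsub>pow n\<^esub> = cg.ones n"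
  by (rule nth_equalityI) (auto simp: vec_def cg.ones_def)

lemma vec_mult:
  assumes "x \<in> carrier (pow n)" "y \<in> carrier (pow n)"
  shows "vec n (x \<otimes>\<^bsub>pow n\<^esub> y) = cg.vmul (vec n x) (vec n y)"
proof (rule nth_equalityI)
  fix i assume "i < length (vec n (x \<otimes>\<^bsub>pow n\<^esub> y))"
  then have i: "i < n" by (simp add: vec_def)
  then show "vec n (x \<otimes>\<^bsub>pow n\<^esub> y) ! i = cg.vmul (vec n x) (vec n y) ! i"
    using pow_mem[OF assms(1) i] pow_mem[OF assms(2) i]
    by (simp add: vec_def cg.vmul_def cg.op_eq)
qed (simp add: vec_def)

lemma lsub_vec:
  assumes "subgroup H (pow n)" shows "cg.lsub n (vec n ` H)"
proof (rule cg.lsubI)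
  note H = subgroup.subset[OF assms]
  show "vec n ` H \<subseteq> cg.vecs n" using H vec_vecs by blast
  show "cg.ones n \<in> vec n ` H" using subgroup.one_closed[OF assms] vec_one by (metis imageI)
  show "cg.vmul u v \<in> vec n ` H" if uv: "u \<in> vec n ` H" "v \<in> vec n ` H" for u v
  proof -
    from uv obtain x y where xy: "x \<in> H" "y \<in> H" "u = vec n x" "v = vec n y" by blast
    then have "x \<in> carrier (pow n)" "y \<in> carrier (pow n)" using H by blast+
    then have "cg.vmul u v = vec n (x \<otimes>\<^bsub>pow n\<^esub> y)" unfolding xy(3,4) by (rule vec_mult[symmetric])
    then show ?thesis using subgroup.m_closed[OF assms xy(1,2)] by blast
  qed
qed

lemma gensby_vec:
  assumes "set gens \<subseteq> carrier (pow n)"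
  shows "cg.gensby n (map (vec n) gens) (vec n ` generate (pow n) (set gens))"
  unfolding cg.gensby_def
proof (intro conjI allI impI)
  interpret P: group "pow n" by (rule group_pow)
  let ?H = "generate (pow n) (set gens)"
  show "cg.lsub n (vec n ` ?H)" by (rule lsub_vec[OF P.generate_is_subgroup[OF assms]])
  show "set (map (vec n) gens) \<subseteq> vec n ` ?H" by (auto intro: generate.incl)
  fix Z assume Z: "cg.lsub n Z" "set (map (vec n) gens) \<subseteq> Z"
  let ?Y = "{x \<in> carrier (pow n). vec n x \<in> Z}"
  have "subgroup ?Y (pow n)"
  proof (rule P.subgroupI)
    show "?Y \<noteq> {}" using P.one_closed vec_one cg.lsubD(2)[OF Z(1)] by (metis (mono_tags, lifting) empty_iff mem_Collect_eq)
    show "x \<otimes>\<^bsub>pow n\<^esub> y \<in> ?Y" if "x \<in> ?Y" "y \<in> ?Y" for x y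
      using that cg.lsubD(3)[OF Z(1)] P.m_closed[of x y] vec_mult[of x n y] by simp
    show "inv\<^bsub>pow n\<^esub> x \<in> ?Y" if x: "x \<in> ?Y" for x
    proof -
      have xi: "x \<in> carrier (pow n)" "inv\<^bsub>pow n\<^esub> x \<in> carrier (pow n)" using x P.inv_closed by auto
      have "cg.vmul (vec n x) (vec n (inv\<^bsub>pow n\<^esub> x)) = cg.ones n"
        using vec_mult[OF xi] P.r_inv[OF xi(1)] vec_one by simp
      then have "vec n (inv\<^bsub>pow n\<^esub> x) = cg.vldiv (vec n x) (cg.ones n)"
        using cg.vldiv_vmul[OF vec_vecs[OF xi(1)] vec_vecs[OF xi(2)]] by simp
      also have "\<dots> \<in> Z" using cg.lsubD(2,4)[OF Z(1)] x by simp
      finally show ?thesis using xi(2) by simp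
    qed
  qed auto
  moreover have "set gens \<subseteq> ?Y" using assms Z(2) by auto
  ultimately have "?H \<subseteq> ?Y" using P.generate_subgroup_incl by blast
  then show "vec n ` ?H \<subseteq> Z" by blast
qed

lemma ndiff_vec:
  assumes "x \<in> carrier (pow n)" "y \<in> carrier (pow n)"
  shows "cg.ndiff (vec n x) (vec n y) = card {i \<in> {..<n}. x i \<noteq> y i}"
proof -
  have "{i. i < n \<and> vec n x ! i \<noteq> vec n y ! i} = {i \<in> {..<n}. x i \<noteq> y i}"
    using pow_mem[OF assms(1)] pow_mem[OF assms(2)] by (auto simp: vec_def e_eq_iff)
  then show ?thesis using cg.ndiff_conv[OF vec_vecs[OF assms(1)] vec_vecs[OF assms(2)]] by simp
qed

text \<open>Writing \<open>x\<close> as \<open>h\<close> times \<open>w\<close> forces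
  \<open>w\<close> to be the coordinatewise quotient, which is nontrivial exactly where
  \<open>x\<close> and \<open>h\<close> differ; so the weight of \<open>w\<close> is a Hamming
  distance.\<close>

lemma ball_around_iff:
  assumes H: "H \<subseteq> carrier (pow n)" and x: "x \<in> carrier (pow n)"
  shows "x \<notin> ball_around G n H r \<longleftrightarrow> (\<forall>h\<in>vec n ` H. r < cg.ndiff (vec n x) h)"
proof -
  interpret P: group "pow n" by (rule group_pow)
  have wt: "wt G n w = card {i \<in> {..<n}. x i \<noteq> h i}"
    if h: "h \<in> carrier (pow n)" and w: "w \<in> carrier (pow n)" and hw: "h \<otimes>\<^bsub>pow n\<^esub> w = x" for h w
  proof -
    have "w i \<noteq> \<one> \<longleftrightarrow> x i \<noteq> h i" if "i < n" for i
    proof -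
      have "x i = h i \<otimes> w i" using hw that by auto
      then show ?thesis using pow_mem[OF h that] pow_mem[OF w that] by simp
    qed
    then show ?thesis unfolding wt_def by (intro arg_cong[where f = card]) auto
  qed
  have "x \<in> ball_around G n H r \<longleftrightarrow> (\<exists>h\<in>H. card {i \<in> {..<n}. x i \<noteq> h i} \<le> r)"
  proof
    assume "x \<in> ball_around G n H r"
    then obtain h w where hw: "h \<in> H" "w \<in> carrier (pow n)" "wt G n w \<le> r" "h \<otimes>\<^bsub>pow n\<^esub> w = x"
      unfolding ball_around_def set_mult_def weight_ball_def by blast
    then have "h \<in> carrier (pow n)" using H by blast
    from wt[OF this hw(2,4)] hw(1,3) show "\<exists>h\<in>H. card {i \<in> {..<n}. x i \<noteq> h i} \<le> r"
      by (intro bexI[of _ h]) (simp only:)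
  next
    assume "\<exists>h\<in>H. card {i \<in> {..<n}. x i \<noteq> h i} \<le> r"
    then obtain h where h: "h \<in> H" "card {i \<in> {..<n}. x i \<noteq> h i} \<le> r" by blast
    then have hc: "h \<in> carrier (pow n)" using H by blast
    let ?w = "inv\<^bsub>pow n\<^esub> h \<otimes>\<^bsub>pow n\<^esub> x"
    have w: "?w \<in> carrier (pow n)" using P.m_closed[OF P.inv_closed[OF hc] x] .
    have "h \<otimes>\<^bsub>pow n\<^esub> ?w = (h \<otimes>\<^bsub>pow n\<^esub> inv\<^bsub>pow n\<^esub> h) \<otimes>\<^bsub>pow n\<^esub> x"
      using P.m_assoc[OF hc P.inv_closed[OF hc] x] by (rule sym)
    also have "\<dots> = x" using P.r_inv[OF hc] P.l_one[OF x] by (simp only:)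
    finally have hw: "h \<otimes>\<^bsub>pow n\<^esub> ?w = x" .
    have "?w \<in> weight_ball G n r" using w h(2) wt[OF hc w hw] unfolding weight_ball_def by simp
    then show "x \<in> ball_around G n H r"
      unfolding ball_around_def set_mult_def using h(1) hw by blast
  qed
  then show ?thesis using ndiff_vec[OF x] H by (auto simp: not_le subset_iff)
qed

lemma card_vec: "H \<subseteq> carrier (pow n) \<Longrightarrow> card (vec n ` H) = card H"
  using inj_on_vec inj_on_subset card_image by blast

lemma exists_remote_iff:
  assumes "H \<subseteq> carrier (pow n)"
  shows "(\<exists>x\<in>carrier (pow n). x \<notin> ball_around G n H r) \<longleftrightarrow>
    (\<exists>v\<in>cg.vecs n. \<forall>h\<in>vec n ` H. r < cg.ndiff v h)"
  using ball_around_iff[OF assms] vec_vecs vec_surj by metis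

lemma enc_vec_eq: "enc_vec e n x = encode (vec n x)"
  by (simp add: enc_vec_def vec_def encode_list_def o_def)

lemma enc_instance_eq: "enc_instance e n gens r = encode (n, map (vec n) gens, enc_binary r)"
proof -
  have "enc_list (map (enc_vec e n) gens) = encode (map (vec n) gens)"
    by (induction gens) (simp_all add: enc_vec_eq)
  then show ?thesis by (simp add: enc_instance_def encode_nat_def)
qed

end

theorem theorem5p2:
  fixes G :: "('a, 'm) monoid_scheme" and e :: "'a \<Rightarrow> tree" and c :: real
  assumes "group G" and "finite (carrier G)" and "card (carrier G) \<ge> 2"
    and "inj_on e (carrier G)"
    and "c > 0"
  shows "(\<forall>k :: nat \<Rightarrow> real. (\<forall>n. k n \<le> real n / 2) \<longrightarrow>
            (\<exists>P. rpp_algorithm G e k (\<lambda>n. c * real n * log 2 (k n) / k n) P)) \<and>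
         (\<exists>k0 :: real. \<forall>(k :: real) n H r.
            k0 \<le> k \<and> k \<le> real n / 2 \<and> subgroup H (power_group G n) \<and> delta G H \<le> k \<and>
            real r \<le> c * real n * log 2 k / k \<longrightarrow>
            (\<exists>x \<in> carrier (power_group G n). x \<notin> ball_around G n H r))"
proof -
  interpret coded_group G e
    using assms by (simp add: coded_group_def coded_group_axioms_def)
  let ?el = codes
  have q: "2 \<le> length ?el" using assms(3) by (simp add: length_codes)
  obtain C :: nat where C: "4 * c * length ?el * length ?el \<le> real C" using real_arch_simple by blast
  obtain B where B: "\<forall>b\<ge>B. 24 * C * blen b < b" using blen_small by blast
  define D where "D = (B + 3) * length ?el * length ?el"
  show ?thesis
  proof (intro conjI allI impI)
    fix k :: "nat \<Rightarrow> real" assume k: "\<forall>n. k n \<le> real n / 2"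
    \<comment> \<open>The third component is the binary radius as a bare tree. The program is
      determined by the codes, \<open>C\<close> and \<open>D\<close>, hence by the group, its coding
      and \<open>c\<close>.\<close>
    have "ptime (\<lambda>x :: nat \<times> tree list list \<times> tree. cg.rpp_solution C D (fst x) (fst (snd x)))"
      by (intro cg.ptime_rpp_solution ptime_intros)
    from ptime_computes_in[OF this] obtain P and p :: "nat poly" where
      P: "\<forall>x :: nat \<times> tree list list \<times> tree. \<exists>t. computes_in P (encode x) t (encode (cg.rpp_solution C D (fst x) (fst (snd x)))) \<and>
        t \<le> poly p (size (encode x))" by (elim exE) (rule that)
    have "\<forall>n gens r. set gens \<subseteq> carrier (pow n) \<longrightarrow> (\<exists>t output.
        computes_in P (enc_instance e n gens r) t output \<and>
        t \<le> poly p (size (enc_instance e n gens r)) \<and>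
        (let H = generate (pow n) (set gens) in
           delta G H \<le> k n \<and> real r \<le> c * real n * log 2 (k n) / k n \<and>
           (\<exists>x\<in>carrier (pow n). x \<notin> ball_around G n H r) \<longrightarrow>
           (\<exists>x\<in>carrier (pow n). output = enc_vec e n x \<and> x \<notin> ball_around G n H r)))"
      (is "\<forall>n gens r. _ \<longrightarrow> ?goal n gens r")
    proof (intro allI impI)
      fix n gens r assume gens: "set gens \<subseteq> carrier (power_group G n)"
      interpret Pg: group "pow n" by (rule group_pow)
      let ?gens = "map (vec n) gens" and ?H = "generate (pow n) (set gens)"
      let ?y = "cg.rpp_solution C D n ?gens"
      obtain t where t: "computes_in P (enc_instance e n gens r) t (encode ?y)"
        "t \<le> poly p (size (enc_instance e n gens r))"
        using P[THEN spec, of "(n, ?gens, enc_binary r)"] unfolding enc_instance_eq by auto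
      have Hsub: "subgroup ?H (pow n)" by (rule Pg.generate_is_subgroup[OF gens])
      note Hc = subgroup.subset[OF Hsub]
      have "\<exists>x\<in>carrier (pow n). encode ?y = enc_vec e n x \<and> x \<notin> ball_around G n ?H r"
        if h: "delta G ?H \<le> k n" "real r \<le> c * real n * log 2 (k n) / k n"
          "\<exists>x\<in>carrier (pow n). x \<notin> ball_around G n ?H r"
      proof -
        obtain x where x: "x \<in> carrier (pow n)" "vec n x = ?y"
          using vec_surj[OF cg.rpp_solution_vecs] by blast
        have "r < cg.ndiff ?y u" if "u \<in> vec n ` ?H" for u
        proof (rule cg.rpp_solution_correct[OF gensby_vec[OF gens] q assms(5) C B D_def _ _ h(2) _ that])
          show "log (length ?el) (card (vec n ` ?H)) \<le> k n"
            using h(1) by (simp only: card_vec[OF Hc] length_codes delta_def)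
          show "k n \<le> real n / 2" using k by blast
          show "\<exists>x\<in>cg.vecs n. \<forall>h\<in>vec n ` ?H. r < cg.ndiff x h"
            using h(3) exists_remote_iff[OF Hc] by blast
        qed
        then have "x \<notin> ball_around G n ?H r" using ball_around_iff[OF Hc x(1)] x(2) by simp
        moreover have "encode ?y = enc_vec e n x" by (simp only: enc_vec_eq x(2))
        ultimately show ?thesis using x(1) by blast
      qed
      then show "?goal n gens r" unfolding Let_def using t by blast
    qed
    then have "rpp_algorithm G e k (\<lambda>n. c * real n * log 2 (k n) / k n) P"
      unfolding rpp_algorithm_def by (rule exI)
    then show "\<exists>P. rpp_algorithm G e k (\<lambda>n. c * real n * log 2 (k n) / k n) P" ..
  next
    \<comment> \<open>\<open>B + 3\<close> serves as \<open>k0\<close>: beyond it, blocks of length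
      \<open>2 * k\<close> satisfy the estimate on \<open>blen\<close>, and \<open>log x / x\<close>
      is decreasing.\<close>
    have "\<exists>x\<in>carrier (pow n). x \<notin> ball_around G n H r"
      if h: "real (B + 3) \<le> k" "k \<le> real n / 2" "subgroup H (pow n)" "delta G H \<le> k"
        "real r \<le> c * real n * log 2 k / k" for k n H r
    proof -
      note Hc = subgroup.subset[OF h(3)]
      have "\<exists>x\<in>cg.vecs n. \<forall>h\<in>vec n ` H. r < cg.ndiff x h"
      proof (rule cg.remote_point_exists[OF lsub_vec[OF h(3)] q assms(5) C B h(1) _ h(2,5)])
        show "log (length ?el) (card (vec n ` H)) \<le> k"
          using h(4) by (simp only: card_vec[OF Hc] length_codes delta_def)
      qed
      then show ?thesis using exists_remote_iff[OF Hc] by blast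
    qed
    then show "\<exists>k0 :: real. \<forall>(k :: real) n H r.
            k0 \<le> k \<and> k \<le> real n / 2 \<and> subgroup H (power_group G n) \<and> delta G H \<le> k \<and>
            real r \<le> c * real n * log 2 k / k \<longrightarrow>
            (\<exists>x \<in> carrier (power_group G n). x \<notin> ball_around G n H r)"
      by blast
  qed
qed

end
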